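(* Let $\mathsf{k}$ be a field of characteristic $2$, let $G=\langle g\rangle\cong\mathbb{Z}/n\mathbb{Z}$ be the cyclic group of order $n$ with $n$ divisible by $2$, and let $V$ be the two-dimensional right $\mathsf{k}G$-module with basis $\{a,b\}$ and action $a\cdot g=a$, $b\cdot g=a+b$, regarded as a Yetter--Drinfeld module over $\mathsf{k}G$ concentrated in degree $g$ (that is, $V_g=V$). Let $\mathcal{B}(V)$ be its Nichols algebra. Then the Radford biproduct $\mathcal{B}(V)\#\mathsf{k}G$ is a pointed Hopf algebra of dimension $16n$ generated by $a$, $b$, and $g$, with (defining) relations $$g^n=1,\quad g^{-1}ag=a,\quad g^{-1}bg=a+b,$$ $$a^2=0,\quad b^4=0,\quad baba=abab,\quad b^2a=ab^2+aba.$$ The coproduct is determined by $$\Delta(g)=g\otimes g,\quad \Delta(a)=a\otimes 1+g\otimes a,\quad \Delta(b)=b\otimes 1+g\otimes b.$$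
   Context: Definition of the Nichols algebra and Radford biproduct used here. Write $v_1=a$, $v_2=b$. Let $Q$ be the quiver with vertex set $G$ and, for each $0\le j\le n-1$, exactly two arrows from $g^j$ to $g^{j+1}$, denoted $a^{i}_{g^j}$ ($i=1,2$), where $a^i_{g^j}$ corresponds to $g^j\otimes v_i$ in $B=\mathsf{k}G\otimes V$. For an arrow $\alpha$, $s(\alpha)$ and $t(\alpha)$ denote its source and target. For $v=\lambda_1v_1+\lambda_2v_2\in V$ identify $h\otimes v$ with $\lambda_1a^1_h+\lambda_2a^2_h$. The group $G$ acts on the span $B$ of the arrows on the left by $l\cdot(h\otimes v)=lh\otimes v$ and on the right by $(h\otimes v)\cdot l=hl\otimes (v\cdot l)$. Let $\mathsf{k}Q$ be the path coalgebra: the vector space with basis all paths $a_m\cdots a_2a_1$ (arrows with $s(a_{j+1})=t(a_j)$; vertices are paths of length $0$), with $\Delta(h)=h\otimes h$ for $h\in G$ and $\Delta(a_m\cdots a_1)=\sum_{i=0}^m a_m\cdots a_{i+1}\otimes a_i\cdots a_1$, where the empty products for $i=m$ and $i=0$ are read as $t(a_m)$ and $s(a_1)$ respectively. $\mathsf{k}Q$ is a pointed graded Hopf algebra with the following product. For a path $\alpha$ of length $m$ and a subset $d\subseteq\{1,\dots,q\}$ of cardinality $m$, let $d\alpha=((d\alpha)_q,\dots,(d\alpha)_1)$ be the unique sequence of vertices and arrows whose concatenation is $\alpha$ and whose arrows occupy exactly the positions in $d$. For paths $\alpha,\beta$ of lengths $m,m'$, $$\alpha\cdot\beta=\sum_{d}\big[(d\alpha)_{m+m'}\cdot(\overline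 d\beta)_{m+m'}\big]\cdots\big[(d\alpha)_1\cdot(\overline d\beta)_1\big],$$ the sum being over all $m$-element subsets $d$ of $\{1,\dots,m+m'\}$, where $\overline d$ is the complement of $d$, each factor $(d\alpha)_i\cdot(\overline d\beta)_i$ is given by the left or right action of $G$ on $B$ (exactly one of the two entries is an arrow, the other a vertex), and the square brackets are concatenated as paths (extended multilinearly). For two vertices the product is the product in $G$. The Nichols algebra $\mathcal{B}(V)$ is the subalgebra of $\mathsf{k}Q$ generated by $V$, identified with the span of the arrows $a=1\otimes v_1$ and $b=1\otimes v_2$ from $1$ to $g$. The Radford biproduct (bosonization) $\mathcal{B}(V)\#\mathsf{k}G$ is the subalgebra of $\mathsf{k}Q$ generated by $V$ and $G$; as an algebra it is the smash product, i.e. $\mathsf{k}G\otimes\mathcal{B}(V)$ with multiplication $(h\otimes x)(h'\otimes y)=hh'\otimes(x\cdot h')y$, where $h\otimes x$ is abbreviated $hx$. *)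

theory Defs
  imports Complex_Main "HOL-Library.Poly_Mapping" "HOL-Algebra.Generated_Groups"
begin

section \<open>Vector spaces with a distinguished basis\<close>

text \<open>
  The vector space with basis \<open>'x\<close> over \<open>'k\<close> is the type \<open>'x \<Rightarrow>\<^sub>0 'k\<close> of finitely supported
  functions.  The tensor product of the spaces with bases \<open>'x\<close> and \<open>'y\<close> is the space with
  basis \<open>'x \<times> 'y\<close>.  Over a field, \<open>C \<otimes> D\<close> embeds in it for subspaces \<open>C\<close> and \<open>D\<close>, as the span
  of the pure tensors.  A linear map defined on a subspace extends to the whole space, so maps
  between subspaces are represented by linear maps of the ambient spaces.
\<close>

definition pscale :: "'k::field \<Rightarrow> ('x \<Rightarrow>\<^sub>0 'k) \<Rightarrow> ('x \<Rightarrow>\<^sub>0 'k)" where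
  "pscale c x = Poly_Mapping.map ((*) c) x"

lemma lookup_pscale [simp]: "Poly_Mapping.lookup (pscale c x) p = c * Poly_Mapping.lookup x p"
  by (simp add: pscale_def Poly_Mapping.map.rep_eq when_def)

global_interpretation pm: vector_space "pscale :: 'k::field \<Rightarrow> ('x \<Rightarrow>\<^sub>0 'k) \<Rightarrow> _"
  by unfold_locales (auto intro!: poly_mapping_eqI simp: lookup_add algebra_simps)

abbreviation plinear :: "(('x \<Rightarrow>\<^sub>0 'k::field) \<Rightarrow> ('y \<Rightarrow>\<^sub>0 'k)) \<Rightarrow> bool" where
  "plinear \<equiv> Vector_Spaces.linear pscale pscale"

definition bas :: "'x \<Rightarrow> ('x \<Rightarrow>\<^sub>0 'k::field)" where
  "bas p = Poly_Mapping.single p 1"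

definition lin_ext :: "('x \<Rightarrow> ('y \<Rightarrow>\<^sub>0 'k::field)) \<Rightarrow> ('x \<Rightarrow>\<^sub>0 'k) \<Rightarrow> ('y \<Rightarrow>\<^sub>0 'k)" where
  "lin_ext f x = (\<Sum>p\<in>Poly_Mapping.keys x. pscale (Poly_Mapping.lookup x p) (f p))"

definition bilin_ext ::
    "('x \<Rightarrow> 'y \<Rightarrow> ('z \<Rightarrow>\<^sub>0 'k::field)) \<Rightarrow> ('x \<Rightarrow>\<^sub>0 'k) \<Rightarrow> ('y \<Rightarrow>\<^sub>0 'k) \<Rightarrow> ('z \<Rightarrow>\<^sub>0 'k)" where
  "bilin_ext f x y = lin_ext (\<lambda>p. lin_ext (f p) y) x"

definition bilinear_op :: "(('x \<Rightarrow>\<^sub>0 'k::field) \<Rightarrow> ('x \<Rightarrow>\<^sub>0 'k) \<Rightarrow> ('x \<Rightarrow>\<^sub>0 'k)) \<Rightarrow> bool" where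
  "bilinear_op M \<longleftrightarrow> (\<forall>x. plinear (M x)) \<and> (\<forall>y. plinear (\<lambda>x. M x y))"

definition tensor :: "('x \<Rightarrow>\<^sub>0 'k::field) \<Rightarrow> ('y \<Rightarrow>\<^sub>0 'k) \<Rightarrow> ('x \<times> 'y \<Rightarrow>\<^sub>0 'k)"  (infixr \<open>\<otimes>\<^sub>k\<close> 70) where
  "x \<otimes>\<^sub>k y = bilin_ext (\<lambda>p q. bas (p, q)) x y"

definition tensor_space ::
    "('x \<Rightarrow>\<^sub>0 'k::field) set \<Rightarrow> ('y \<Rightarrow>\<^sub>0 'k) set \<Rightarrow> ('x \<times> 'y \<Rightarrow>\<^sub>0 'k) set" where
  "tensor_space C D = pm.span {x \<otimes>\<^sub>k y | x y. x \<in> C \<and> y \<in> D}"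

definition tensor_mult ::
    "(('x \<Rightarrow>\<^sub>0 'k::field) \<Rightarrow> ('x \<Rightarrow>\<^sub>0 'k) \<Rightarrow> ('x \<Rightarrow>\<^sub>0 'k)) \<Rightarrow>
     ('x \<times> 'x \<Rightarrow>\<^sub>0 'k) \<Rightarrow> ('x \<times> 'x \<Rightarrow>\<^sub>0 'k) \<Rightarrow> ('x \<times> 'x \<Rightarrow>\<^sub>0 'k)" where
  "tensor_mult M =
     bilin_ext (\<lambda>(p, q) (p', q'). M (bas p) (bas p') \<otimes>\<^sub>k M (bas q) (bas q'))"


section \<open>Hopf algebras\<close>

definition algebra_on ::
    "('x \<Rightarrow>\<^sub>0 'k::field) set \<Rightarrow> (('x \<Rightarrow>\<^sub>0 'k) \<Rightarrow> ('x \<Rightarrow>\<^sub>0 'k) \<Rightarrow> ('x \<Rightarrow>\<^sub>0 'k)) \<Rightarrow> ('x \<Rightarrow>\<^sub>0 'k) \<Rightarrow> bool" where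
  "algebra_on H M u \<longleftrightarrow>
     pm.subspace H \<and> bilinear_op M \<and> u \<in> H \<and>
     (\<forall>x\<in>H. \<forall>y\<in>H. M x y \<in> H) \<and>
     (\<forall>x\<in>H. \<forall>y\<in>H. \<forall>z\<in>H. M (M x y) z = M x (M y z)) \<and>
     (\<forall>x\<in>H. M u x = x \<and> M x u = x)"

definition algebra_hom_on ::
    "('x \<Rightarrow>\<^sub>0 'k::field) set \<Rightarrow> (('x \<Rightarrow>\<^sub>0 'k) \<Rightarrow> ('x \<Rightarrow>\<^sub>0 'k) \<Rightarrow> ('x \<Rightarrow>\<^sub>0 'k)) \<Rightarrow> ('x \<Rightarrow>\<^sub>0 'k) \<Rightarrow>
     ('y \<Rightarrow>\<^sub>0 'k) set \<Rightarrow> (('y \<Rightarrow>\<^sub>0 'k) \<Rightarrow> ('y \<Rightarrow>\<^sub>0 'k) \<Rightarrow> ('y \<Rightarrow>\<^sub>0 'k)) \<Rightarrow> ('y \<Rightarrow>\<^sub>0 'k) \<Rightarrow>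
     (('x \<Rightarrow>\<^sub>0 'k) \<Rightarrow> ('y \<Rightarrow>\<^sub>0 'k)) \<Rightarrow> bool" where
  "algebra_hom_on H M u K N v f \<longleftrightarrow>
     plinear f \<and> f ` H \<subseteq> K \<and> f u = v \<and> (\<forall>x\<in>H. \<forall>y\<in>H. f (M x y) = N (f x) (f y))"

definition coalgebra_on ::
    "('x \<Rightarrow>\<^sub>0 'k::field) set \<Rightarrow> (('x \<Rightarrow>\<^sub>0 'k) \<Rightarrow> ('x \<times> 'x \<Rightarrow>\<^sub>0 'k)) \<Rightarrow> (('x \<Rightarrow>\<^sub>0 'k) \<Rightarrow> 'k) \<Rightarrow> bool" where
  "coalgebra_on C D e \<longleftrightarrow>
     pm.subspace C \<and> plinear D \<and> Vector_Spaces.linear pscale (*) e \<and>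
     D ` C \<subseteq> tensor_space C C \<and>
     (\<forall>x\<in>C.
        lin_ext (\<lambda>((p, q), r). bas (p, (q, r))) (lin_ext (\<lambda>(p, q). D (bas p) \<otimes>\<^sub>k bas q) (D x))
          = lin_ext (\<lambda>(p, q). bas p \<otimes>\<^sub>k D (bas q)) (D x) \<and>
        lin_ext (\<lambda>(p, q). pscale (e (bas p)) (bas q)) (D x) = x \<and>
        lin_ext (\<lambda>(p, q). pscale (e (bas q)) (bas p)) (D x) = x)"

definition bialgebra_on ::
    "('x \<Rightarrow>\<^sub>0 'k::field) set \<Rightarrow> (('x \<Rightarrow>\<^sub>0 'k) \<Rightarrow> ('x \<Rightarrow>\<^sub>0 'k) \<Rightarrow> ('x \<Rightarrow>\<^sub>0 'k)) \<Rightarrow> ('x \<Rightarrow>\<^sub>0 'k) \<Rightarrow>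
     (('x \<Rightarrow>\<^sub>0 'k) \<Rightarrow> ('x \<times> 'x \<Rightarrow>\<^sub>0 'k)) \<Rightarrow> (('x \<Rightarrow>\<^sub>0 'k) \<Rightarrow> 'k) \<Rightarrow> bool" where
  "bialgebra_on H M u D e \<longleftrightarrow>
     algebra_on H M u \<and> coalgebra_on H D e \<and>
     algebra_hom_on H M u (tensor_space H H) (tensor_mult M) (u \<otimes>\<^sub>k u) D \<and>
     e u = 1 \<and> (\<forall>x\<in>H. \<forall>y\<in>H. e (M x y) = e x * e y)"

definition hopf_algebra_on ::
    "('x \<Rightarrow>\<^sub>0 'k::field) set \<Rightarrow> (('x \<Rightarrow>\<^sub>0 'k) \<Rightarrow> ('x \<Rightarrow>\<^sub>0 'k) \<Rightarrow> ('x \<Rightarrow>\<^sub>0 'k)) \<Rightarrow> ('x \<Rightarrow>\<^sub>0 'k) \<Rightarrow>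
     (('x \<Rightarrow>\<^sub>0 'k) \<Rightarrow> ('x \<times> 'x \<Rightarrow>\<^sub>0 'k)) \<Rightarrow> (('x \<Rightarrow>\<^sub>0 'k) \<Rightarrow> 'k) \<Rightarrow> bool" where
  "hopf_algebra_on H M u D e \<longleftrightarrow>
     bialgebra_on H M u D e \<and>
     (\<exists>S. plinear S \<and> S ` H \<subseteq> H \<and>
        (\<forall>x\<in>H.
           lin_ext (\<lambda>(p, q). M (S (bas p)) (bas q)) (D x) = pscale (e x) u \<and>
           lin_ext (\<lambda>(p, q). M (bas p) (S (bas q))) (D x) = pscale (e x) u))"

definition subcoalgebra ::
    "('x \<Rightarrow>\<^sub>0 'k::field) set \<Rightarrow> (('x \<Rightarrow>\<^sub>0 'k) \<Rightarrow> ('x \<times> 'x \<Rightarrow>\<^sub>0 'k)) \<Rightarrow> ('x \<Rightarrow>\<^sub>0 'k) set \<Rightarrow> bool" where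
  "subcoalgebra C D E \<longleftrightarrow> pm.subspace E \<and> E \<subseteq> C \<and> D ` E \<subseteq> tensor_space E E"

definition simple_subcoalgebra ::
    "('x \<Rightarrow>\<^sub>0 'k::field) set \<Rightarrow> (('x \<Rightarrow>\<^sub>0 'k) \<Rightarrow> ('x \<times> 'x \<Rightarrow>\<^sub>0 'k)) \<Rightarrow> ('x \<Rightarrow>\<^sub>0 'k) set \<Rightarrow> bool" where
  "simple_subcoalgebra C D E \<longleftrightarrow>
     subcoalgebra C D E \<and> E \<noteq> {0} \<and> (\<forall>F. subcoalgebra C D F \<and> F \<subseteq> E \<longrightarrow> F = {0} \<or> F = E)"

definition pointed_on ::
    "('x \<Rightarrow>\<^sub>0 'k::field) set \<Rightarrow> (('x \<Rightarrow>\<^sub>0 'k) \<Rightarrow> ('x \<times> 'x \<Rightarrow>\<^sub>0 'k)) \<Rightarrow> bool" where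
  "pointed_on C D \<longleftrightarrow> (\<forall>E. simple_subcoalgebra C D E \<longrightarrow> pm.dim E = 1)"

definition subalgebra_generated ::
    "(('x \<Rightarrow>\<^sub>0 'k::field) \<Rightarrow> ('x \<Rightarrow>\<^sub>0 'k) \<Rightarrow> ('x \<Rightarrow>\<^sub>0 'k)) \<Rightarrow> ('x \<Rightarrow>\<^sub>0 'k) \<Rightarrow> ('x \<Rightarrow>\<^sub>0 'k) set \<Rightarrow>
     ('x \<Rightarrow>\<^sub>0 'k) set" where
  "subalgebra_generated M u X =
     \<Inter> {A. pm.subspace A \<and> u \<in> A \<and> X \<subseteq> A \<and> (\<forall>x\<in>A. \<forall>y\<in>A. M x y \<in> A)}"


section \<open>Free algebras and presentations\<close>

text \<open>
  Words form the free monoid, written additively, so that the multiplication of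
  \<^theory>\<open>HOL-Library.Poly_Mapping\<close> makes \<open>'l word \<Rightarrow>\<^sub>0 'k\<close> the free unital algebra on \<open>'l\<close>.
\<close>

datatype 'l word = Word (letters: "'l list")

instantiation word :: (type) monoid_add
begin

definition zero_word :: "'a word" where "0 = Word []"

definition plus_word :: "'a word \<Rightarrow> 'a word \<Rightarrow> 'a word" where
  "v + w = Word (letters v @ letters w)"

instance
  by standard (auto simp: zero_word_def plus_word_def)

end

definition var :: "'l \<Rightarrow> ('l word \<Rightarrow>\<^sub>0 'k::field)" where
  "var l = bas (Word [l])"

definition ideal_generated :: "'r::ring_1 set \<Rightarrow> 'r set" where
  "ideal_generated R =
     \<Inter> {I. R \<subseteq> I \<and> 0 \<in> I \<and> (\<forall>x\<in>I. \<forall>y\<in>I. x - y \<in> I) \<and> (\<forall>x\<in>I. \<forall>r. r * x \<in> I \<and> x * r \<in> I)}"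

definition free_eval ::
    "(('x \<Rightarrow>\<^sub>0 'k::field) \<Rightarrow> ('x \<Rightarrow>\<^sub>0 'k) \<Rightarrow> ('x \<Rightarrow>\<^sub>0 'k)) \<Rightarrow> ('x \<Rightarrow>\<^sub>0 'k) \<Rightarrow> ('l \<Rightarrow> ('x \<Rightarrow>\<^sub>0 'k)) \<Rightarrow>
     ('l word \<Rightarrow>\<^sub>0 'k) \<Rightarrow> ('x \<Rightarrow>\<^sub>0 'k)" where
  "free_eval M u f = lin_ext (\<lambda>w. foldr (\<lambda>l x. M (f l) x) (letters w) u)"

definition presented_by ::
    "('x \<Rightarrow>\<^sub>0 'k::field) set \<Rightarrow> (('x \<Rightarrow>\<^sub>0 'k) \<Rightarrow> ('x \<Rightarrow>\<^sub>0 'k) \<Rightarrow> ('x \<Rightarrow>\<^sub>0 'k)) \<Rightarrow> ('x \<Rightarrow>\<^sub>0 'k) \<Rightarrow>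
     ('l \<Rightarrow> ('x \<Rightarrow>\<^sub>0 'k)) \<Rightarrow> ('l word \<Rightarrow>\<^sub>0 'k) set \<Rightarrow> bool" where
  "presented_by H M u f R \<longleftrightarrow>
     H = subalgebra_generated M u (range f) \<and>
     {p. free_eval M u f p = 0} = ideal_generated R"


section \<open>The Hopf quiver and its path coalgebra\<close>

text \<open>
  \<open>Va\<close> and \<open>Vb\<close> index the basis \<open>v\<^sub>1 = a\<close>, \<open>v\<^sub>2 = b\<close> of \<open>V\<close>, so \<open>V\<close> is \<open>vbasis \<Rightarrow>\<^sub>0 'k\<close>.  A right
  \<open>kG\<close>-module structure is the same as a linear right action of \<open>G\<close>.
\<close>

datatype vbasis = Va | Vb

definition right_module ::
    "('g, 'm) monoid_scheme \<Rightarrow> (('v \<Rightarrow>\<^sub>0 'k::field) \<Rightarrow> 'g \<Rightarrow> ('v \<Rightarrow>\<^sub>0 'k)) \<Rightarrow> bool" where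
  "right_module G act \<longleftrightarrow>
     (\<forall>h\<in>carrier G. plinear (\<lambda>v. act v h)) \<and>
     (\<forall>v. act v \<one>\<^bsub>G\<^esub> = v) \<and>
     (\<forall>v. \<forall>h\<in>carrier G. \<forall>l\<in>carrier G. act v (h \<otimes>\<^bsub>G\<^esub> l) = act (act v h) l)"

text \<open>
  Since \<open>V\<close> is concentrated in degree \<open>g\<close>, the arrow \<open>h \<otimes> v\<^sub>i\<close> goes from \<open>h\<close> to \<open>hg\<close>.  Hence a path
  \<open>a\<^sub>m \<dots> a\<^sub>2 a\<^sub>1\<close> is determined by its source and the superscripts of its arrows.  The pair
  \<open>(h, [i\<^sub>1, \<dots>, i\<^sub>m])\<close> is the path starting at \<open>h\<close> whose \<open>j\<close>th arrow is \<open>h g\<^bsup>j-1\<^esup> \<otimes> v\<close> with \<open>v\<close> the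
  basis vector indexed by \<open>i\<^sub>j\<close>.  The list is in order of traversal, the reverse of the written
  order of arrows; \<open>(h, [])\<close> is the vertex \<open>h\<close>.
\<close>

type_synonym 'g path = "'g \<times> vbasis list"

definition vertex_after :: "('g, 'm) monoid_scheme \<Rightarrow> 'g \<Rightarrow> 'g path \<Rightarrow> nat \<Rightarrow> 'g" where
  "vertex_after G g p k = fst p \<otimes>\<^bsub>G\<^esub> (g [^]\<^bsub>G\<^esub> k)"

definition vertex :: "'g \<Rightarrow> ('g path \<Rightarrow>\<^sub>0 'k::field)" where
  "vertex h = bas (h, [])"

text \<open>The element \<open>h \<otimes> v\<close> of the span \<open>B\<close> of the arrows.\<close>

definition arrow :: "'g \<Rightarrow> (vbasis \<Rightarrow>\<^sub>0 'k::field) \<Rightarrow> ('g path \<Rightarrow>\<^sub>0 'k)" where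
  "arrow h v = lin_ext (\<lambda>i. bas (h, [i])) v"

definition path_comult ::
    "('g, 'm) monoid_scheme \<Rightarrow> 'g \<Rightarrow> ('g path \<Rightarrow>\<^sub>0 'k::field) \<Rightarrow> ('g path \<times> 'g path \<Rightarrow>\<^sub>0 'k)" where
  "path_comult G g = lin_ext (\<lambda>p. \<Sum>i\<le>length (snd p).
     bas (vertex_after G g p i, drop i (snd p)) \<otimes>\<^sub>k bas (fst p, take i (snd p)))"

definition path_counit :: "('g path \<Rightarrow>\<^sub>0 'k::field) \<Rightarrow> 'k" where
  "path_counit x = (\<Sum>p\<in>{p \<in> Poly_Mapping.keys x. snd p = []}. Poly_Mapping.lookup x p)"

text \<open>Concatenation in order of traversal: \<open>p\<close> first, then \<open>q\<close>.\<close>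

definition path_concat ::
    "('g, 'm) monoid_scheme \<Rightarrow> 'g \<Rightarrow> 'g path \<Rightarrow> 'g path \<Rightarrow> ('g path \<Rightarrow>\<^sub>0 'k::field)" where
  "path_concat G g p q =
     (if fst q = vertex_after G g p (length (snd p)) then bas (fst p, snd p @ snd q) else 0)"

fun concat_list ::
    "('g, 'm) monoid_scheme \<Rightarrow> 'g \<Rightarrow> ('g path \<Rightarrow>\<^sub>0 'k::field) list \<Rightarrow> ('g path \<Rightarrow>\<^sub>0 'k)" where
  "concat_list G g [] = 0"
| "concat_list G g [x] = x"
| "concat_list G g (x # y # zs) = bilin_ext (path_concat G g) x (concat_list G g (y # zs))"

text \<open>
  The entry \<open>(d\<alpha>)\<^sub>i\<close>: the arrow of \<open>\<alpha>\<close> put at position \<open>i\<close> if \<open>i \<in> d\<close>, and otherwise the vertex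
  reached by the arrows at earlier positions.
\<close>

definition thin :: "('g, 'm) monoid_scheme \<Rightarrow> 'g \<Rightarrow> nat set \<Rightarrow> 'g path \<Rightarrow> nat \<Rightarrow> 'g path" where
  "thin G g d p i =
     (let k = card (d \<inter> {1..<i})
      in (vertex_after G g p k, if i \<in> d then [snd p ! k] else []))"

text \<open>The left and right actions of \<open>G\<close> on \<open>B\<close>.\<close>

definition entry_mult ::
    "('g, 'm) monoid_scheme \<Rightarrow> ((vbasis \<Rightarrow>\<^sub>0 'k::field) \<Rightarrow> 'g \<Rightarrow> (vbasis \<Rightarrow>\<^sub>0 'k)) \<Rightarrow>
     'g path \<Rightarrow> 'g path \<Rightarrow> ('g path \<Rightarrow>\<^sub>0 'k)" where
  "entry_mult G act p q =
     (case (p, q) of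
        ((l, []), (h, [i])) \<Rightarrow> arrow (l \<otimes>\<^bsub>G\<^esub> h) (bas i)
      | ((h, [i]), (l, [])) \<Rightarrow> arrow (h \<otimes>\<^bsub>G\<^esub> l) (act (bas i) l)
      | _ \<Rightarrow> 0)"

definition path_mult_basis ::
    "('g, 'm) monoid_scheme \<Rightarrow> 'g \<Rightarrow> ((vbasis \<Rightarrow>\<^sub>0 'k::field) \<Rightarrow> 'g \<Rightarrow> (vbasis \<Rightarrow>\<^sub>0 'k)) \<Rightarrow>
     'g path \<Rightarrow> 'g path \<Rightarrow> ('g path \<Rightarrow>\<^sub>0 'k)" where
  "path_mult_basis G g act p q =
     (let m = length (snd p); N = m + length (snd q)
      in if N = 0 then vertex (fst p \<otimes>\<^bsub>G\<^esub> fst q)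
         else \<Sum>d | d \<subseteq> {1..N} \<and> card d = m.
                concat_list G g
                  (map (\<lambda>i. entry_mult G act (thin G g d p i) (thin G g ({1..N} - d) q i)) [1..<N + 1]))"

definition path_mult ::
    "('g, 'm) monoid_scheme \<Rightarrow> 'g \<Rightarrow> ((vbasis \<Rightarrow>\<^sub>0 'k::field) \<Rightarrow> 'g \<Rightarrow> (vbasis \<Rightarrow>\<^sub>0 'k)) \<Rightarrow>
     ('g path \<Rightarrow>\<^sub>0 'k) \<Rightarrow> ('g path \<Rightarrow>\<^sub>0 'k) \<Rightarrow> ('g path \<Rightarrow>\<^sub>0 'k)" where
  "path_mult G g act = bilin_ext (path_mult_basis G g act)"

definition nichols_algebra ::
    "('g, 'm) monoid_scheme \<Rightarrow> 'g \<Rightarrow> ((vbasis \<Rightarrow>\<^sub>0 'k::field) \<Rightarrow> 'g \<Rightarrow> (vbasis \<Rightarrow>\<^sub>0 'k)) \<Rightarrow>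
     ('g path \<Rightarrow>\<^sub>0 'k) set" where
  "nichols_algebra G g act =
     subalgebra_generated (path_mult G g act) (vertex \<one>\<^bsub>G\<^esub>) (range (arrow \<one>\<^bsub>G\<^esub>))"

definition radford_biproduct ::
    "('g, 'm) monoid_scheme \<Rightarrow> 'g \<Rightarrow> ((vbasis \<Rightarrow>\<^sub>0 'k::field) \<Rightarrow> 'g \<Rightarrow> (vbasis \<Rightarrow>\<^sub>0 'k)) \<Rightarrow>
     ('g path \<Rightarrow>\<^sub>0 'k) set" where
  "radford_biproduct G g act =
     subalgebra_generated (path_mult G g act) (vertex \<one>\<^bsub>G\<^esub>)
       (range (arrow \<one>\<^bsub>G\<^esub>) \<union> vertex ` carrier G)"

lemma radford_biproduct_nichols:
  "radford_biproduct G g act =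
     subalgebra_generated (path_mult G g act) (vertex \<one>\<^bsub>G\<^esub>)
       (nichols_algebra G g act \<union> vertex ` carrier G)"
  unfolding radford_biproduct_def nichols_algebra_def subalgebra_generated_def
  by (rule arg_cong[where f = Inter]) blast


section \<open>Generators and relations\<close>

datatype gen = Gen_a | Gen_b | Gen_g

fun gen_val :: "('g, 'm) monoid_scheme \<Rightarrow> 'g \<Rightarrow> gen \<Rightarrow> ('g path \<Rightarrow>\<^sub>0 'k::field)" where
  "gen_val G g Gen_a = arrow \<one>\<^bsub>G\<^esub> (bas Va)"
| "gen_val G g Gen_b = arrow \<one>\<^bsub>G\<^esub> (bas Vb)"
| "gen_val G g Gen_g = vertex g"

text \<open>The first relation makes \<open>g\<^bsup>n-1\<^esup>\<close> the inverse of \<open>g\<close>, so it stands for \<open>g\<^bsup>-1\<^esup>\<close> below.\<close>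

definition biproduct_relations :: "nat \<Rightarrow> (gen word \<Rightarrow>\<^sub>0 'k::field) set" where
  "biproduct_relations n =
     (let a = var Gen_a; b = var Gen_b; g = var Gen_g; g_inv = g ^ (n - 1) in
      {g ^ n - 1, g_inv * a * g - a, g_inv * b * g - (a + b),
       a ^ 2, b ^ 4, b * a * b * a - a * b * a * b, b ^ 2 * a - (a * b ^ 2 + a * b * a)})"

end

theory Submission
  imports Defs "HOL-Algebra.Multiplicative_Group"
begin

text \<open>
  Let \<open>\<partial>\<^sub>i\<close> remove the last arrow of a path if it has superscript \<open>i\<close>.  These operators are skew
  derivations of the product of \<open>kQ\<close>, and an element of positive degree is determined by its
  derivatives, so that all identities between products follow by induction on the degree:
  associativity, multiplicativity of the coproduct, and antimultiplicativity of the antipode.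
  Pointedness holds because a nonzero subcoalgebra contains a vertex.

  The relations are checked with the same derivations, in which \<open>b \<cdot> g = a + b\<close> and characteristic
  \<open>2\<close> enter.  They reduce every word to one of the \<open>16n\<close> words \<open>g\<^sup>k w b\<^sup>l\<close> with \<open>w \<in> {1, a, ba, aba}\<close>.  These
  stay independent in \<open>kQ\<close>: multiplying a linear relation by powers of \<open>b\<close> on the right and by
  \<open>aba\<close>, \<open>ab\<close>, \<open>a\<close> on the left isolates its coefficients in front of \<open>abab\<^sup>3\<close>, which is not \<open>0\<close>.
\<close>

section \<open>Linear and bilinear extension\<close>

text \<open>The Leibniz rule is skew: if the last arrow of a product xy comes from x, it is acted on
  from the right by the vertex at which y ends. For the twist to be one matrix, all paths of y must
  end at the same vertex; hence identities are proved for elements of fixed source and degree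
  (\<open>homog\<close>) and then extended linearly. Cyclicity of G enters the Hopf structure as
  commutativity, which lets powers of g move past other vertices. The coproduct leaves the end of a
  path in its left tensor factor, so on the tensor square the derivations act on that factor. The
  antipode reverses paths and exchanges last arrows with first ones, which calls for a second family
  of skew derivations, \<open>front_deriv\<close>, twisted by the source of y instead of its end.
  Since g^m sends b to b + m a, the derivative of bx by a depends on the parity of the degree of x.
  The relations for b^2 a and baba come from comparing derivatives computed with this
  parity.\<close>

named_theorems lin_intros

abbreviation coeff_at :: "('x \<Rightarrow>\<^sub>0 'k::field) \<Rightarrow> 'x \<Rightarrow> 'k" where
  "coeff_at \<equiv> Poly_Mapping.lookup"

abbreviation supp :: "('x \<Rightarrow>\<^sub>0 'k::field) \<Rightarrow> 'x set" where
  "supp \<equiv> Poly_Mapping.keys"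

global_interpretation pmp: vector_space_pair
  "pscale :: 'k::field \<Rightarrow> ('x \<Rightarrow>\<^sub>0 'k) \<Rightarrow> _" "pscale :: 'k::field \<Rightarrow> ('y \<Rightarrow>\<^sub>0 'k) \<Rightarrow> _"
  by unfold_locales

lemma plinearI:
  assumes "\<And>x y. f (x + y) = f x + f y" "\<And>c x. f (pscale c x) = pscale c (f x)"
  shows "plinear f"
  by (intro Vector_Spaces.linear.intro module_hom.intro module_hom_axioms.intro
      pm.module_axioms pm.vector_space_axioms assms)

lemma plinear_add: "plinear f \<Longrightarrow> f (x + y) = f x + f y"
  by (rule pmp.linear_add)

lemma plinear_scale: "plinear f \<Longrightarrow> f (pscale c x) = pscale c (f x)"
  by (rule pmp.linear_scale)

lemma plinear_zero: "plinear f \<Longrightarrow> f 0 = 0"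
  by (rule pmp.linear_0)

lemma plinear_sum: "plinear f \<Longrightarrow> f (\<Sum>i\<in>A. h i) = (\<Sum>i\<in>A. f (h i))"
  by (rule pmp.linear_sum)

lemma pscale_sum: "pscale c (\<Sum>i\<in>A. h i) = (\<Sum>i\<in>A. pscale c (h i))"
  by (rule pm.scale_sum_right)

lemma uminus_conv_pscale: "- x = pscale (-1) x"
  by (rule poly_mapping_eqI) simp

lemma lookup_bas: "coeff_at (bas p) q = (if p = q then 1 else 0)"
  by (simp add: bas_def lookup_single when_def)

lemma keys_bas [simp]: "supp (bas p) = {p}"
  by (simp add: bas_def)

lemma bas_neq_0 [simp]: "bas p \<noteq> 0"
  using keys_bas[of p] by (metis insert_not_empty keys_zero)

lemma keys_pscale: "supp (pscale c x) \<subseteq> supp x"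
  by (auto simp: in_keys_iff)

lemma keys_sum_subset: "supp (\<Sum>i\<in>A. f i) \<subseteq> (\<Union>i\<in>A. supp (f i))"
proof
  fix p assume "p \<in> supp (\<Sum>i\<in>A. f i)"
  then have "(\<Sum>i\<in>A. coeff_at (f i) p) \<noteq> 0" by (simp add: in_keys_iff lookup_sum)
  then obtain i where "i \<in> A" "coeff_at (f i) p \<noteq> 0" by (meson sum.neutral)
  then show "p \<in> (\<Union>i\<in>A. supp (f i))" by (auto simp: in_keys_iff)
qed

text \<open>The supports of x, y and x + y differ; over a common finite superset the defining sums
  can be added term by term.\<close>

lemma lin_ext_superset:
  assumes "finite A" "supp x \<subseteq> A"
  shows "lin_ext f x = (\<Sum>p\<in>A. pscale (coeff_at x p) (f p))"
  unfolding lin_ext_def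
  by (rule sum.mono_neutral_left) (use assms in \<open>auto simp: in_keys_iff\<close>)

lemma linear_lin_ext:
  fixes f :: "'x \<Rightarrow> ('y \<Rightarrow>\<^sub>0 'k::field)"
  shows "plinear (lin_ext f)"
proof (rule plinearI)
  fix x y :: "'x \<Rightarrow>\<^sub>0 'k"
  let ?A = "supp x \<union> supp y"
  have "lin_ext f (x + y) = (\<Sum>p\<in>?A. pscale (coeff_at (x + y) p) (f p))"
    by (rule lin_ext_superset) (auto simp: Poly_Mapping.keys_add)
  also have "\<dots> = (\<Sum>p\<in>?A. pscale (coeff_at x p) (f p)) + (\<Sum>p\<in>?A. pscale (coeff_at y p) (f p))"
    by (simp add: lookup_add pm.scale_left_distrib sum.distrib)
  also have "\<dots> = lin_ext f x + lin_ext f y"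
    by (subst (1 2) lin_ext_superset[of ?A]) auto
  finally show "lin_ext f (x + y) = lin_ext f x + lin_ext f y" .
next
  fix c :: 'k and x :: "'x \<Rightarrow>\<^sub>0 'k"
  have "lin_ext f (pscale c x) = (\<Sum>p\<in>supp x. pscale (coeff_at (pscale c x) p) (f p))"
    by (rule lin_ext_superset) (auto simp: keys_pscale)
  then show "lin_ext f (pscale c x) = pscale c (lin_ext f x)"
    by (simp add: lin_ext_def pscale_sum)
qed

lemma lin_ext_bas [simp]: "lin_ext f (bas p) = f p"
  by (simp add: lin_ext_def lookup_bas)

lemma bas_expansion: "x = (\<Sum>p\<in>supp x. pscale (coeff_at x p) (bas p))"
proof (rule poly_mapping_eqI)
  fix q
  have "coeff_at (\<Sum>p\<in>supp x. pscale (coeff_at x p) (bas p)) q =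
      (\<Sum>p\<in>supp x. if p = q then coeff_at x p else 0)"
    unfolding lookup_sum by (rule sum.cong) (auto simp: lookup_bas)
  also have "\<dots> = coeff_at x q"
    by (simp add: in_keys_iff)
  finally show "coeff_at x q = coeff_at (\<Sum>p\<in>supp x. pscale (coeff_at x p) (bas p)) q" by simp
qed

lemma plinear_expand:
  assumes "plinear f"
  shows "f x = (\<Sum>p\<in>supp x. pscale (coeff_at x p) (f (bas p)))"
  by (subst bas_expansion[of x]) (simp add: plinear_sum[OF assms] plinear_scale[OF assms])

text \<open>Agreement is required only on the basis elements that occur in \<open>x\<close>.
  Equations valid just for paths of one source and length, or for sources in G, can therefore still
  be checked on a basis.\<close>

lemma plinear_eqI:
  assumes "plinear f" "plinear f'" "\<And>p. p \<in> supp x \<Longrightarrow> f (bas p) = f' (bas p)"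
  shows "f x = f' x"
  unfolding plinear_expand[OF assms(1), of x] plinear_expand[OF assms(2), of x]
  using assms(3) by (intro sum.cong) auto

lemma supp_plinear:
  assumes "plinear f" "\<And>p. p \<in> supp x \<Longrightarrow> supp (f (bas p)) \<subseteq> A"
  shows "supp (f x) \<subseteq> A"
proof -
  have "supp (f x) \<subseteq> (\<Union>p\<in>supp x. supp (pscale (coeff_at x p) (f (bas p))))"
    by (subst plinear_expand[OF assms(1)]) (rule keys_sum_subset)
  also have "\<dots> \<subseteq> A"
    using assms(2) keys_pscale by fast
  finally show ?thesis .
qed

lemma plinear_ident [lin_intros]: "plinear (\<lambda>x. x)"
  by (rule plinearI) auto

lemma plinear_const_zero [lin_intros]: "plinear (\<lambda>x. 0)"
  by (rule plinearI) auto

lemma plinear_plus [lin_intros]: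
  "plinear f \<Longrightarrow> plinear f' \<Longrightarrow> plinear (\<lambda>x. f x + f' x)"
  by (rule plinearI) (auto simp: plinear_add plinear_scale algebra_simps pm.scale_right_distrib)

lemma plinear_pscale [lin_intros]: "plinear f \<Longrightarrow> plinear (\<lambda>x. pscale c (f x))"
  by (rule plinearI) (auto simp: plinear_add plinear_scale pm.scale_right_distrib mult.commute)

lemma plinear_uminus [lin_intros]: "plinear f \<Longrightarrow> plinear (\<lambda>x. - f x)"
  unfolding uminus_conv_pscale by (rule plinear_pscale)

lemma plinear_setsum [lin_intros]:
  "(\<And>i. i \<in> A \<Longrightarrow> plinear (f i)) \<Longrightarrow> plinear (\<lambda>x. \<Sum>i\<in>A. f i x)"
  by (rule plinearI) (auto simp: plinear_add plinear_scale sum.distrib pscale_sum)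

lemma plinear_compose: "plinear f \<Longrightarrow> plinear h \<Longrightarrow> plinear (\<lambda>x. f (h x))"
  by (rule plinearI) (auto simp: plinear_add plinear_scale)

lemma plinear_lin_ext [lin_intros]: "plinear h \<Longrightarrow> plinear (\<lambda>x. lin_ext f (h x))"
  by (rule plinear_compose[OF linear_lin_ext])

lemma plinear_lin_ext_fun:
  assumes "\<And>p. plinear (\<lambda>x. F p x)"
  shows "plinear (\<lambda>x. lin_ext (\<lambda>p. F p x) y)"
  unfolding lin_ext_def by (intro lin_intros assms)

lemma plinear_bilin_ext_left [lin_intros]: "plinear h \<Longrightarrow> plinear (\<lambda>x. bilin_ext f (h x) y)"
  unfolding bilin_ext_def by (intro lin_intros)

lemma plinear_bilin_ext_right [lin_intros]:
  assumes "plinear h" shows "plinear (\<lambda>y. bilin_ext f x (h y))"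
  unfolding bilin_ext_def by (rule plinear_lin_ext_fun) (intro lin_intros assms)

lemma bilin_ext_bas [simp]: "bilin_ext f (bas p) (bas q) = f p q"
  by (simp add: bilin_ext_def)

lemma bilinear_op_bilin_ext: "bilinear_op (bilin_ext f)"
  unfolding bilinear_op_def by (intro allI conjI plinear_bilin_ext_left plinear_bilin_ext_right plinear_ident)

lemma plinear_eq2I:
  assumes "\<And>y. plinear (\<lambda>x. f x y)" "\<And>x. plinear (f x)"
    "\<And>y. plinear (\<lambda>x. f' x y)" "\<And>x. plinear (f' x)"
    "\<And>p q. p \<in> supp x \<Longrightarrow> q \<in> supp y \<Longrightarrow> f (bas p) (bas q) = f' (bas p) (bas q)"
  shows "f x y = f' x y"
proof (rule plinear_eqI[of "\<lambda>x. f x y" "\<lambda>x. f' x y", OF assms(1,3)])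
  fix p assume "p \<in> supp x"
  then show "f (bas p) y = f' (bas p) y"
    using plinear_eqI[of "f (bas p)" "f' (bas p)" y, OF assms(2,4)] assms(5) by blast
qed

section \<open>Tensor products\<close>

lemma plinear_tensor_left [lin_intros]: "plinear h \<Longrightarrow> plinear (\<lambda>x. h x \<otimes>\<^sub>k y)"
  unfolding tensor_def by (intro lin_intros)

lemma plinear_tensor_right [lin_intros]: "plinear h \<Longrightarrow> plinear (\<lambda>y. x \<otimes>\<^sub>k h y)"
  unfolding tensor_def by (intro lin_intros)

lemma tensor_bas [simp]: "bas p \<otimes>\<^sub>k bas q = bas (p, q)"
  by (simp add: tensor_def)

text \<open>The universal property of the tensor product; it evaluates basis formulas such as those
  in the antipode axioms on arbitrary pure tensors.\<close>

lemma lin_ext_tensor: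
  assumes "\<And>y. plinear (\<lambda>x. f x y)" "\<And>x. plinear (f x)"
  shows "lin_ext (\<lambda>(p, q). f (bas p) (bas q)) (x \<otimes>\<^sub>k y) = f x y"
  by (rule plinear_eq2I[where x = x and y = y]) (intro lin_intros assms | simp)+

lemma tensor_lookup: "coeff_at (x \<otimes>\<^sub>k y) (p, q) = coeff_at x p * coeff_at y q"
proof -
  have "coeff_at (x \<otimes>\<^sub>k y) (p, q) =
      (\<Sum>p'\<in>supp x. \<Sum>q'\<in>supp y. coeff_at x p' * (coeff_at y q' * (if (p', q') = (p, q) then 1 else 0)))"
    by (simp add: tensor_def bilin_ext_def lin_ext_def lookup_sum lookup_bas sum_distrib_left)
  also have "\<dots> = (\<Sum>p'\<in>supp x. if p' = p then coeff_at x p * coeff_at y q else 0)"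
    by (rule sum.cong) (auto simp: in_keys_iff if_distrib cong: if_cong)
  also have "\<dots> = coeff_at x p * coeff_at y q"
    by (auto simp: in_keys_iff)
  finally show ?thesis .
qed

lemma subspace_tensor_space: "pm.subspace (tensor_space C D)"
  by (simp add: tensor_space_def)

lemma tensor_in_tensor_space: "x \<in> C \<Longrightarrow> y \<in> D \<Longrightarrow> x \<otimes>\<^sub>k y \<in> tensor_space C D"
  unfolding tensor_space_def by (rule pm.span_base) auto

text \<open>A multiple of a pure tensor is pure again because \<open>C\<close> is a subspace, so
  scalars need no case of their own.\<close>

lemma tensor_space_induct [consumes 2, case_names zero add pure]:
  assumes "z \<in> tensor_space C D" "pm.subspace C"
    and "P 0" "\<And>z z'. P z \<Longrightarrow> P z' \<Longrightarrow> P (z + z')" "\<And>x y. x \<in> C \<Longrightarrow> y \<in> D \<Longrightarrow> P (x \<otimes>\<^sub>k y)"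
  shows "P z"
  using assms(1) unfolding tensor_space_def
proof (induction rule: pm.span_induct_alt)
  case base
  show ?case by fact
next
  case (step c z' z)
  then obtain x y where z': "z' = x \<otimes>\<^sub>k y" "x \<in> C" "y \<in> D" by auto
  have "pscale c (x \<otimes>\<^sub>k y) = pscale c x \<otimes>\<^sub>k y"
    by (rule plinear_scale[symmetric]) (intro lin_intros)
  with z' show ?case
    using assms(2,4,5) step.IH by (metis pm.subspace_scale)
qed

lemma plinear_tensor_mult_left [lin_intros]: "plinear h \<Longrightarrow> plinear (\<lambda>x. tensor_mult M (h x) y)"
  unfolding tensor_mult_def by (intro lin_intros)

lemma plinear_tensor_mult_right [lin_intros]: "plinear h \<Longrightarrow> plinear (\<lambda>y. tensor_mult M x (h y))"
  unfolding tensor_mult_def by (intro lin_intros)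

lemma tensor_mult_bas:
  "tensor_mult M (bas (p, q)) (bas (p', q')) = M (bas p) (bas p') \<otimes>\<^sub>k M (bas q) (bas q')"
  by (simp add: tensor_mult_def)

lemma bilinear_op_left: "bilinear_op M \<Longrightarrow> plinear h \<Longrightarrow> plinear (\<lambda>x. M (h x) y)"
  unfolding bilinear_op_def by (rule plinear_compose[of "\<lambda>x. M x y"]) auto

lemma bilinear_op_right: "bilinear_op M \<Longrightarrow> plinear h \<Longrightarrow> plinear (\<lambda>y. M x (h y))"
  unfolding bilinear_op_def by (rule plinear_compose[of "M x"]) auto

lemma tensor_mult_tensor:
  assumes M: "bilinear_op M"
  shows "tensor_mult M (x \<otimes>\<^sub>k y) (x' \<otimes>\<^sub>k y') = M x x' \<otimes>\<^sub>k M y y'"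
proof -
  note [lin_intros] = bilinear_op_left[OF M] bilinear_op_right[OF M]
  have *: "tensor_mult M (bas p \<otimes>\<^sub>k bas q) (x' \<otimes>\<^sub>k y') = M (bas p) x' \<otimes>\<^sub>k M (bas q) y'" for p q
    by (rule plinear_eq2I[where x = x' and y = y'])
      (intro lin_intros | simp add: tensor_mult_bas)+
  show ?thesis
    by (rule plinear_eq2I[where x = x and y = y]) (intro lin_intros | simp add: *[unfolded tensor_bas])+
qed

lemma tensor_space_mult_closed:
  assumes M: "bilinear_op M" and H: "pm.subspace H" "\<And>x y. x \<in> H \<Longrightarrow> y \<in> H \<Longrightarrow> M x y \<in> H"
    and z: "z \<in> tensor_space H H" and z': "z' \<in> tensor_space H H"
  shows "tensor_mult M z z' \<in> tensor_space H H"
  using z H(1)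
proof (induction rule: tensor_space_induct)
  case zero
  have "tensor_mult M 0 z' = 0" by (rule plinear_zero) (intro lin_intros)
  then show ?case by (simp add: subspace_tensor_space pm.subspace_0)
next
  case (add z1 z2)
  have "tensor_mult M (z1 + z2) z' = tensor_mult M z1 z' + tensor_mult M z2 z'"
    by (rule plinear_add) (intro lin_intros)
  with add show ?case by (simp add: subspace_tensor_space pm.subspace_add)
next
  case (pure x y)
  show ?case using z' H(1)
  proof (induction rule: tensor_space_induct)
    case zero
    have "tensor_mult M (x \<otimes>\<^sub>k y) 0 = 0" by (rule plinear_zero) (intro lin_intros)
    then show ?case by (simp add: subspace_tensor_space pm.subspace_0)
  next
    case (add z1 z2)
    have "tensor_mult M (x \<otimes>\<^sub>k y) (z1 + z2) = tensor_mult M (x \<otimes>\<^sub>k y) z1 + tensor_mult M (x \<otimes>\<^sub>k y) z2"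
      by (rule plinear_add) (intro lin_intros)
    with add show ?case by (simp add: subspace_tensor_space pm.subspace_add)
  next
    case (pure x' y')
    then show ?case
      using \<open>x \<in> H\<close> \<open>y \<in> H\<close> by (simp add: tensor_mult_tensor[OF M] tensor_in_tensor_space H)
  qed
qed

section \<open>Generated subalgebras\<close>

lemma subspace_subalgebra_generated: "pm.subspace (subalgebra_generated M u X)"
  unfolding subalgebra_generated_def by (rule pm.subspace_Inter) auto

lemma subalgebra_generated_unit: "u \<in> subalgebra_generated M u X"
  and subalgebra_generated_base: "x \<in> X \<Longrightarrow> x \<in> subalgebra_generated M u X"
  unfolding subalgebra_generated_def by auto

lemma subalgebra_generated_mult:
  "x \<in> subalgebra_generated M u X \<Longrightarrow> y \<in> subalgebra_generated M u X \<Longrightarrow> M x y \<in> subalgebra_generated M u X"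
  unfolding subalgebra_generated_def by auto

lemma subalgebra_generated_least:
  assumes "pm.subspace A" "u \<in> A" "X \<subseteq> A" "\<And>x y. x \<in> A \<Longrightarrow> y \<in> A \<Longrightarrow> M x y \<in> A"
  shows "subalgebra_generated M u X \<subseteq> A"
  using assms unfolding subalgebra_generated_def by auto

section \<open>The path coalgebra and its product\<close>

text \<open>The pure tensor of the vectors \<open>vs\<close> in a tensor power, with the words of
  that length as basis. It is the concatenation of arrows labelled by these vectors, without the
  source.\<close>

definition tens :: "('x \<Rightarrow>\<^sub>0 'k::field) list \<Rightarrow> ('x list \<Rightarrow>\<^sub>0 'k)" where
  "tens vs = foldr (bilin_ext (\<lambda>i w. bas (i # w))) vs (bas [])"

lemma tens_Nil [simp]: "tens [] = bas []"
  and tens_Cons: "tens (v # vs) = bilin_ext (\<lambda>i w. bas (i # w)) v (tens vs)"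
  by (simp_all add: tens_def)

text \<open>\<open>tens\<close> grows at the front, while derivatives look at the end; associativity
  of the tensor product reconciles the two.\<close>

lemma tens_snoc: "tens (vs @ [v]) = bilin_ext (\<lambda>w i. bas (w @ [i])) (tens vs) v"
proof (induction vs)
  case Nil
  show ?case
    by (simp add: tens_Cons) (rule plinear_eqI[where x = v]; (intro lin_intros)?; simp)
next
  case (Cons u vs)
  have "bilin_ext (\<lambda>i w. bas (i # w)) u (bilin_ext (\<lambda>w i. bas (w @ [i])) t v) =
     bilin_ext (\<lambda>w i. bas (w @ [i])) (bilin_ext (\<lambda>i w. bas (i # w)) u t) v" for t
  proof (rule plinear_eqI[where x = v])
    fix i
    show "bilin_ext (\<lambda>i w. bas (i # w)) u (bilin_ext (\<lambda>w i. bas (w @ [i])) t (bas i)) =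
      bilin_ext (\<lambda>w i. bas (w @ [i])) (bilin_ext (\<lambda>i w. bas (i # w)) u t) (bas i)"
      by (rule plinear_eq2I[where x = u and y = t]) (intro lin_intros | simp)+
  qed (intro lin_intros)+
  then show ?case by (simp add: tens_Cons Cons.IH)
qed

text \<open>Pulling coefficients back along the injection w -> w @ [i] strips a final
  \<open>i\<close> and kills the words without one, and makes every coefficient of the result
  explicit.\<close>

definition last_deriv :: "'x \<Rightarrow> ('x list \<Rightarrow>\<^sub>0 'k::field) \<Rightarrow> ('x list \<Rightarrow>\<^sub>0 'k)" where
  "last_deriv i = Poly_Mapping.map_key (\<lambda>w. w @ [i])"

lemma lookup_last_deriv [simp]: "coeff_at (last_deriv i t) w = coeff_at t (w @ [i])"
  unfolding last_deriv_def by (subst map_key.rep_eq) (auto simp: inj_def)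

lemma plinear_last_deriv [lin_intros]: "plinear h \<Longrightarrow> plinear (\<lambda>x. last_deriv i (h x))"
  by (rule plinearI) (auto intro!: poly_mapping_eqI simp: plinear_add plinear_scale lookup_add)

lemma last_deriv_Nil [simp]: "last_deriv i (bas []) = 0"
  by (rule poly_mapping_eqI) (simp add: lookup_bas)

lemma last_deriv_snoc [simp]: "last_deriv i (bas (w @ [j])) = (if i = j then bas w else 0)"
  by (rule poly_mapping_eqI) (auto simp: lookup_bas split: if_splits)

lemma last_deriv_tens_snoc:
  "last_deriv i (tens (vs @ [v])) = pscale (coeff_at v i) (tens vs)"
proof -
  have "last_deriv i (bilin_ext (\<lambda>w i. bas (w @ [i])) t v) = pscale (coeff_at v i) t" for t
  proof (rule plinear_eq2I[where x = t and y = v])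
    show "plinear (\<lambda>y. pscale (coeff_at y i) x)" for x :: "'a list \<Rightarrow>\<^sub>0 'b"
      by (rule plinearI) (auto simp: lookup_add pm.scale_left_distrib)
    show "last_deriv i (bilin_ext (\<lambda>w i. bas (w @ [i])) (bas p) (bas q)) = pscale (coeff_at (bas q) i) (bas p)"
      for p q by (rule poly_mapping_eqI) (auto simp: lookup_bas)
  qed (intro lin_intros)+
  then show ?thesis by (simp add: tens_snoc)
qed

lemma supp_tens: "supp (tens vs) \<subseteq> {w. length w = length vs}"
proof (induction vs)
  case (Cons v vs)
  show ?case unfolding tens_Cons
  proof (rule supp_plinear[where x = v])
    fix i
    show "supp (bilin_ext (\<lambda>i w. bas (i # w)) (bas i) (tens vs)) \<subseteq> {w. length w = length (v # vs)}"
      by (rule supp_plinear[where x = "tens vs"]) (use Cons in \<open>auto intro!: lin_intros\<close>)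
  qed (intro lin_intros)
qed simp

section \<open>Paths as words with a source, and their derivatives\<close>

definition src :: "'g \<Rightarrow> (vbasis list \<Rightarrow>\<^sub>0 'k::field) \<Rightarrow> ('g path \<Rightarrow>\<^sub>0 'k)" where
  "src c = lin_ext (\<lambda>w. bas (c, w))"

lemma src_bas [simp]: "src c (bas w) = bas (c, w)"
  by (simp add: src_def)

lemma plinear_src [lin_intros]: "plinear h \<Longrightarrow> plinear (\<lambda>x. src c (h x))"
  unfolding src_def by (intro lin_intros)

lemma plinear_arrow [lin_intros]: "plinear h \<Longrightarrow> plinear (\<lambda>x. arrow c (h x))"
  unfolding arrow_def by (intro lin_intros)

lemma arrow_bas [simp]: "arrow c (bas i) = bas (c, [i])"
  by (simp add: arrow_def)

definition deriv :: "vbasis \<Rightarrow> ('g path \<Rightarrow>\<^sub>0 'k::field) \<Rightarrow> ('g path \<Rightarrow>\<^sub>0 'k)" where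
  "deriv i = Poly_Mapping.map_key (\<lambda>(h, w). (h, w @ [i]))"

lemma lookup_deriv [simp]: "coeff_at (deriv i t) (h, w) = coeff_at t (h, w @ [i])"
  unfolding deriv_def by (subst map_key.rep_eq) (auto simp: inj_def)

lemma plinear_deriv [lin_intros]: "plinear h \<Longrightarrow> plinear (\<lambda>x. deriv i (h x))"
  by (rule plinearI) (auto intro!: poly_mapping_eqI simp: plinear_add plinear_scale lookup_add)

lemma deriv_bas_Nil [simp]: "deriv i (bas (h, [])) = 0"
  by (rule poly_mapping_eqI) (auto simp: lookup_bas)

lemma deriv_bas_snoc [simp]: "deriv i (bas (h, w @ [j])) = (if i = j then bas (h, w) else 0)"
  by (rule poly_mapping_eqI) (auto simp: lookup_bas split: if_splits)

lemma deriv_bas: "deriv i (bas (h, w)) = (if w \<noteq> [] \<and> last w = i then bas (h, butlast w) else 0)"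
  by (cases w rule: rev_cases) auto

lemma deriv_src: "deriv i (src c t) = src c (last_deriv i t)"
proof (rule plinear_eqI[where x = t])
  fix w
  show "deriv i (src c (bas w)) = src c (last_deriv i (bas w))"
    by (cases w rule: rev_cases) (simp_all add: plinear_zero[OF plinear_src[OF plinear_ident]])
qed (intro lin_intros)+

lemma path_eqI:
  assumes "\<And>h. coeff_at x (h, []) = coeff_at y (h, [])" "\<And>i. deriv i x = deriv i y"
  shows "x = y"
proof (rule poly_mapping_eqI)
  fix p :: "'a path"
  obtain h w where p: "p = (h, w)" by (cases p)
  show "coeff_at x p = coeff_at y p"
  proof (cases w rule: rev_cases)
    case Nil
    then show ?thesis using assms(1) p by simp
  next
    case (snoc w' i)
    then show ?thesis using assms(2)[of i] p by (metis lookup_deriv)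
  qed
qed

text \<open>Commutativity makes the vertices of a product independent of the order in which the
  arrows of the two factors are interleaved.\<close>

locale hopf_quiver = comm_group G for G :: "('g, 'm) monoid_scheme" (structure) +
  fixes g :: 'g and act :: "(vbasis \<Rightarrow>\<^sub>0 'k::field) \<Rightarrow> 'g \<Rightarrow> (vbasis \<Rightarrow>\<^sub>0 'k)"
  assumes g_closed [simp]: "g \<in> carrier G" and module_act: "right_module G act"
begin

section \<open>The product of two paths as a sum over shuffles of words\<close>

abbreviation "M \<equiv> path_mult G g act"
abbreviation D :: "('g path \<Rightarrow>\<^sub>0 'k) \<Rightarrow> ('g path \<times> 'g path \<Rightarrow>\<^sub>0 'k)" where "D \<equiv> path_comult G g"

lemma act_linear: "h \<in> carrier G \<Longrightarrow> plinear (\<lambda>v. act v h)"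
  and act_one: "act v \<one> = v"
  and act_mult: "h \<in> carrier G \<Longrightarrow> l \<in> carrier G \<Longrightarrow> act v (h \<otimes> l) = act (act v h) l"
  using module_act by (auto simp: right_module_def)

text \<open>An arrow of the left factor at position i meets the vertex of the right factor reached
  so far, l times g to the number of its earlier arrows, and is acted on from the right. An arrow of
  the right factor is only translated on the left, which leaves its vector unchanged.\<close>

definition shuffle_entry :: "'g \<Rightarrow> vbasis list \<Rightarrow> vbasis list \<Rightarrow> nat set \<Rightarrow> nat \<Rightarrow> (vbasis \<Rightarrow>\<^sub>0 'k)" where
  "shuffle_entry l u w d i =
     (if i \<in> d then act (bas (u ! card (d \<inter> {1..<i}))) (l \<otimes> g [^] card ({1..<i} - d))
      else bas (w ! card ({1..<i} - d)))"

text \<open>The word part of a product of paths. It depends on the source \<open>l\<close> of the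
  right factor, but not on the source of the left one.\<close>

definition shuffle :: "'g \<Rightarrow> vbasis list \<Rightarrow> vbasis list \<Rightarrow> (vbasis list \<Rightarrow>\<^sub>0 'k)" where
  "shuffle l u w =
     (\<Sum>d | d \<subseteq> {1..length u + length w} \<and> card d = length u.
        tens (map (shuffle_entry l u w d) [1..<length u + length w + 1]))"

text \<open>The consecutive sources c, cg, cg^2, ... make neighbouring arrows composable, so that no
  concatenation vanishes.\<close>

fun arrows :: "'g \<Rightarrow> (vbasis \<Rightarrow>\<^sub>0 'k) list \<Rightarrow> ('g path \<Rightarrow>\<^sub>0 'k) list" where
  "arrows c [] = []"
| "arrows c (v # vs) = arrow c v # arrows (c \<otimes> g) vs"

lemma length_arrows [simp]: "length (arrows c vs) = length vs"
  by (induction c vs rule: arrows.induct) auto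

lemma nth_arrows:
  "c \<in> carrier G \<Longrightarrow> i < length vs \<Longrightarrow> arrows c vs ! i = arrow (c \<otimes> g [^] i) (vs ! i)"
proof (induction c vs arbitrary: i rule: arrows.induct)
  case (2 c v vs)
  then show ?case
    by (cases i) (auto simp: m_ac)
qed simp

lemma concat_arrows:
  "c \<in> carrier G \<Longrightarrow> vs \<noteq> [] \<Longrightarrow> concat_list G g (arrows c vs) = src c (tens vs)"
proof (induction c vs rule: arrows.induct)
  case (2 c v vs)
  show ?case
  proof (cases vs)
    case Nil
    have "arrow c v = src c (bilin_ext (\<lambda>i w. bas (i # w)) v (bas []))"
      by (rule plinear_eqI[where x = v]) (intro lin_intros | simp)+
    then show ?thesis by (simp add: Nil tens_Cons)
  next
    case (Cons v' vs')
    have "bilin_ext (path_concat G g) (arrow c v) (src (c \<otimes> g) t) =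
        src c (bilin_ext (\<lambda>i w. bas (i # w)) v t)" for t
      by (rule plinear_eq2I[where x = v and y = t])
        (use 2 in \<open>intro lin_intros | simp add: path_concat_def vertex_after_def\<close>)+
    moreover have "concat_list G g (arrows (c \<otimes> g) vs) = src (c \<otimes> g) (tens vs)"
      using 2 Cons by simp
    ultimately show ?thesis by (simp add: Cons tens_Cons)
  qed
qed simp

text \<open>If k of the i - 1 arrows before position i come from the left factor and k' from the
  right, the ith bracket starts at (h g^k)(l g^k') = h l g^(i-1). This is the same vertex for every
  \<open>d\<close>, so each summand is a genuine concatenation from h l.\<close>

lemma path_mult_basis_eq:
  assumes h: "h \<in> carrier G" and l: "l \<in> carrier G"
  shows "path_mult_basis G g act (h, u) (l, w) = src (h \<otimes> l) (shuffle l u w)"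
proof (cases "length u + length w = 0")
  case True
  have "{d :: nat set. d = {} \<and> card d = 0} = {{}}" by auto
  then show ?thesis using True by (simp add: path_mult_basis_def vertex_def shuffle_def)
next
  case False
  let ?N = "length u + length w"
  let ?D = "{d. d \<subseteq> {1..?N} \<and> card d = length u}"
  have entry: "entry_mult G act (thin G g d (h, u) i) (thin G g ({1..?N} - d) (l, w) i) =
      arrow (h \<otimes> l \<otimes> g [^] (i - 1)) (shuffle_entry l u w d i)"
    if d: "d \<in> ?D" and i: "i \<in> {1..?N}" for d i
  proof -
    have [simp]: "({1..?N} - d) \<inter> {1..<i} = {1..<i} - d" using i by auto
    let ?k = "card (d \<inter> {1..<i})" and ?k' = "card ({1..<i} - d)"
    \<comment> \<open>Each of the i - 1 earlier positions carries an arrow of exactly one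
      factor.\<close>
    have "?k + ?k' = card ((d \<inter> {1..<i}) \<union> ({1..<i} - d))"
      by (rule card_Un_disjoint[symmetric]) auto
    also have "(d \<inter> {1..<i}) \<union> ({1..<i} - d) = {1..<i}" by auto
    finally have k: "i - 1 = ?k + ?k'" by simp
    have "(h \<otimes> g [^] ?k) \<otimes> (l \<otimes> g [^] ?k') = h \<otimes> l \<otimes> g [^] (i - 1)"
      unfolding k by (simp add: h l m_ac nat_pow_mult[symmetric])
    then show ?thesis
      using i by (simp add: entry_mult_def thin_def Let_def vertex_after_def shuffle_entry_def del: One_nat_def)
  qed
  have concat: "concat_list G g (map (\<lambda>i. entry_mult G act (thin G g d (h, u) i) (thin G g ({1..?N} - d) (l, w) i))
      [1..<?N + 1]) = src (h \<otimes> l) (tens (map (shuffle_entry l u w d) [1..<?N + 1]))"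
    if d: "d \<in> ?D" for d
  proof -
    let ?vs = "map (shuffle_entry l u w d) [1..<?N + 1]"
    have "map (\<lambda>i. entry_mult G act (thin G g d (h, u) i) (thin G g ({1..?N} - d) (l, w) i)) [1..<?N + 1] =
        map (\<lambda>i. arrow (h \<otimes> l \<otimes> g [^] (i - 1)) (shuffle_entry l u w d i)) [1..<?N + 1]"
      by (rule map_cong) (use entry[OF d] in auto)
    also have "\<dots> = arrows (h \<otimes> l) ?vs"
      by (rule nth_equalityI) (auto simp: nth_arrows h l simp del: upt_Suc)
    finally show ?thesis using concat_arrows[of "h \<otimes> l" ?vs] False h l by (simp del: upt_Suc)
  qed
  show ?thesis
    unfolding path_mult_basis_def Let_def fst_conv snd_conv if_not_P[OF False] shuffle_def
      plinear_sum[OF plinear_src[OF plinear_ident]]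
    by (rule sum.cong[OF refl concat])
qed

text \<open>Positions that do not yet use the last letter of a word cannot see it. With its
  counterpart for the right word this allows that letter to be dropped once its position has been
  stripped.\<close>

lemma shuffle_entry_prefix_left:
  assumes "card (d \<inter> {1..<i}) < length u \<or> i \<notin> d"
  shows "shuffle_entry l (u @ [x]) w d i = shuffle_entry l u w d i"
  using assms by (auto simp: shuffle_entry_def nth_append)

lemma shuffle_entry_prefix_right:
  assumes "card ({1..<i} - d) < length w \<or> i \<in> d"
  shows "shuffle_entry l u (w @ [y]) d i = shuffle_entry l u w d i"
  using assms by (auto simp: shuffle_entry_def nth_append)

text \<open>The last position carries either the last letter of \<open>u\<close>, by then acted on
  by the end l g^(length w) of the right path, or the last letter of \<open>w\<close>, unchanged.
  Splitting the subsets \<open>d\<close> accordingly leaves a shuffle with that letter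
  removed.\<close>

lemma last_deriv_shuffle:
  "last_deriv i (shuffle l u w) =
     (if u = [] then 0
      else pscale (coeff_at (act (bas (last u)) (l \<otimes> g [^] length w)) i) (shuffle l (butlast u) w)) +
     (if w = [] \<or> last w \<noteq> i then 0 else shuffle l u (butlast w))"
proof (cases "length u + length w")
  case 0
  then show ?thesis
    by (auto simp: shuffle_def plinear_sum[OF plinear_last_deriv[OF plinear_ident]])
next
  case (Suc N)
  let ?f = "\<lambda>d. last_deriv i (tens (map (shuffle_entry l u w d) [1..<Suc N + 1]))"
  \<comment> \<open>\<open>?A\<close> holds the subsets in which \<open>w\<close> takes the last
    position; \<open>?B\<close> holds those in which \<open>u\<close> takes it, with that position
    removed.\<close>
  let ?A = "{d. d \<subseteq> {1..N} \<and> card d = length u}"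
  let ?B = "{d. d \<subseteq> {1..N} \<and> Suc (card d) = length u}"
  have f: "?f d = pscale (coeff_at (shuffle_entry l u w d (Suc N)) i) (tens (map (shuffle_entry l u w d) [1..<N + 1]))" for d
    using last_deriv_tens_snoc[of i "map (shuffle_entry l u w d) [1..<N + 1]"] by simp
  have "last_deriv i (shuffle l u w) = (\<Sum>d | d \<subseteq> {1..Suc N} \<and> card d = length u. ?f d)"
    by (simp add: shuffle_def Suc plinear_sum[OF plinear_last_deriv[OF plinear_ident]])
  also have "{d. d \<subseteq> {1..Suc N} \<and> card d = length u} = insert (Suc N) ` ?B \<union> ?A"
  proof (intro equalityI subsetI)
    fix d assume d: "d \<in> {d. d \<subseteq> {1..Suc N} \<and> card d = length u}"
    then have fin: "finite d" using finite_subset[of d "{1..Suc N}"] by simp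
    have sub: "d \<subseteq> insert (Suc N) {1..N}" using d by (simp add: atLeastAtMostSuc_conv)
    show "d \<in> insert (Suc N) ` ?B \<union> ?A"
    proof (cases "Suc N \<in> d")
      case True
      then have "d = insert (Suc N) (d - {Suc N})" by auto
      moreover have "d - {Suc N} \<subseteq> {1..N}" using sub by blast
      moreover have "Suc (card (d - {Suc N})) = length u" using d card_Suc_Diff1[OF fin True] by simp
      ultimately show ?thesis by blast
    next
      case False
      then have "d \<subseteq> {1..N}" using sub by blast
      then show ?thesis using d by auto
    qed
  next
    fix d assume "d \<in> insert (Suc N) ` ?B \<union> ?A"
    then show "d \<in> {d. d \<subseteq> {1..Suc N} \<and> card d = length u}"
    proof
      assume "d \<in> insert (Suc N) ` ?B"
      then obtain d' where d': "d = insert (Suc N) d'" "d' \<in> ?B" by auto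
      then have "finite d'" "Suc N \<notin> d'" using finite_subset[of d' "{1..N}"] by auto
      then show ?thesis using d' by auto
    qed auto
  qed
  also have "(\<Sum>d\<in>insert (Suc N) ` ?B \<union> ?A. ?f d) = (\<Sum>d\<in>insert (Suc N) ` ?B. ?f d) + (\<Sum>d\<in>?A. ?f d)"
  proof (rule sum.union_disjoint)
    have fin: "finite {d. d \<subseteq> {1..N}}" by (metis Pow_def finite_Pow_iff finite_atLeastAtMost)
    show "finite ?A" by (rule finite_subset[OF _ fin]) auto
    show "finite (insert (Suc N) ` ?B)" by (rule finite_imageI, rule finite_subset[OF _ fin]) auto
  qed auto
  also have "(\<Sum>d\<in>?A. ?f d) = (if w = [] \<or> last w \<noteq> i then 0 else shuffle l u (butlast w))"
  proof (cases w rule: rev_cases)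
    case Nil
    \<comment> \<open>Without letters in \<open>w\<close>, all Suc N positions belong to
      \<open>u\<close>, and they do not fit into {1..N}.\<close>
    have "d \<notin> ?A" for d
    proof
      assume d: "d \<in> ?A"
      then have "card d \<le> card {1..N}" by (intro card_mono) auto
      then show False using d Suc Nil by simp
    qed
    then have empty: "?A = {}" by blast
    show ?thesis unfolding empty using Nil by simp
  next
    case (snoc w' y)
    have "?f d = (if y = i then tens (map (shuffle_entry l u w' d) [1..<N + 1]) else 0)" if d: "d \<in> ?A" for d
    proof -
      have fin: "finite d" using d finite_subset[of d "{1..N}"] by simp
      have card: "card ({1..N} - d) = length w'" using d snoc Suc fin by (simp add: card_Diff_subset)
      have entries: "map (shuffle_entry l u w d) [1..<N + 1] = map (shuffle_entry l u w' d) [1..<N + 1]"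
      proof (rule map_cong)
        fix j assume j: "j \<in> set [1..<N + 1]"
        \<comment> \<open>The position j itself is missing from the smaller set, so fewer than
          \<open>length w'\<close> letters of \<open>w\<close> have been used before j.\<close>
        have "card ({1..<j} - d) < card ({1..N} - d)" if "j \<notin> d"
          by (rule psubset_card_mono) (use j that in auto)
        then show "shuffle_entry l u w d j = shuffle_entry l u w' d j"
          unfolding snoc card by (intro shuffle_entry_prefix_right) auto
      qed simp
      have last_entry: "shuffle_entry l u w d (Suc N) = bas y"
        using d card by (auto simp: shuffle_entry_def snoc atLeastLessThanSuc_atLeastAtMost nth_append)
      show ?thesis unfolding f entries last_entry by (simp add: lookup_bas del: upt_Suc)
    qed
    then have "(\<Sum>d\<in>?A. ?f d) = (\<Sum>d\<in>?A. (if y = i then tens (map (shuffle_entry l u w' d) [1..<N + 1]) else 0))"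
      by (rule sum.cong[OF refl])
    moreover have "length u + length w' = N" using Suc snoc by simp
    ultimately show ?thesis using snoc by (simp add: shuffle_def del: upt_Suc)
  qed
  also have "(\<Sum>d\<in>insert (Suc N) ` ?B. ?f d) = (\<Sum>d\<in>?B. ?f (insert (Suc N) d))"
  proof (subst sum.reindex)
    show "inj_on (insert (Suc N)) ?B"
    proof (rule inj_onI)
      fix d d' assume *: "d \<in> ?B" "d' \<in> ?B" "insert (Suc N) d = insert (Suc N) d'"
      then have "Suc N \<notin> d" "Suc N \<notin> d'" by auto
      with *(3) show "d = d'" by (metis insert_ident)
    qed
  qed simp
  also have "(\<Sum>d\<in>?B. ?f (insert (Suc N) d)) = (if u = [] then 0
      else pscale (coeff_at (act (bas (last u)) (l \<otimes> g [^] length w)) i) (shuffle l (butlast u) w))"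
  proof (cases u rule: rev_cases)
    case Nil
    then show ?thesis by simp
  next
    case (snoc u' x)
    let ?c = "coeff_at (act (bas x) (l \<otimes> g [^] length w)) i"
    have "?f (insert (Suc N) d) = pscale ?c (tens (map (shuffle_entry l u' w d) [1..<N + 1]))" if d: "d \<in> ?B" for d
    proof -
      have fin: "finite d" using d finite_subset[of d "{1..N}"] by simp
      have card: "card d = length u'" using d snoc by simp
      have card': "card ({1..N} - d) = length w" using d snoc Suc fin by (simp add: card_Diff_subset)
      have entries: "map (shuffle_entry l u w (insert (Suc N) d)) [1..<N + 1] = map (shuffle_entry l u' w d) [1..<N + 1]"
      proof (rule map_cong)
        fix j assume j: "j \<in> set [1..<N + 1]"
        have "insert (Suc N) d \<inter> {1..<j} = d \<inter> {1..<j}" "{1..<j} - insert (Suc N) d = {1..<j} - d"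
          "j \<noteq> Suc N"
          using j by auto
        then have "shuffle_entry l u w (insert (Suc N) d) j = shuffle_entry l u w d j"
          by (simp add: shuffle_entry_def)
        also have "card (d \<inter> {1..<j}) < card d" if "j \<in> d"
          by (rule psubset_card_mono) (use j that fin in auto)
        then have "shuffle_entry l u w d j = shuffle_entry l u' w d j"
          unfolding snoc card by (intro shuffle_entry_prefix_left) auto
        finally show "shuffle_entry l u w (insert (Suc N) d) j = shuffle_entry l u' w d j" .
      qed simp
      have last_entry: "shuffle_entry l u w (insert (Suc N) d) (Suc N) = act (bas x) (l \<otimes> g [^] length w)"
      proof -
        have "insert (Suc N) d \<inter> {1..<Suc N} = d" "{1..<Suc N} - insert (Suc N) d = {1..N} - d"
          using d by auto
        then show ?thesis using card card' by (simp add: shuffle_entry_def snoc)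
      qed
      show ?thesis unfolding f entries last_entry ..
    qed
    then have "(\<Sum>d\<in>?B. ?f (insert (Suc N) d)) =
        (\<Sum>d\<in>?B. pscale ?c (tens (map (shuffle_entry l u' w d) [1..<N + 1])))"
      by (rule sum.cong[OF refl])
    moreover have "length u' + length w = N" using Suc snoc by simp
    ultimately show ?thesis using snoc by (simp add: shuffle_def pscale_sum del: upt_Suc)
  qed
  finally show ?thesis .
qed

section \<open>Homogeneous elements and associativity\<close>

text \<open>Source and degree together fix the target c g^n of every path in \<open>x\<close>, which
  is the vertex that twists the Leibniz rule. Zero is homogeneous for every source in G and every
  degree.\<close>

definition homog :: "'g \<Rightarrow> nat \<Rightarrow> ('g path \<Rightarrow>\<^sub>0 'k) \<Rightarrow> bool" where
  "homog c n x \<longleftrightarrow> c \<in> carrier G \<and> supp x \<subseteq> {(c, w) | w. length w = n}"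

definition act_coeff :: "'g \<Rightarrow> vbasis \<Rightarrow> vbasis \<Rightarrow> 'k" where
  "act_coeff t j i = coeff_at (act (bas j) t) i"

lemma vbasis_expansion: "v = pscale (coeff_at v Va) (bas Va) + pscale (coeff_at v Vb) (bas Vb)"
proof (rule poly_mapping_eqI)
  fix i show "coeff_at v i = coeff_at (pscale (coeff_at v Va) (bas Va) + pscale (coeff_at v Vb) (bas Vb)) i"
    by (cases i) (simp_all add: lookup_add lookup_bas)
qed

lemma act_coeff_one: "act_coeff \<one> j i = (if j = i then 1 else 0)"
  by (simp add: act_coeff_def act_one lookup_bas)

text \<open>\<open>act_coeff t\<close> is the matrix of a right action acting on row vectors, so
  matrices multiply in the same order as group elements.\<close>

lemma act_coeff_mult:
  assumes "t \<in> carrier G" "t' \<in> carrier G"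
  shows "act_coeff (t \<otimes> t') k i =
    act_coeff t k Va * act_coeff t' Va i + act_coeff t k Vb * act_coeff t' Vb i"
proof -
  have "act (act (bas k) t) t' = pscale (act_coeff t k Va) (act (bas Va) t') + pscale (act_coeff t k Vb) (act (bas Vb) t')"
    by (subst vbasis_expansion[of "act (bas k) t"])
      (simp add: act_coeff_def plinear_add[OF act_linear] plinear_scale[OF act_linear] assms)
  then show ?thesis using assms by (simp add: act_coeff_def act_mult lookup_add)
qed

lemma bilinear_M: "bilinear_op M"
  unfolding path_mult_def by (rule bilinear_op_bilin_ext)

lemma plinear_M_left [lin_intros]: "plinear h \<Longrightarrow> plinear (\<lambda>x. M (h x) y)"
  and plinear_M_right [lin_intros]: "plinear h \<Longrightarrow> plinear (\<lambda>y. M x (h y))"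
  by (rule bilinear_op_left[OF bilinear_M] bilinear_op_right[OF bilinear_M]; assumption)+

lemma M_simps [simp]:
  "M (x + y) z = M x z + M y z" "M z (x + y) = M z x + M z y"
  "M (pscale c x) z = pscale c (M x z)" "M z (pscale c x) = pscale c (M z x)"
  "M 0 z = 0" "M z 0 = 0" "M (- x) z = - M x z" "M z (- x) = - M z x"
  unfolding uminus_conv_pscale
  by (rule plinear_add[of "\<lambda>x. M x z"] plinear_add[of "M z"] plinear_scale[of "\<lambda>x. M x z"]
      plinear_scale[of "M z"] plinear_zero[of "\<lambda>x. M x z"] plinear_zero[of "M z"]; intro lin_intros)+

lemma M_diff [simp]: "M (x - y) z = M x z - M y z" "M z (x - y) = M z x - M z y"
  unfolding diff_conv_add_uminus by (simp_all only: M_simps)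

lemma deriv_simps [simp]:
  "deriv i (x + y) = deriv i x + deriv i y" "deriv i (pscale c x) = pscale c (deriv i x)"
  "deriv i 0 = 0" "deriv i (- x) = - deriv i x"
  unfolding uminus_conv_pscale
  by (rule plinear_add[of "deriv i"] plinear_scale[of "deriv i"] plinear_zero[of "deriv i"]; intro lin_intros)+

lemma M_bas:
  "h \<in> carrier G \<Longrightarrow> l \<in> carrier G \<Longrightarrow> M (bas (h, u)) (bas (l, w)) = src (h \<otimes> l) (shuffle l u w)"
  by (simp add: path_mult_def path_mult_basis_eq)

lemma supp_shuffle: "supp (shuffle l u w) \<subseteq> {v. length v = length u + length w}"
proof -
  have "supp (shuffle l u w) \<subseteq> (\<Union>d \<in> {d. d \<subseteq> {1..length u + length w} \<and> card d = length u}.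
      supp (tens (map (shuffle_entry l u w d) [1..<length u + length w + 1])))"
    unfolding shuffle_def by (rule keys_sum_subset)
  also have "\<dots> \<subseteq> {v. length v = length u + length w}"
    using supp_tens[where 'a = vbasis and 'b = 'k] by (fastforce simp del: upt_Suc)
  finally show ?thesis .
qed

lemma homog_bas: "h \<in> carrier G \<Longrightarrow> homog h (length w) (bas (h, w))"
  by (simp add: homog_def)

lemma homog_zero: "c \<in> carrier G \<Longrightarrow> homog c n 0"
  by (simp add: homog_def)

lemma homog_add: "homog c n x \<Longrightarrow> homog c n y \<Longrightarrow> homog c n (x + y)"
  unfolding homog_def using Poly_Mapping.keys_add[of x y] by blast

lemma homog_pscale: "homog c n x \<Longrightarrow> homog c n (pscale a x)"
  unfolding homog_def using keys_pscale[of a x] by blast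

lemma homog_carrier: "homog c n x \<Longrightarrow> c \<in> carrier G"
  by (simp add: homog_def)

lemma homog_suppD: "homog c n x \<Longrightarrow> p \<in> supp x \<Longrightarrow> \<exists>w. p = (c, w) \<and> length w = n"
  by (auto simp: homog_def)

lemma homog_M:
  assumes x: "homog c n x" and y: "homog c' n' y"
  shows "homog (c \<otimes> c') (n + n') (M x y)"
proof -
  have c: "c \<in> carrier G" "c' \<in> carrier G" using x y by (auto simp: homog_def)
  have "supp (M x y) \<subseteq> {(c \<otimes> c', w) | w. length w = n + n'}"
  proof (rule supp_plinear[of "\<lambda>x. M x y"])
    fix p assume "p \<in> supp x"
    then obtain u where p: "p = (c, u)" "length u = n" using homog_suppD[OF x] by blast
    show "supp (M (bas p) y) \<subseteq> {(c \<otimes> c', w) | w. length w = n + n'}"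
    proof (rule supp_plinear[of "M (bas p)"])
      fix q assume "q \<in> supp y"
      then obtain w where q: "q = (c', w)" "length w = n'" using homog_suppD[OF y] by blast
      have "supp (src (c \<otimes> c') (shuffle c' u w)) \<subseteq> {(c \<otimes> c', w) | w. length w = n + n'}"
        by (rule supp_plinear[of "src (c \<otimes> c')"])
          (use supp_shuffle[of c' u w] p q in \<open>auto intro!: lin_intros\<close>)
      then show "supp (M (bas p) (bas q)) \<subseteq> {(c \<otimes> c', w) | w. length w = n + n'}"
        using p q c by (simp add: M_bas)
    qed (intro lin_intros)
  qed (intro lin_intros)
  then show ?thesis using c by (simp add: homog_def)
qed

text \<open>An elimination rule for inductions on the degree: either the derivative vanishes and its
  term disappears, or the degree drops and the induction hypothesis applies.\<close>

lemma homog_deriv: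
  assumes "homog c n x"
  obtains (zero) "n = 0" "deriv i x = 0" | (Suc) m where "n = Suc m" "homog c m (deriv i x)"
proof (cases n)
  case 0
  have "deriv i x = 0"
  proof (rule poly_mapping_eqI)
    fix p :: "'g path"
    obtain h w where p: "p = (h, w)" by (cases p)
    have "(h, w @ [i]) \<notin> supp x" using homog_suppD[OF assms] 0 by force
    then show "coeff_at (deriv i x) p = coeff_at 0 p" by (simp add: p in_keys_iff)
  qed
  then show ?thesis using 0 zero by blast
next
  case (Suc m)
  have "supp (deriv i x) \<subseteq> {(c, w) | w. length w = m}"
  proof
    fix p assume p: "p \<in> supp (deriv i x)"
    obtain h w where hw: "p = (h, w)" by (cases p)
    have "(h, w @ [i]) \<in> supp x" using p by (simp add: hw in_keys_iff)
    then show "p \<in> {(c, w) | w. length w = m}" using homog_suppD[OF assms] Suc hw by force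
  qed
  then have "homog c m (deriv i x)" using homog_carrier[OF assms] by (simp add: homog_def)
  then show ?thesis using Suc that(2) by blast
qed

lemma homog_lookup_Nil: "homog c n x \<Longrightarrow> n > 0 \<Longrightarrow> coeff_at x (h, []) = 0"
  using homog_suppD[of c n x "(h, [])"] by (auto simp: in_keys_iff)

lemma homog_0:
  assumes "homog c 0 x"
  shows "\<exists>a. x = pscale a (bas (c, []))"
proof
  show "x = pscale (coeff_at x (c, [])) (bas (c, []))"
  proof (rule poly_mapping_eqI)
    fix p show "coeff_at x p = coeff_at (pscale (coeff_at x (c, [])) (bas (c, []))) p"
      using homog_suppD[OF assms, of p] by (cases "p = (c, [])") (auto simp: lookup_bas in_keys_iff)
  qed
qed

lemma homog_eqI:
  assumes "homog c n x" "homog c n y"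
    and "n = 0 \<Longrightarrow> coeff_at x (c, []) = coeff_at y (c, [])"
    and "\<And>i. n > 0 \<Longrightarrow> deriv i x = deriv i y"
  shows "x = y"
proof (cases "n = 0")
  case True
  obtain a where a: "x = pscale a (bas (c, []))" using homog_0[of c x] assms(1) True by auto
  obtain b where b: "y = pscale b (bas (c, []))" using homog_0[of c y] assms(2) True by auto
  show ?thesis using assms(3) True a b by (simp add: lookup_bas)
next
  case False
  then show ?thesis
    using assms(4) by (auto intro: path_eqI[of x y] simp: homog_lookup_Nil[OF assms(1)] homog_lookup_Nil[OF assms(2)])
qed

lemma M_vertices: "h \<in> carrier G \<Longrightarrow> l \<in> carrier G \<Longrightarrow> M (bas (h, [])) (bas (l, [])) = bas (h \<otimes> l, [])"
proof -
  have "{d :: nat set. d = {} \<and> card d = 0} = {{}}" by auto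
  then show "h \<in> carrier G \<Longrightarrow> l \<in> carrier G \<Longrightarrow> M (bas (h, [])) (bas (l, [])) = bas (h \<otimes> l, [])"
    by (simp add: M_bas shuffle_def)
qed

text \<open>At most one of \<open>deriv Va\<close> and \<open>deriv Vb\<close> is nonzero on a path,
  namely the one for its last letter. The two twisted terms together thus encode the single term of
  \<open>last_deriv_shuffle\<close> that removes the last letter of \<open>u\<close>.\<close>

lemma deriv_M_bas:
  assumes "h \<in> carrier G" "l \<in> carrier G"
  shows "deriv i (M (bas (h, u)) (bas (l, w))) =
    pscale (act_coeff (l \<otimes> g [^] length w) Va i) (M (deriv Va (bas (h, u))) (bas (l, w))) +
    pscale (act_coeff (l \<otimes> g [^] length w) Vb i) (M (deriv Vb (bas (h, u))) (bas (l, w))) +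
    M (bas (h, u)) (deriv i (bas (l, w)))"
proof -
  have [simp]: "src c (x + y) = src c x + src c y" "src c (pscale a x) = pscale a (src c x)" "src c 0 = 0"
    for c a and x y :: "vbasis list \<Rightarrow>\<^sub>0 'k"
    by (rule plinear_add[of "src c"] plinear_scale[of "src c"] plinear_zero[of "src c"]; intro lin_intros)+
  show ?thesis
    using assms by (cases "last u") (auto simp: M_bas deriv_src last_deriv_shuffle deriv_bas act_coeff_def)
qed

text \<open>A product is determined by this Leibniz rule together with its component in degree \<open>0\<close>,
  which reduces identities between products to inductions on the degree.\<close>

lemma deriv_M:
  assumes x: "homog c n x" and y: "homog c' n' y"
  shows "deriv i (M x y) =
    pscale (act_coeff (c' \<otimes> g [^] n') Va i) (M (deriv Va x) y) +
    pscale (act_coeff (c' \<otimes> g [^] n') Vb i) (M (deriv Vb x) y) + M x (deriv i y)"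
proof (rule plinear_eq2I[where x = x and y = y])
  fix p q assume "p \<in> supp x" "q \<in> supp y"
  then obtain u w where "p = (c, u)" "q = (c', w)" "length w = n'"
    using homog_suppD x y by metis
  then show "deriv i (M (bas p) (bas q)) =
    pscale (act_coeff (c' \<otimes> g [^] n') Va i) (M (deriv Va (bas p)) (bas q)) +
    pscale (act_coeff (c' \<otimes> g [^] n') Vb i) (M (deriv Vb (bas p)) (bas q)) + M (bas p) (deriv i (bas q))"
    using deriv_M_bas[of c c'] homog_carrier x y by blast
qed (intro lin_intros)+

text \<open>Differentiating either bracketing produces the same three kinds of terms, according to
  the factor that loses its last arrow. An arrow of x is twisted by y and then by z on one side and
  by yz on the other, which agree because the action is multiplicative.\<close>

lemma M_assoc_homog:
  "homog c n x \<Longrightarrow> homog c' n' y \<Longrightarrow> homog c'' n'' z \<Longrightarrow> M (M x y) z = M x (M y z)"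
proof (induction "n + n' + n''" arbitrary: n n' n'' x y z rule: less_induct)
  case less
  note x = less.prems(1) and y = less.prems(2) and z = less.prems(3)
  note carr [simp] = x[THEN homog_carrier] y[THEN homog_carrier] z[THEN homog_carrier]
  have l: "homog (c \<otimes> c' \<otimes> c'') (n + n' + n'') (M (M x y) z)"
    and r: "homog (c \<otimes> c' \<otimes> c'') (n + n' + n'') (M x (M y z))"
    using homog_M[OF homog_M[OF x y] z] homog_M[OF x homog_M[OF y z]] by (simp_all add: m_assoc add.assoc)
  show ?case
  proof (rule homog_eqI[OF l r])
    assume "n + n' + n'' = 0"
    then have "n = 0" "n' = 0" "n'' = 0" by auto
    obtain a1 where "x = pscale a1 (bas (c, []))" using homog_0[of c x] x \<open>n = 0\<close> by auto
    moreover obtain a2 where "y = pscale a2 (bas (c', []))" using homog_0[of c' y] y \<open>n' = 0\<close> by auto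
    moreover obtain a3 where "z = pscale a3 (bas (c'', []))" using homog_0[of c'' z] z \<open>n'' = 0\<close> by auto
    ultimately show "coeff_at (M (M x y) z) (c \<otimes> c' \<otimes> c'', []) = coeff_at (M x (M y z)) (c \<otimes> c' \<otimes> c'', [])"
      by (simp add: M_vertices m_assoc mult.assoc)
  next
    fix i
    define t where "t = c' \<otimes> g [^] n'"
    define t' where "t' = c'' \<otimes> g [^] n''"
    have carr_t [simp]: "t \<in> carrier G" "t' \<in> carrier G" by (simp_all add: t_def t'_def)
    \<comment> \<open>By commutativity the target of yz is the product of the targets of y and
      z.\<close>
    have t: "c' \<otimes> c'' \<otimes> g [^] (n' + n'') = t \<otimes> t'"
      by (simp add: t_def t'_def nat_pow_mult[symmetric] m_ac)
    have "M (M (deriv k x) y) z = M (deriv k x) (M y z)" for k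
      by (rule homog_deriv[OF x, of k]) (use less.hyps[of _ n' n'' "deriv k x" y z] y z in auto)
    moreover have "M (M x (deriv k y)) z = M x (M (deriv k y) z)" for k
      by (rule homog_deriv[OF y, of k]) (use less.hyps[of n _ n'' x "deriv k y" z] x z in auto)
    moreover have "M (M x y) (deriv k z) = M x (M y (deriv k z))" for k
      by (rule homog_deriv[OF z, of k]) (use less.hyps[of n n' _ x y "deriv k z"] x y in auto)
    ultimately show "deriv i (M (M x y) z) = deriv i (M x (M y z))"
      by (simp add: deriv_M[OF homog_M[OF x y] z, folded t'_def] deriv_M[OF x y, folded t_def]
          deriv_M[OF x homog_M[OF y z], unfolded t] deriv_M[OF y z, folded t'_def]
          act_coeff_mult pm.scale_right_distrib pm.scale_left_distrib algebra_simps)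
  qed
qed

text \<open>The basis type also contains paths whose source lies outside the carrier, where the
  group laws say nothing. This subspace is kQ proper.\<close>

definition pathspace :: "('g path \<Rightarrow>\<^sub>0 'k) set" where
  "pathspace = {x. supp x \<subseteq> carrier G \<times> UNIV}"

lemma subspace_pathspace: "pm.subspace pathspace"
  unfolding pathspace_def pm.subspace_def
  using Poly_Mapping.keys_add keys_pscale by fastforce

lemma bas_in_pathspace [simp]: "bas (h, w) \<in> pathspace \<longleftrightarrow> h \<in> carrier G"
  by (simp add: pathspace_def)

lemma pathspace_homog: "x \<in> pathspace \<Longrightarrow> p \<in> supp x \<Longrightarrow> homog (fst p) (length (snd p)) (bas p)"
  using homog_bas[of "fst p" "snd p"] by (auto simp: pathspace_def)

lemma homog_pathspace: "homog c n x \<Longrightarrow> x \<in> pathspace"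
  by (auto simp: homog_def pathspace_def)

lemma M_pathspace:
  assumes x: "x \<in> pathspace" and y: "y \<in> pathspace"
  shows "M x y \<in> pathspace"
proof -
  have "supp (M x y) \<subseteq> carrier G \<times> UNIV"
  proof (rule supp_plinear[of "\<lambda>x. M x y"])
    fix p assume p: "p \<in> supp x"
    show "supp (M (bas p) y) \<subseteq> carrier G \<times> UNIV"
    proof (rule supp_plinear[of "M (bas p)"])
      fix q assume "q \<in> supp y"
      then show "supp (M (bas p) (bas q)) \<subseteq> carrier G \<times> UNIV"
        using homog_pathspace[OF homog_M[OF pathspace_homog[OF x p] pathspace_homog[OF y]]]
        unfolding pathspace_def by blast
    qed (intro lin_intros)
  qed (intro lin_intros)
  then show ?thesis by (simp add: pathspace_def)
qed

lemma M_assoc: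
  assumes "x \<in> pathspace" "y \<in> pathspace" "z \<in> pathspace"
  shows "M (M x y) z = M x (M y z)"
proof (rule plinear_eqI[of "\<lambda>x. M (M x y) z" "\<lambda>x. M x (M y z)"])
  fix p assume p: "p \<in> supp x"
  show "M (M (bas p) y) z = M (bas p) (M y z)"
  proof (rule plinear_eq2I[where x = y and y = z])
    fix q r assume "q \<in> supp y" "r \<in> supp z"
    then show "M (M (bas p) (bas q)) (bas r) = M (bas p) (M (bas q) (bas r))"
      using M_assoc_homog pathspace_homog assms p by blast
  qed (intro lin_intros)+
qed (intro lin_intros)+

lemma M_vertex_left:
  "h \<in> carrier G \<Longrightarrow> l \<in> carrier G \<Longrightarrow> M (bas (h, [])) (bas (l, w)) = bas (h \<otimes> l, w)"
proof (induction w rule: rev_induct)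
  case Nil
  then show ?case by (simp add: M_vertices)
next
  case (snoc x w)
  show ?case
  proof (rule homog_eqI)
    show "homog (h \<otimes> l) (Suc (length w)) (M (bas (h, [])) (bas (l, w @ [x])))"
      using homog_M[OF homog_bas[of h "[]"] homog_bas[of l "w @ [x]"]] snoc.prems by simp
    show "homog (h \<otimes> l) (Suc (length w)) (bas (h \<otimes> l, w @ [x]))"
      using homog_bas[of "h \<otimes> l" "w @ [x]"] snoc.prems by simp
    show "deriv i (M (bas (h, [])) (bas (l, w @ [x]))) = deriv i (bas (h \<otimes> l, w @ [x]))" for i
      using snoc by (simp add: deriv_M_bas)
  qed simp
qed

lemma M_one_left: "x \<in> pathspace \<Longrightarrow> M (bas (\<one>, [])) x = x"
  by (rule plinear_eqI[of "M (bas (\<one>, []))" "\<lambda>x. x"]; (intro lin_intros)?)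
    (auto simp: pathspace_def M_vertex_left)

lemma M_one_right_bas:
  "h \<in> carrier G \<Longrightarrow> M (bas (h, w)) (bas (\<one>, [])) = bas (h, w)"
proof (induction w rule: rev_induct)
  case Nil
  then show ?case by (simp add: M_vertices)
next
  case (snoc x w)
  show ?case
  proof (rule homog_eqI)
    show "homog h (Suc (length w)) (M (bas (h, w @ [x])) (bas (\<one>, [])))"
      using homog_M[OF homog_bas[of h "w @ [x]"] homog_bas[of \<one> "[]"]] snoc.prems by simp
    show "homog h (Suc (length w)) (bas (h, w @ [x]))"
      using homog_bas[of "h" "w @ [x]"] snoc.prems by simp
    show "deriv i (M (bas (h, w @ [x])) (bas (\<one>, []))) = deriv i (bas (h, w @ [x]))" for i
      using snoc by (cases x; cases i) (simp_all add: deriv_M_bas act_coeff_one)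
  qed simp
qed

lemma M_one_right: "x \<in> pathspace \<Longrightarrow> M x (bas (\<one>, [])) = x"
  by (rule plinear_eqI[of "\<lambda>x. M x (bas (\<one>, []))" "\<lambda>x. x"]; (intro lin_intros)?)
    (auto simp: pathspace_def M_one_right_bas)

section \<open>The coproduct\<close>

text \<open>Together with \<open>nil_left\<close>, which collects the terms whose left factor is a
  given vertex, this plays on the tensor square the part of \<open>deriv\<close> and vertex
  coefficients on kQ.\<close>

definition deriv_left :: "vbasis \<Rightarrow> ('g path \<times> 'g path \<Rightarrow>\<^sub>0 'k) \<Rightarrow> ('g path \<times> 'g path \<Rightarrow>\<^sub>0 'k)" where
  "deriv_left i = Poly_Mapping.map_key (\<lambda>((h, w), q). ((h, w @ [i]), q))"

definition nil_left :: "'g \<Rightarrow> ('g path \<times> 'g path \<Rightarrow>\<^sub>0 'k) \<Rightarrow> ('g path \<Rightarrow>\<^sub>0 'k)" where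
  "nil_left h = Poly_Mapping.map_key (\<lambda>q. ((h, []), q))"

lemma lookup_deriv_left [simp]: "coeff_at (deriv_left i z) ((h, w), q) = coeff_at z ((h, w @ [i]), q)"
  unfolding deriv_left_def by (subst map_key.rep_eq) (auto simp: inj_def)

lemma lookup_nil_left [simp]: "coeff_at (nil_left h z) q = coeff_at z ((h, []), q)"
  unfolding nil_left_def by (subst map_key.rep_eq) (auto simp: inj_def)

lemma plinear_deriv_left [lin_intros]: "plinear f \<Longrightarrow> plinear (\<lambda>x. deriv_left i (f x))"
  by (rule plinearI) (auto intro!: poly_mapping_eqI simp: plinear_add plinear_scale lookup_add)

lemma plinear_nil_left [lin_intros]: "plinear f \<Longrightarrow> plinear (\<lambda>x. nil_left h (f x))"
  by (rule plinearI) (auto intro!: poly_mapping_eqI simp: plinear_add plinear_scale lookup_add)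

lemma deriv_left_simps [simp]:
  "deriv_left i (x + y) = deriv_left i x + deriv_left i y"
  "deriv_left i (pscale c x) = pscale c (deriv_left i x)" "deriv_left i 0 = 0"
  by (rule plinear_add[of "deriv_left i"] plinear_scale[of "deriv_left i"]
      plinear_zero[of "deriv_left i"]; intro lin_intros)+

lemma deriv_left_tensor: "deriv_left i (x \<otimes>\<^sub>k y) = deriv i x \<otimes>\<^sub>k y"
  by (rule poly_mapping_eqI) (auto simp: tensor_lookup)

lemma nil_left_tensor: "nil_left h (x \<otimes>\<^sub>k y) = pscale (coeff_at x (h, [])) y"
  by (rule poly_mapping_eqI) (auto simp: tensor_lookup)

lemma deriv_left_bas: "deriv_left i (bas (p, q)) = deriv i (bas p) \<otimes>\<^sub>k bas q"
  using deriv_left_tensor[of i "bas p" "bas q"] by simp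

lemma nil_left_bas: "nil_left h (bas (p, q)) = (if p = (h, []) then bas q else 0)"
  using nil_left_tensor[of h "bas p" "bas q"] by (simp add: lookup_bas)

lemma tensor_zero_left [simp]: "0 \<otimes>\<^sub>k y = 0"
  by (rule plinear_zero[of "\<lambda>x. x \<otimes>\<^sub>k y"]) (intro lin_intros)

lemma tensor_eqI:
  assumes "\<And>h. nil_left h z = nil_left h z'" "\<And>i. deriv_left i z = deriv_left i z'"
  shows "z = z'"
proof (rule poly_mapping_eqI)
  fix p :: "'g path \<times> 'g path"
  obtain h w q where p: "p = ((h, w), q)" by (cases p) auto
  show "coeff_at z p = coeff_at z' p"
  proof (cases w rule: rev_cases)
    case Nil
    then show ?thesis using assms(1)[of h] p by (metis lookup_nil_left)
  next
    case (snoc w' i)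
    then show ?thesis using assms(2)[of i] p by (metis lookup_deriv_left)
  qed
qed

lemma plinear_D [lin_intros]: "plinear h \<Longrightarrow> plinear (\<lambda>x. D (h x))"
  unfolding path_comult_def by (intro lin_intros)

lemma D_bas: "D (bas (h, w)) = (\<Sum>i\<le>length w. bas ((h \<otimes> g [^] i, drop i w), (h, take i w)))"
  by (simp add: path_comult_def vertex_after_def)

lemma D_simps [simp]: "D (x + y) = D x + D y" "D (pscale c x) = pscale c (D x)" "D 0 = 0"
  by (rule plinear_add[of D] plinear_scale[of D] plinear_zero[of D]; intro lin_intros)+

text \<open>Every cut of a path leaves the last arrow in the left factor, except the cut at its very
  end, whose left factor is a vertex and is killed.\<close>

lemma deriv_left_D: "deriv_left i (D x) = D (deriv i x)"
proof (rule plinear_eqI[where x = x])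
  fix p :: "'g path"
  obtain h w where p: "p = (h, w)" by (cases p)
  show "deriv_left i (D (bas p)) = D (deriv i (bas p))"
  proof (cases w rule: rev_cases)
    case Nil
    then show ?thesis by (simp add: p D_bas deriv_left_bas)
  next
    case (snoc w' j)
    have "deriv_left i (bas ((h \<otimes> g [^] m, drop m w), (h, take m w))) =
        (if i = j then bas ((h \<otimes> g [^] m, drop m w'), (h, take m w')) else 0)" if "m \<le> length w'" for m
      using that by (simp add: snoc deriv_left_bas)
    moreover have "deriv_left i (bas ((h \<otimes> g [^] Suc (length w'), drop (Suc (length w')) w), q)) = 0" for q
      by (simp add: snoc deriv_left_bas)
    ultimately have "deriv_left i (D (bas p)) =
        (\<Sum>m\<le>length w'. if i = j then bas ((h \<otimes> g [^] m, drop m w'), (h, take m w')) else 0)"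
      unfolding p D_bas plinear_sum[OF plinear_deriv_left[OF plinear_ident]] by (simp add: snoc)
    then show ?thesis by (simp add: p snoc D_bas)
  qed
qed (intro lin_intros)+

text \<open>Only the cut at the end of a path has a vertex on the left, and this vertex is the
  target.\<close>

lemma nil_left_D:
  assumes "homog c n x"
  shows "nil_left h (D x) = (if h = c \<otimes> g [^] n then x else 0)"
proof (rule plinear_eqI[where x = x and f' = "\<lambda>x. if h = c \<otimes> g [^] n then x else 0"])
  show "plinear (\<lambda>x. if h = c \<otimes> g [^] n then x else 0)" by (rule plinearI) auto
  fix p assume "p \<in> supp x"
  then obtain w where p: "p = (c, w)" "length w = n" using homog_suppD[OF assms] by blast
  have "nil_left h (D (bas p)) =
      (\<Sum>m\<le>n. if m = n then (if h = c \<otimes> g [^] n then bas (c, take m w) else 0) else 0)"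
    unfolding p(1) D_bas plinear_sum[OF plinear_nil_left[OF plinear_ident]] p(2)
    by (rule sum.cong) (use p in \<open>auto simp: nil_left_bas\<close>)
  also have "\<dots> = (if h = c \<otimes> g [^] n then bas p else 0)" using p by simp
  finally show "nil_left h (D (bas p)) = (if h = c \<otimes> g [^] n then bas p else 0)" .
qed (intro lin_intros)

text \<open>The counterpart of \<open>homog\<close> on the tensor square: all left factors end at
  \<open>t\<close>, so the Leibniz rule there has a constant twist.\<close>

definition left_target :: "'g \<Rightarrow> ('g path \<times> 'g path \<Rightarrow>\<^sub>0 'k) \<Rightarrow> bool" where
  "left_target t z \<longleftrightarrow>
     supp z \<subseteq> {((h, w), q). h \<in> carrier G \<and> h \<otimes> g [^] length w = t \<and> fst q \<in> carrier G}"

lemma left_targetD: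
  "left_target t z \<Longrightarrow> P \<in> supp z \<Longrightarrow>
    \<exists>h u q. P = ((h, u), q) \<and> h \<in> carrier G \<and> h \<otimes> g [^] length u = t \<and> fst q \<in> carrier G"
  by (cases P; cases "fst P") (auto simp: left_target_def)

lemma left_target_D:
  assumes "homog c n x"
  shows "left_target (c \<otimes> g [^] n) (D x)"
  unfolding left_target_def
proof (rule supp_plinear[of D])
  fix p assume "p \<in> supp x"
  then obtain w where p: "p = (c, w)" "length w = n" using homog_suppD[OF assms] by blast
  have c: "c \<in> carrier G" using assms by (rule homog_carrier)
  show "supp (D (bas p)) \<subseteq> {((h, w), q). h \<in> carrier G \<and> h \<otimes> g [^] length w = c \<otimes> g [^] n \<and> fst q \<in> carrier G}"
    unfolding p(1) D_bas p(2)
    by (rule order.trans[OF keys_sum_subset]) (use c p(2) in \<open>auto simp: m_assoc nat_pow_mult\<close>)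
qed (intro lin_intros)

abbreviation "MM \<equiv> tensor_mult M"

lemma MM_simps [simp]:
  "MM (x + y) z = MM x z + MM y z" "MM z (x + y) = MM z x + MM z y"
  "MM (pscale c x) z = pscale c (MM x z)" "MM z (pscale c x) = pscale c (MM z x)"
  "MM 0 z = 0" "MM z 0 = 0"
  by (rule plinear_add[of "\<lambda>x. MM x z"] plinear_add[of "MM z"] plinear_scale[of "\<lambda>x. MM x z"]
      plinear_scale[of "MM z"] plinear_zero[of "\<lambda>x. MM x z"] plinear_zero[of "MM z"]; intro lin_intros)+

lemma deriv_left_MM:
  assumes "left_target s z" "left_target t z'"
  shows "deriv_left i (MM z z') = pscale (act_coeff t Va i) (MM (deriv_left Va z) z') +
    pscale (act_coeff t Vb i) (MM (deriv_left Vb z) z') + MM z (deriv_left i z')"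
proof (rule plinear_eq2I[where x = z and y = z'])
  fix P Q assume PQ: "P \<in> supp z" "Q \<in> supp z'"
  obtain h u q where P: "P = ((h, u), q)" "h \<in> carrier G"
    using left_targetD[OF assms(1) PQ(1)] by blast
  obtain l w q' where Q: "Q = ((l, w), q')" "l \<in> carrier G" "l \<otimes> g [^] length w = t"
    using left_targetD[OF assms(2) PQ(2)] by blast
  have *: "MM (x \<otimes>\<^sub>k y) (x' \<otimes>\<^sub>k y') = M x x' \<otimes>\<^sub>k M y y'" for x y x' y'
    by (rule tensor_mult_tensor[OF bilinear_M])
  have add: "(x + x') \<otimes>\<^sub>k y = x \<otimes>\<^sub>k y + x' \<otimes>\<^sub>k y" and scale: "pscale c x \<otimes>\<^sub>k y = pscale c (x \<otimes>\<^sub>k y)"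
    for c and x x' y :: "'g path \<Rightarrow>\<^sub>0 'k"
    by (rule plinear_add[of "\<lambda>x. x \<otimes>\<^sub>k y"] plinear_scale[of "\<lambda>x. x \<otimes>\<^sub>k y"]; intro lin_intros)+
  show "deriv_left i (MM (bas P) (bas Q)) = pscale (act_coeff t Va i) (MM (deriv_left Va (bas P)) (bas Q)) +
    pscale (act_coeff t Vb i) (MM (deriv_left Vb (bas P)) (bas Q)) + MM (bas P) (deriv_left i (bas Q))"
    unfolding P(1) Q(1) tensor_bas[of "(h, u)" q, symmetric] tensor_bas[of "(l, w)" q', symmetric] * deriv_left_tensor deriv_M_bas[OF P(2) Q(2)] Q(3) add scale ..
qed (intro lin_intros)+

text \<open>Degrees add under the product, so a vertex on the left arises only from two vertices;
  these are the common ends s and t.\<close>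

lemma nil_left_MM:
  assumes s: "s \<in> carrier G" and t: "t \<in> carrier G" and z: "left_target s z" "left_target t z'"
  shows "nil_left h (MM z z') = (if h = s \<otimes> t then M (nil_left s z) (nil_left t z') else 0)"
proof -
  have lin: "plinear (\<lambda>x. if h = s \<otimes> t then f x else 0)" if "plinear f"
    for f :: "('g path \<times> 'g path \<Rightarrow>\<^sub>0 'k) \<Rightarrow> ('g path \<Rightarrow>\<^sub>0 'k)"
    using that by (cases "h = s \<otimes> t") (auto intro: lin_intros)
  show ?thesis
  proof (rule plinear_eq2I[where x = z and y = z'])
    fix P Q assume PQ: "P \<in> supp z" "Q \<in> supp z'"
    obtain k u q where P: "P = ((k, u), q)" "k \<in> carrier G" "k \<otimes> g [^] length u = s"
      using left_targetD[OF z(1) PQ(1)] by blast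
    obtain l w q' where Q: "Q = ((l, w), q')" "l \<in> carrier G" "l \<otimes> g [^] length w = t"
      using left_targetD[OF z(2) PQ(2)] by blast
    have *: "nil_left h (MM (bas P) (bas Q)) = pscale (coeff_at (M (bas (k, u)) (bas (l, w))) (h, [])) (M (bas q) (bas q'))"
      unfolding P(1) Q(1) tensor_bas[of "(k, u)" q, symmetric] tensor_bas[of "(l, w)" q', symmetric] tensor_mult_tensor[OF bilinear_M] nil_left_tensor ..
    show "nil_left h (MM (bas P) (bas Q)) = (if h = s \<otimes> t then M (nil_left s (bas P)) (nil_left t (bas Q)) else 0)"
    proof (cases "u = [] \<and> w = []")
      case True
      then show ?thesis unfolding * using P Q
        by (auto simp: M_vertices lookup_bas nil_left_bas)
    next
      case False
      have "homog (k \<otimes> l) (length u + length w) (M (bas (k, u)) (bas (l, w)))"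
        by (rule homog_M) (use P Q in \<open>auto intro: homog_bas\<close>)
      then have "nil_left h (MM (bas P) (bas Q)) = 0"
        unfolding * using homog_lookup_Nil[of _ _ _ h] False by fastforce
      moreover have "M (nil_left s (bas P)) (nil_left t (bas Q)) = 0"
        using False P(1) Q(1) by (auto simp: nil_left_bas)
      ultimately show ?thesis by simp
    qed
  qed (intro lin lin_intros)+
qed

text \<open>With a vertex on the left, both sides give xy beside the product of the two targets.
  Their left derivatives agree by the Leibniz rules on kQ and on its tensor square and the induction
  hypothesis.\<close>

lemma D_M_homog: "homog c n x \<Longrightarrow> homog c' n' y \<Longrightarrow> D (M x y) = MM (D x) (D y)"
proof (induction "n + n'" arbitrary: n n' x y rule: less_induct)
  case less
  note x = less.prems(1) and y = less.prems(2)
  note carr [simp] = x[THEN homog_carrier] y[THEN homog_carrier]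
  define s where "s = c \<otimes> g [^] n"
  define t where "t = c' \<otimes> g [^] n'"
  have st [simp]: "s \<in> carrier G" "t \<in> carrier G" by (simp_all add: s_def t_def)
  have st_mult: "c \<otimes> c' \<otimes> g [^] (n + n') = s \<otimes> t"
    by (simp add: s_def t_def nat_pow_mult[symmetric] m_ac)
  show ?case
  proof (rule tensor_eqI)
    fix h
    show "nil_left h (D (M x y)) = nil_left h (MM (D x) (D y))"
      unfolding nil_left_D[OF homog_M[OF x y], unfolded st_mult]
        nil_left_MM[OF st left_target_D[OF x, folded s_def] left_target_D[OF y, folded t_def]]
        nil_left_D[OF x, folded s_def] nil_left_D[OF y, folded t_def] by simp
  next
    fix i
    have "D (M (deriv k x) y) = MM (D (deriv k x)) (D y)" for k
      by (rule homog_deriv[OF x, of k]) (use less.hyps[of _ n' "deriv k x" y] y in auto)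
    moreover have "D (M x (deriv k y)) = MM (D x) (D (deriv k y))" for k
      by (rule homog_deriv[OF y, of k]) (use less.hyps[of n _ x "deriv k y"] x in auto)
    ultimately show "deriv_left i (D (M x y)) = deriv_left i (MM (D x) (D y))"
      by (simp add: deriv_left_D deriv_M[OF x y, folded t_def]
          deriv_left_MM[OF left_target_D[OF x] left_target_D[OF y, folded t_def]])
  qed
qed

lemma D_M:
  assumes "x \<in> pathspace" "y \<in> pathspace"
  shows "D (M x y) = MM (D x) (D y)"
proof (rule plinear_eq2I[where x = x and y = y])
  fix p q assume "p \<in> supp x" "q \<in> supp y"
  then show "D (M (bas p) (bas q)) = MM (D (bas p)) (D (bas q))"
    using D_M_homog pathspace_homog assms by blast
qed (intro lin_intros)+

section \<open>Coassociativity and the counit\<close>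

lemma D_coassoc:
  assumes "x \<in> pathspace"
  shows "lin_ext (\<lambda>((p, q), r). bas (p, (q, r))) (lin_ext (\<lambda>(p, q). D (bas p) \<otimes>\<^sub>k bas q) (D x))
    = lin_ext (\<lambda>(p, q). bas p \<otimes>\<^sub>k D (bas q)) (D x)"
proof (rule plinear_eqI[where x = x])
  fix p assume "p \<in> supp x"
  then obtain h w where p: "p = (h, w)" and h: "h \<in> carrier G"
    using assms by (cases p) (auto simp: pathspace_def)
  let ?t = "\<lambda>i j. bas ((h \<otimes> g [^] i, drop i w), (h \<otimes> g [^] j, drop j (take i w)), (h, take j w))"
  note sums = plinear_sum[OF plinear_lin_ext[OF plinear_ident]]
    plinear_sum[OF plinear_tensor_left[OF plinear_ident]]
    plinear_sum[OF plinear_tensor_right[OF plinear_ident]]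
  have "lin_ext (\<lambda>((p, q), r). bas (p, (q, r))) (lin_ext (\<lambda>(p, q). D (bas p) \<otimes>\<^sub>k bas q) (D (bas p))) =
      (\<Sum>j\<le>length w. \<Sum>i\<le>length w - j. ?t (j + i) j)"
    by (simp add: p D_bas sums h m_assoc nat_pow_mult take_drop add.commute)
  also have "\<dots> = (\<Sum>(j, i)\<in>Sigma {..length w} (\<lambda>j. {..length w - j}). ?t (j + i) j)"
    by (rule sum.Sigma) auto
  \<comment> \<open>Cutting the left part at i after a first cut at j is a cut of the whole path at
    j + i; both sides sum over pairs of cuts j <= i.\<close>
  also have "\<dots> = (\<Sum>(i, j)\<in>Sigma {..length w} (\<lambda>i. {..i}). ?t i j)"
    by (rule sum.reindex_bij_witness[of _ "\<lambda>(i, j). (j, i - j)" "\<lambda>(j, i). (j + i, j)"]) auto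
  also have "\<dots> = (\<Sum>i\<le>length w. \<Sum>j\<le>i. ?t i j)"
    by (rule sum.Sigma[symmetric]) auto
  also have "\<dots> = lin_ext (\<lambda>(p, q). bas p \<otimes>\<^sub>k D (bas q)) (D (bas p))"
    by (simp add: p D_bas sums min.absorb1 min.absorb2 cong: sum.cong_simp)
  finally show "lin_ext (\<lambda>((p, q), r). bas (p, (q, r))) (lin_ext (\<lambda>(p, q). D (bas p) \<otimes>\<^sub>k bas q) (D (bas p)))
    = lin_ext (\<lambda>(p, q). bas p \<otimes>\<^sub>k D (bas q)) (D (bas p))" .
qed (intro lin_intros)+

lemma path_counit_superset:
  assumes "finite A" "supp x \<subseteq> A"
  shows "path_counit x = (\<Sum>p\<in>A. if snd p = [] then coeff_at x p else 0)"
proof -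
  have "path_counit x = (\<Sum>p\<in>supp x. if snd p = [] then coeff_at x p else 0)"
    unfolding path_counit_def by (rule sum.inter_filter) simp
  also have "\<dots> = (\<Sum>p\<in>A. if snd p = [] then coeff_at x p else 0)"
    by (rule sum.mono_neutral_left) (use assms in \<open>auto simp: in_keys_iff\<close>)
  finally show ?thesis .
qed

lemma path_counit_add: "path_counit (x + y) = path_counit x + path_counit (y :: 'g path \<Rightarrow>\<^sub>0 'k)"
proof -
  let ?A = "supp x \<union> supp y"
  have "path_counit (x + y) = (\<Sum>p\<in>?A. if snd p = [] then coeff_at (x + y) p else 0)"
    by (rule path_counit_superset) (auto simp: Poly_Mapping.keys_add)
  also have "\<dots> = (\<Sum>p\<in>?A. if snd p = [] then coeff_at x p else 0) + (\<Sum>p\<in>?A. if snd p = [] then coeff_at y p else 0)"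
    unfolding sum.distrib[symmetric] by (rule sum.cong) (auto simp: lookup_add)
  also have "\<dots> = path_counit x + path_counit y"
    by (simp add: path_counit_superset[of ?A])
  finally show ?thesis .
qed

lemma path_counit_pscale: "path_counit (pscale c x) = c * path_counit (x :: 'g path \<Rightarrow>\<^sub>0 'k)"
proof -
  have "path_counit (pscale c x) = (\<Sum>p\<in>supp x. if snd p = [] then coeff_at (pscale c x) p else 0)"
    by (rule path_counit_superset) (auto simp: keys_pscale)
  also have "\<dots> = (\<Sum>p\<in>supp x. c * (if snd p = [] then coeff_at x p else 0))"
    by (rule sum.cong) auto
  also have "\<dots> = c * path_counit x"
    by (simp add: path_counit_superset[of "supp x"] sum_distrib_left)
  finally show ?thesis .
qed

lemma path_counit_bas: "path_counit (bas p :: 'g path \<Rightarrow>\<^sub>0 'k) = (if snd p = [] then 1 else 0)"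
  by (simp add: path_counit_superset[of "{p}"] lookup_bas)

lemma linear_path_counit: "Vector_Spaces.linear pscale (*) (path_counit :: ('g path \<Rightarrow>\<^sub>0 'k) \<Rightarrow> 'k)"
proof -
  have "vector_space ((*) :: 'k \<Rightarrow> 'k \<Rightarrow> 'k)"
    by unfold_locales (auto simp: algebra_simps)
  then interpret vs: vector_space "(*) :: 'k \<Rightarrow> 'k \<Rightarrow> 'k" .
  show ?thesis
    by (intro Vector_Spaces.linear.intro module_hom.intro module_hom_axioms.intro
        pm.module_axioms pm.vector_space_axioms vs.module_axioms vs.vector_space_axioms
        path_counit_add path_counit_pscale)
qed

lemma plinear_counit_scale: "plinear h \<Longrightarrow> plinear (\<lambda>x. pscale (path_counit (h x :: 'g path \<Rightarrow>\<^sub>0 'k)) y)"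
  by (rule plinearI) (auto simp: plinear_add plinear_scale path_counit_add path_counit_pscale pm.scale_left_distrib)

lemma D_counit:
  assumes "x \<in> pathspace"
  shows "lin_ext (\<lambda>(p, q). pscale (path_counit (bas p :: 'g path \<Rightarrow>\<^sub>0 'k)) (bas q)) (D x) = x"
    and "lin_ext (\<lambda>(p, q). pscale (path_counit (bas q :: 'g path \<Rightarrow>\<^sub>0 'k)) (bas p)) (D x) = x"
proof -
  note sums = plinear_sum[OF plinear_lin_ext[OF plinear_ident]]
  show "lin_ext (\<lambda>(p, q). pscale (path_counit (bas p :: 'g path \<Rightarrow>\<^sub>0 'k)) (bas q)) (D x) = x"
  proof (rule plinear_eqI[where x = x])
    fix p assume "p \<in> supp x"
    obtain h w where p: "p = (h, w)" by (cases p)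
    have "lin_ext (\<lambda>(p, q). pscale (path_counit (bas p)) (bas q)) (D (bas p)) =
        (\<Sum>i\<le>length w. if i = length w then bas (h, take i w) else 0 :: 'g path \<Rightarrow>\<^sub>0 'k)"
      unfolding p D_bas sums by (rule sum.cong) (auto simp: path_counit_bas)
    then show "lin_ext (\<lambda>(p, q). pscale (path_counit (bas p)) (bas q)) (D (bas p)) = bas p"
      by (simp add: p)
  qed (intro lin_intros)+
  show "lin_ext (\<lambda>(p, q). pscale (path_counit (bas q :: 'g path \<Rightarrow>\<^sub>0 'k)) (bas p)) (D x) = x"
  proof (rule plinear_eqI[where x = x])
    fix p assume "p \<in> supp x"
    then obtain h w where p: "p = (h, w)" and h: "h \<in> carrier G"
      using assms by (cases p) (auto simp: pathspace_def)
    have "lin_ext (\<lambda>(p, q). pscale (path_counit (bas q)) (bas p)) (D (bas p)) =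
        (\<Sum>i\<le>length w. if i = 0 then bas (h, w) else 0 :: 'g path \<Rightarrow>\<^sub>0 'k)"
      unfolding p D_bas sums by (rule sum.cong) (auto simp: path_counit_bas h)
    then show "lin_ext (\<lambda>(p, q). pscale (path_counit (bas q)) (bas p)) (D (bas p)) = bas p"
      by (simp add: p)
  qed (intro lin_intros)+
qed

lemma counit_M_bas:
  assumes "h \<in> carrier G" "l \<in> carrier G"
  shows "path_counit (M (bas (h, u)) (bas (l, w))) = path_counit (bas (h, u) :: 'g path \<Rightarrow>\<^sub>0 'k) * path_counit (bas (l, w) :: 'g path \<Rightarrow>\<^sub>0 'k)"
proof (cases "u = [] \<and> w = []")
  case True
  then show ?thesis using assms by (simp add: M_vertices path_counit_bas)
next
  case False
  have "homog (h \<otimes> l) (length u + length w) (M (bas (h, u)) (bas (l, w)))"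
    by (intro homog_M homog_bas assms)
  then have empty: "{p \<in> supp (M (bas (h, u)) (bas (l, w))). snd p = []} = {}"
    using False by (fastforce simp: homog_def)
  have "path_counit (M (bas (h, u)) (bas (l, w))) = 0"
    unfolding path_counit_def empty by simp
  then show ?thesis using False by (auto simp: path_counit_bas)
qed

lemma counit_M:
  assumes "x \<in> pathspace" "y \<in> pathspace"
  shows "path_counit (M x y) = path_counit x * path_counit y"
proof -
  \<comment> \<open>The counit takes values in the field, which is not one of the spaces with a
    basis; multiplying a fixed basis vector by them makes the criterion for \<open>plinear\<close>
    maps applicable.\<close>
  have "pscale (path_counit (M x y)) (bas (g, [])) = pscale (path_counit x) (pscale (path_counit y) (bas (g, [])))"
  proof (rule plinear_eq2I[where x = x and y = y])
    fix p q assume "p \<in> supp x" "q \<in> supp y"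
    then show "pscale (path_counit (M (bas p) (bas q))) (bas (g, [])) =
        pscale (path_counit (bas p :: 'g path \<Rightarrow>\<^sub>0 'k)) (pscale (path_counit (bas q :: 'g path \<Rightarrow>\<^sub>0 'k)) (bas (g, [])))"
      using assms counit_M_bas[of "fst p" "fst q" "snd p" "snd q"]
      by (cases p; cases q) (auto simp: pathspace_def)
  qed (intro plinear_counit_scale lin_intros)+
  then have "coeff_at (pscale (path_counit (M x y)) (bas (g, []) :: 'g path \<Rightarrow>\<^sub>0 'k)) (g, []) =
      coeff_at (pscale (path_counit x) (pscale (path_counit y) (bas (g, []) :: 'g path \<Rightarrow>\<^sub>0 'k))) (g, [])" by simp
  then show ?thesis by (simp add: lookup_bas)
qed

section \<open>The antipode\<close>

text \<open>The source moves along the removed arrow. This translation need not be injective outside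
  the carrier, so the map is built by linear extension and not as a pullback like
  \<open>deriv\<close>.\<close>

definition front_deriv :: "vbasis \<Rightarrow> ('g path \<Rightarrow>\<^sub>0 'k) \<Rightarrow> ('g path \<Rightarrow>\<^sub>0 'k)" where
  "front_deriv j = lin_ext (\<lambda>(h, w). case w of [] \<Rightarrow> 0 | i # w' \<Rightarrow> if i = j then bas (h \<otimes> g, w') else 0)"

lemma front_deriv_bas [simp]:
  "front_deriv j (bas (h, [])) = 0"
  "front_deriv j (bas (h, i # w)) = (if i = j then bas (h \<otimes> g, w) else 0)"
  by (simp_all add: front_deriv_def)

lemma plinear_front_deriv [lin_intros]: "plinear h \<Longrightarrow> plinear (\<lambda>x. front_deriv j (h x))"
  unfolding front_deriv_def by (intro lin_intros)

lemma front_deriv_simps [simp]: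
  "front_deriv i (x + y) = front_deriv i x + front_deriv i y"
  "front_deriv i (pscale c x) = pscale c (front_deriv i x)"
  "front_deriv i 0 = 0"
  by (rule plinear_add[of "front_deriv i"] plinear_scale[of "front_deriv i"]
      plinear_zero[of "front_deriv i"]; intro lin_intros)+

lemma homog_front_deriv:
  assumes x: "homog c n x"
  obtains (zero) "n = 0" "front_deriv j x = 0" | (Suc) m where "n = Suc m" "homog (c \<otimes> g) m (front_deriv j x)"
proof (cases n)
  case 0
  have "front_deriv j x = 0"
  proof (rule plinear_eqI[where x = x and f' = "\<lambda>x. 0"])
    fix p assume "p \<in> supp x"
    then show "front_deriv j (bas p) = 0" using homog_suppD[OF x] 0 by fastforce
  qed (intro lin_intros)+
  then show ?thesis using 0 zero by blast
next
  case (Suc m)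
  have "supp (front_deriv j x) \<subseteq> {(c \<otimes> g, w) | w. length w = m}"
  proof (rule supp_plinear[of "front_deriv j"])
    fix p assume "p \<in> supp x"
    then obtain i w where "p = (c, i # w)" "length w = m"
      using homog_suppD[OF x, of p] Suc by (auto simp: length_Suc_conv)
    then show "supp (front_deriv j (bas p)) \<subseteq> {(c \<otimes> g, w) | w. length w = m}" by simp
  qed (intro lin_intros)
  then have "homog (c \<otimes> g) m (front_deriv j x)"
    using homog_carrier[OF x] by (simp add: homog_def)
  then show ?thesis using Suc that(2) by blast
qed

lemma front_deriv_deriv: "front_deriv j (deriv i x) = deriv i (front_deriv j x)"
proof (rule plinear_eqI[where x = x])
  fix p :: "'g path"
  obtain h w where p: "p = (h, w)" by (cases p)
  show "front_deriv j (deriv i (bas p)) = deriv i (front_deriv j (bas p))"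
  proof (cases w)
    case (Cons k w')
    then show ?thesis
      by (cases w' rule: rev_cases) (auto simp: p deriv_bas)
  qed (simp add: p)
qed (intro lin_intros)+

lemma front_deriv_degree_1:
  assumes "homog c 1 x"
  shows "front_deriv j x = pscale (coeff_at x (c, [j])) (bas (c \<otimes> g, []))"
proof (rule plinear_eqI[where x = x and f' = "\<lambda>x. pscale (coeff_at x (c, [j])) (bas (c \<otimes> g, []))"])
  show "plinear (\<lambda>x. pscale (coeff_at x (c, [j])) (bas (c \<otimes> g, [])))"
    by (rule plinearI) (auto simp: lookup_add pm.scale_left_distrib)
  fix p assume "p \<in> supp x"
  then obtain i where "p = (c, [i])"
    using homog_suppD[OF assms, of p] by (auto simp: length_Suc_conv)
  then show "front_deriv j (bas p) = pscale (coeff_at (bas p) (c, [j])) (bas (c \<otimes> g, []))"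
    by (simp add: lookup_bas)
qed (intro lin_intros)

text \<open>In a path of length 1 the first arrow is also the last. The lowest case of the front
  Leibniz rule is thereby read off from \<open>deriv_M\<close>.\<close>

lemma lookup_front_deriv_degree_1:
  assumes "homog c n x" "n \<le> 1"
  shows "coeff_at (front_deriv j x) (c \<otimes> g, []) = coeff_at (deriv j x) (c, [])"
proof (cases "n = 1")
  case True
  then show ?thesis using assms by (simp add: front_deriv_degree_1 lookup_bas)
next
  case False
  then have "n = 0" using assms by simp
  have "front_deriv j x = 0" using assms(1) \<open>n = 0\<close> by (cases rule: homog_front_deriv[of c n x j]) auto
  moreover have "deriv j x = 0" using assms(1) \<open>n = 0\<close> by (cases rule: homog_deriv[of c n x j]) auto
  ultimately show ?thesis by simp
qed

lemma lookup_M_Nil: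
  assumes "homog c 0 x" "homog c' 0 y"
  shows "coeff_at (M x y) (c \<otimes> c', []) = coeff_at x (c, []) * coeff_at y (c', [])"
proof -
  obtain a where "x = pscale a (bas (c, []))" using homog_0 assms by blast
  moreover obtain b where "y = pscale b (bas (c', []))" using homog_0 assms by blast
  ultimately show ?thesis
    using homog_carrier assms by (simp add: M_vertices lookup_bas)
qed

text \<open>If the first arrow of a product comes from x, no arrow of y precedes it, so it is
  twisted by the source c' of y. Since \<open>front_deriv\<close> commutes with
  \<open>deriv\<close>, applying \<open>deriv\<close> to both sides reduces the claim to smaller
  degree; in total degree 1 the vertex coefficients are compared instead.\<close>

lemma front_deriv_M:
  "homog c n x \<Longrightarrow> homog c' n' y \<Longrightarrow>
    front_deriv j (M x y) = pscale (act_coeff c' Va j) (M (front_deriv Va x) y) +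
      pscale (act_coeff c' Vb j) (M (front_deriv Vb x) y) + M x (front_deriv j y)"
proof (induction "n + n'" arbitrary: n n' x y rule: less_induct)
  case less
  note x = less.prems(1) and y = less.prems(2)
  note carr [simp] = x[THEN homog_carrier] y[THEN homog_carrier]
  let ?rhs = "pscale (act_coeff c' Va j) (M (front_deriv Va x) y) +
      pscale (act_coeff c' Vb j) (M (front_deriv Vb x) y) + M x (front_deriv j y)"
  show ?case
  proof (cases "n + n' = 0")
    case True
    then have n: "n = 0" "n' = 0" by auto
    have "front_deriv k x = 0" for k using x n by (cases rule: homog_front_deriv[of c n x k]) auto
    moreover have "front_deriv k y = 0" for k using y n by (cases rule: homog_front_deriv[of c' n' y k]) auto
    moreover have "front_deriv k (M x y) = 0" for k
      using homog_M[OF x y] n by (cases rule: homog_front_deriv[of "c \<otimes> c'" "n + n'" "M x y" k]) auto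
    ultimately show ?thesis by simp
  next
    case False
    then obtain m where m: "n + n' = Suc m" using not0_implies_Suc by blast
    have l: "homog (c \<otimes> c' \<otimes> g) m (front_deriv j (M x y))"
      using homog_M[OF x y] m by (cases rule: homog_front_deriv[of "c \<otimes> c'" "n + n'" "M x y" j]) auto
    have r1: "homog (c \<otimes> c' \<otimes> g) m (M (front_deriv k x) y)" for k
    proof (cases rule: homog_front_deriv[OF x, of k])
      case 1
      then show ?thesis by (simp add: homog_zero)
    next
      case (2 n1)
      have "c \<otimes> g \<otimes> c' = c \<otimes> c' \<otimes> g" by (simp add: m_ac)
      moreover have "n1 + n' = m" using 2 m by simp
      ultimately show ?thesis using homog_M[OF 2(2) y] by simp
    qed
    have r2: "homog (c \<otimes> c' \<otimes> g) m (M x (front_deriv k y))" for k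
    proof (cases rule: homog_front_deriv[OF y, of k])
      case 1
      then show ?thesis by (simp add: homog_zero)
    next
      case (2 n1)
      have "n + n1 = m" using 2 m by simp
      then show ?thesis using homog_M[OF x 2(2)] by (simp add: m_assoc)
    qed
    have r: "homog (c \<otimes> c' \<otimes> g) m ?rhs"
      by (intro homog_add homog_pscale r1 r2)
    show ?thesis
    proof (rule homog_eqI[OF l r])
      assume "m = 0"
      then consider "n = 1" "n' = 0" | "n = 0" "n' = 1" using m by linarith
      then show "coeff_at (front_deriv j (M x y)) (c \<otimes> c' \<otimes> g, []) = coeff_at ?rhs (c \<otimes> c' \<otimes> g, [])"
      proof cases
        case 1
        have y0: "front_deriv k y = 0" "deriv k y = 0" for k
          using y 1(2) by (cases rule: homog_front_deriv[of c' n' y k], auto)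
            (cases rule: homog_deriv[of c' n' y k], auto)
        have d: "homog c 0 (deriv k x)" for k
          using x 1(1) by (cases rule: homog_deriv[of c n x k]) auto
        have f: "homog (c \<otimes> g) 0 (front_deriv k x)" for k
          using x 1(1) by (cases rule: homog_front_deriv[of c n x k]) auto
        have y': "homog c' 0 y" using y 1(2) by simp
        have *: "coeff_at (M (front_deriv k x) y) (c \<otimes> c' \<otimes> g, []) = coeff_at (M (deriv k x) y) (c \<otimes> c', [])" for k
        proof -
          have "c \<otimes> c' \<otimes> g = c \<otimes> g \<otimes> c'" by (simp add: m_ac)
          then show ?thesis
            using lookup_M_Nil[OF f y'] lookup_M_Nil[OF d y'] lookup_front_deriv_degree_1[OF x] 1(1) by simp
        qed
        show ?thesis
          using lookup_front_deriv_degree_1[OF homog_M[OF x y]] 1 deriv_M[OF x y]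
          by (simp add: y0 lookup_add *)
      next
        case 2
        have x0: "front_deriv k x = 0" "deriv k x = 0" for k
          using x 2(1) by (cases rule: homog_front_deriv[of c n x k], auto)
            (cases rule: homog_deriv[of c n x k], auto)
        have d: "homog c' 0 (deriv k y)" for k
          using y 2(2) by (cases rule: homog_deriv[of c' n' y k]) auto
        have f: "homog (c' \<otimes> g) 0 (front_deriv k y)" for k
          using y 2(2) by (cases rule: homog_front_deriv[of c' n' y k]) auto
        have x': "homog c 0 x" using x 2(1) by simp
        have *: "coeff_at (M x (front_deriv k y)) (c \<otimes> c' \<otimes> g, []) = coeff_at (M x (deriv k y)) (c \<otimes> c', [])" for k
        proof -
          have "c \<otimes> c' \<otimes> g = c \<otimes> (c' \<otimes> g)" by (simp add: m_ac)
          then show ?thesis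
            using lookup_M_Nil[OF x' f] lookup_M_Nil[OF x' d] lookup_front_deriv_degree_1[OF y] 2(2) by simp
        qed
        show ?thesis
          using lookup_front_deriv_degree_1[OF homog_M[OF x y]] 2 deriv_M[OF x y]
          by (simp add: x0 lookup_add *)
      qed
    next
      fix i
      define t where "t = c' \<otimes> g [^] n'"
      have "front_deriv j (M (deriv k x) y) = pscale (act_coeff c' Va j) (M (front_deriv Va (deriv k x)) y) +
          pscale (act_coeff c' Vb j) (M (front_deriv Vb (deriv k x)) y) + M (deriv k x) (front_deriv j y)" for k
        by (rule homog_deriv[OF x, of k]) (use less.hyps[of _ n' "deriv k x" y] y in auto)
      moreover have "front_deriv j (M x (deriv i y)) = pscale (act_coeff c' Va j) (M (front_deriv Va x) (deriv i y)) +
          pscale (act_coeff c' Vb j) (M (front_deriv Vb x) (deriv i y)) + M x (front_deriv j (deriv i y))"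
        by (rule homog_deriv[OF y, of i]) (use less.hyps[of n _ x "deriv i y"] x in auto)
      moreover have "deriv i (M (front_deriv k x) y) = pscale (act_coeff t Va i) (M (deriv Va (front_deriv k x)) y) +
          pscale (act_coeff t Vb i) (M (deriv Vb (front_deriv k x)) y) + M (front_deriv k x) (deriv i y)" for k
        by (rule homog_front_deriv[OF x, of k]) (auto simp: t_def deriv_M y)
      moreover have "deriv i (M x (front_deriv j y)) = pscale (act_coeff t Va i) (M (deriv Va x) (front_deriv j y)) +
          pscale (act_coeff t Vb i) (M (deriv Vb x) (front_deriv j y)) + M x (deriv i (front_deriv j y))"
      proof (cases rule: homog_front_deriv[OF y, of j])
        case (2 n1)
        have "c' \<otimes> g \<otimes> g [^] n1 = t" by (simp add: 2 t_def m_ac)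
        then show ?thesis using deriv_M[OF x 2(2)] by simp
      qed simp
      ultimately show "deriv i (front_deriv j (M x y)) = deriv i ?rhs"
        by (simp add: front_deriv_deriv[symmetric] deriv_M[OF x y, folded t_def]
            pm.scale_right_distrib algebra_simps)
    qed
  qed
qed

section \<open>The antipode on paths reverses products\<close>

definition snoc :: "(vbasis \<Rightarrow>\<^sub>0 'k) \<Rightarrow> ('g path \<Rightarrow>\<^sub>0 'k) \<Rightarrow> ('g path \<Rightarrow>\<^sub>0 'k)" where
  "snoc v = bilin_ext (\<lambda>i (c, w). bas (c, w @ [i])) v"

fun antipode_path :: "'g \<Rightarrow> vbasis list \<Rightarrow> ('g path \<Rightarrow>\<^sub>0 'k)" where
  "antipode_path h [] = bas (inv h, [])"
| "antipode_path h (x # w) = - snoc (act (bas x) (inv h)) (antipode_path (h \<otimes> g) w)"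

text \<open>The antipode of an arrow \<open>\<alpha>\<close> from \<open>s\<close> to \<open>t\<close> is the arrow \<open>- t\<^sup>-\<^sup>1 \<alpha> s\<^sup>-\<^sup>1\<close> from \<open>t\<^sup>-\<^sup>1\<close> to \<open>s\<^sup>-\<^sup>1\<close>;
  as a coalgebra antihomomorphism it maps a path to the path of the antipodes of its arrows in
  reverse order.\<close>

definition antipode :: "('g path \<Rightarrow>\<^sub>0 'k) \<Rightarrow> ('g path \<Rightarrow>\<^sub>0 'k)" where
  "antipode = lin_ext (\<lambda>(h, w). antipode_path h w)"

lemma antipode_bas [simp]: "antipode (bas (h, w)) = antipode_path h w"
  by (simp add: antipode_def)

lemma plinear_antipode [lin_intros]: "plinear h \<Longrightarrow> plinear (\<lambda>x. antipode (h x))"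
  unfolding antipode_def by (intro lin_intros)

lemma antipode_simps [simp]:
  "antipode (x + y) = antipode x + antipode y" "antipode (pscale c x) = pscale c (antipode x)"
  "antipode 0 = 0"
  by (rule plinear_add[of antipode] plinear_scale[of antipode] plinear_zero[of antipode]; intro lin_intros)+

lemma deriv_snoc: "deriv i (snoc v z) = pscale (coeff_at v i) z"
proof (rule plinear_eq2I[where x = v and y = z])
  show "plinear (\<lambda>v. pscale (coeff_at v i) z)" for z :: "'g path \<Rightarrow>\<^sub>0 'k"
    by (rule plinearI) (auto simp: lookup_add pm.scale_left_distrib)
qed (auto simp: snoc_def lookup_bas intro!: plinear_deriv plinear_bilin_ext_left plinear_bilin_ext_right
      plinear_pscale plinear_ident)

lemma homog_snoc:
  assumes "homog c n z"
  shows "homog c (Suc n) (snoc v z)"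
proof -
  have "supp (snoc v z) \<subseteq> {(c, w) | w. length w = Suc n}"
    unfolding snoc_def
  proof (rule supp_plinear[where x = v])
    fix i
    show "supp (bilin_ext (\<lambda>i (c, w). bas (c, w @ [i])) (bas i) z) \<subseteq> {(c, w) | w. length w = Suc n}"
    proof (rule supp_plinear[where x = z])
      fix p assume "p \<in> supp z"
      then show "supp (bilin_ext (\<lambda>i (c, w). bas (c, w @ [i])) (bas i) (bas p)) \<subseteq> {(c, w) | w. length w = Suc n}"
        using homog_suppD[OF assms] by fastforce
    qed (intro lin_intros)
  qed (intro lin_intros)
  then show ?thesis using homog_carrier[OF assms] by (simp add: homog_def)
qed

lemma homog_antipode_path:
  "h \<in> carrier G \<Longrightarrow> homog (inv (h \<otimes> g [^] length w)) (length w) (antipode_path h w)"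
proof (induction w arbitrary: h)
  case Nil
  then show ?case by (simp add: homog_def)
next
  case (Cons x w)
  have t: "h \<otimes> g \<otimes> g [^] length w = h \<otimes> g [^] length (x # w)" using Cons.prems by (simp add: m_ac)
  have "homog (inv (h \<otimes> g [^] length (x # w))) (length w) (antipode_path (h \<otimes> g) w)"
    using Cons.IH[of "h \<otimes> g"] Cons.prems unfolding t by simp
  then show ?case
    unfolding antipode_path.simps uminus_conv_pscale length_Cons
    by (intro homog_pscale homog_snoc)
qed

lemma homog_antipode:
  assumes x: "homog c n x"
  shows "homog (inv (c \<otimes> g [^] n)) n (antipode x)"
proof -
  have "supp (antipode x) \<subseteq> {(inv (c \<otimes> g [^] n), w) | w. length w = n}"
  proof (rule supp_plinear[of antipode])
    fix p assume "p \<in> supp x"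
    then obtain w where "p = (c, w)" "length w = n" using homog_suppD[OF x] by blast
    then show "supp (antipode (bas p)) \<subseteq> {(inv (c \<otimes> g [^] n), w) | w. length w = n}"
      using homog_antipode_path[of c w] homog_carrier[OF x] by (simp add: homog_def)
  qed (intro lin_intros)
  then show ?thesis using homog_carrier[OF x] by (simp add: homog_def)
qed

text \<open>The first arrow of a path becomes the last arrow of its antipode, acted on by the
  inverse of its source.\<close>

lemma deriv_antipode:
  assumes x: "homog c n x"
  shows "deriv i (antipode x) = - (pscale (act_coeff (inv c) Va i) (antipode (front_deriv Va x)) +
    pscale (act_coeff (inv c) Vb i) (antipode (front_deriv Vb x)))"
proof (rule plinear_eqI[where x = x])
  fix p assume "p \<in> supp x"
  then obtain w where p: "p = (c, w)" using homog_suppD[OF x] by blast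
  show "deriv i (antipode (bas p)) = - (pscale (act_coeff (inv c) Va i) (antipode (front_deriv Va (bas p))) +
    pscale (act_coeff (inv c) Vb i) (antipode (front_deriv Vb (bas p))))"
  proof (cases w)
    case (Cons j w')
    then show ?thesis by (cases j) (simp_all add: p deriv_snoc act_coeff_def)
  qed (simp add: p)
qed (intro lin_intros)+

text \<open>The last arrow of S(xy) comes from the first arrow of xy, twisted by the inverse of cc'.
  An arrow of x already carries the twist c' of the front Leibniz rule, and the two combine to the
  inverse of c, as in S(x). For an arrow of y the twist splits into the inverse of c' from S(y) and
  the inverse of c, the vertex at which S(x) ends.\<close>

lemma antipode_M_homog:
  "homog c n x \<Longrightarrow> homog c' n' y \<Longrightarrow> antipode (M x y) = M (antipode y) (antipode x)"
proof (induction "n + n'" arbitrary: n n' c c' x y rule: less_induct)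
  case less
  note x = less.prems(1) and y = less.prems(2)
  note carr [simp] = x[THEN homog_carrier] y[THEN homog_carrier]
  define s where "s = inv (c \<otimes> g [^] n)"
  define t where "t = inv (c' \<otimes> g [^] n')"
  have st [simp]: "s \<in> carrier G" "t \<in> carrier G" by (simp_all add: s_def t_def)
  have "inv (c \<otimes> c' \<otimes> g [^] (n + n')) = t \<otimes> s"
    by (simp add: s_def t_def nat_pow_mult[symmetric] inv_mult_group m_ac)
  then have l: "homog (t \<otimes> s) (n + n') (antipode (M x y))"
    using homog_antipode[OF homog_M[OF x y]] by simp
  have r: "homog (t \<otimes> s) (n + n') (M (antipode y) (antipode x))"
    using homog_M[OF homog_antipode[OF y] homog_antipode[OF x]] by (simp add: s_def t_def add.commute)
  show ?case
  proof (rule homog_eqI[OF l r])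
    assume "n + n' = 0"
    then have n: "n = 0" "n' = 0" by auto
    obtain a where "x = pscale a (bas (c, []))" using homog_0[of c x] x n by auto
    moreover obtain b where "y = pscale b (bas (c', []))" using homog_0[of c' y] y n by auto
    ultimately show "coeff_at (antipode (M x y)) (t \<otimes> s, []) = coeff_at (M (antipode y) (antipode x)) (t \<otimes> s, [])"
      by (simp add: M_vertices inv_mult_group lookup_bas mult.commute)
  next
    fix i
    have sg: "s \<otimes> g [^] n = inv c"
      by (simp add: s_def inv_mult m_assoc)
    have c1: "act_coeff c' k Va * act_coeff (inv (c \<otimes> c')) Va i + act_coeff c' k Vb * act_coeff (inv (c \<otimes> c')) Vb i
        = act_coeff (inv c) k i" for k
    proof -
      have "c' \<otimes> inv (c \<otimes> c') = inv c" by (simp add: inv_mult_group m_assoc[symmetric])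
      then show ?thesis by (simp add: act_coeff_mult[symmetric])
    qed
    have c2: "act_coeff (inv c') k Va * act_coeff (inv c) Va i + act_coeff (inv c') k Vb * act_coeff (inv c) Vb i
        = act_coeff (inv (c \<otimes> c')) k i" for k
      by (simp add: act_coeff_mult[symmetric] inv_mult_group)
    have 1: "antipode (M (front_deriv k x) y) = M (antipode y) (antipode (front_deriv k x))" for k
      by (rule homog_front_deriv[OF x, of k]) (use less.hyps[of _ n' "c \<otimes> g" "front_deriv k x" c' y] y in auto)
    have 2: "antipode (M x (front_deriv k y)) = M (antipode (front_deriv k y)) (antipode x)" for k
      by (rule homog_front_deriv[OF y, of k]) (use less.hyps[of n _ c x "c' \<otimes> g" "front_deriv k y"] x in auto)
    define A where "A k = M (antipode y) (antipode (front_deriv k x))" for k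
    define B where "B k = M (antipode (front_deriv k y)) (antipode x)" for k
    let ?u = "inv (c \<otimes> c')"
    have "deriv i (antipode (M x y)) =
        - (pscale (act_coeff c' Va Va * act_coeff ?u Va i + act_coeff c' Va Vb * act_coeff ?u Vb i) (A Va)
         + pscale (act_coeff c' Vb Va * act_coeff ?u Va i + act_coeff c' Vb Vb * act_coeff ?u Vb i) (A Vb)
         + pscale (act_coeff ?u Va i) (B Va) + pscale (act_coeff ?u Vb i) (B Vb))"
      by (simp add: deriv_antipode[OF homog_M[OF x y]] front_deriv_M[OF x y] 1 2 A_def B_def
          pm.scale_right_distrib pm.scale_left_distrib algebra_simps)
    also have "\<dots> = - (pscale (act_coeff (inv c) Va i) (A Va) + pscale (act_coeff (inv c) Vb i) (A Vb)
         + pscale (act_coeff ?u Va i) (B Va) + pscale (act_coeff ?u Vb i) (B Vb))"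
      by (simp only: c1)
    also have "\<dots> = deriv i (M (antipode y) (antipode x))"
      unfolding c2[symmetric]
      by (simp add: deriv_M[OF homog_antipode[OF y] homog_antipode[OF x], folded s_def, unfolded sg]
          deriv_antipode[OF x] deriv_antipode[OF y] A_def B_def
          pm.scale_right_distrib pm.scale_left_distrib pm.scale_right_diff_distrib algebra_simps)
    finally show "deriv i (antipode (M x y)) = deriv i (M (antipode y) (antipode x))" .
  qed
qed

lemma antipode_pathspace:
  assumes "x \<in> pathspace"
  shows "antipode x \<in> pathspace"
proof -
  have "supp (antipode x) \<subseteq> carrier G \<times> UNIV"
  proof (rule supp_plinear[of antipode])
    fix p assume "p \<in> supp x"
    then show "supp (antipode (bas p)) \<subseteq> carrier G \<times> UNIV"
      using homog_pathspace[OF homog_antipode[OF pathspace_homog[OF assms]]] unfolding pathspace_def by blast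
  qed (intro lin_intros)
  then show ?thesis by (simp add: pathspace_def)
qed

lemma antipode_M:
  assumes "x \<in> pathspace" "y \<in> pathspace"
  shows "antipode (M x y) = M (antipode y) (antipode x)"
proof (rule plinear_eq2I[where x = x and y = y])
  fix p q assume "p \<in> supp x" "q \<in> supp y"
  then show "antipode (M (bas p) (bas q)) = M (antipode (bas q)) (antipode (bas p))"
    using antipode_M_homog pathspace_homog assms by blast
qed (intro lin_intros)+

section \<open>The biproduct is a pointed Hopf algebra\<close>

abbreviation "H \<equiv> radford_biproduct G g act"

abbreviation one_vertex :: "'g path \<Rightarrow>\<^sub>0 'k" where "one_vertex \<equiv> vertex \<one>"

lemma vertex_bas: "vertex h = bas (h, [])"
  by (simp add: vertex_def)

text \<open>The generating arrows range over all of V, but by linearity the two basis arrows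
  suffice.\<close>

lemma H_induct:
  assumes "x \<in> H" "pm.subspace A" "\<And>i. bas (\<one>, [i]) \<in> A" "\<And>h. h \<in> carrier G \<Longrightarrow> bas (h, []) \<in> A"
    "\<And>x y. x \<in> A \<Longrightarrow> y \<in> A \<Longrightarrow> M x y \<in> A"
  shows "x \<in> A"
proof -
  have arrow: "arrow \<one> v \<in> A" for v
  proof -
    have "arrow \<one> v = pscale (coeff_at v Va) (bas (\<one>, [Va])) + pscale (coeff_at v Vb) (bas (\<one>, [Vb]))"
      by (subst vbasis_expansion[of v])
        (simp add: plinear_add[OF plinear_arrow[OF plinear_ident]] plinear_scale[OF plinear_arrow[OF plinear_ident]])
    then show ?thesis using assms(2,3) by (simp add: pm.subspace_add pm.subspace_scale)
  qed
  have "H \<subseteq> A"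
    unfolding radford_biproduct_def
    by (rule subalgebra_generated_least) (use assms arrow in \<open>auto simp: vertex_bas\<close>)
  then show ?thesis using assms(1) by blast
qed

lemma subspace_H: "pm.subspace H"
  unfolding radford_biproduct_def by (rule subspace_subalgebra_generated)

lemma one_in_H: "bas (\<one>, []) \<in> H"
  using subalgebra_generated_unit[of one_vertex] by (simp add: radford_biproduct_def vertex_bas)

lemma vertex_in_H: "h \<in> carrier G \<Longrightarrow> bas (h, []) \<in> H"
  unfolding radford_biproduct_def by (rule subalgebra_generated_base) (auto simp: vertex_bas)

lemma arrow_in_H: "bas (\<one>, [i]) \<in> H"
  unfolding radford_biproduct_def
  by (rule subalgebra_generated_base) (metis UnI1 arrow_bas rangeI)

lemma M_in_H: "x \<in> H \<Longrightarrow> y \<in> H \<Longrightarrow> M x y \<in> H"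
  unfolding radford_biproduct_def by (rule subalgebra_generated_mult)

lemma H_pathspace: "x \<in> H \<Longrightarrow> x \<in> pathspace"
  by (erule H_induct) (simp_all add: subspace_pathspace M_pathspace)

lemma algebra_on_H: "algebra_on H M one_vertex"
  unfolding algebra_on_def vertex_bas
  using subspace_H bilinear_M one_in_H M_in_H M_assoc H_pathspace M_one_left M_one_right by auto

lemma D_vertex: "h \<in> carrier G \<Longrightarrow> D (bas (h, [])) = bas (h, []) \<otimes>\<^sub>k bas (h, [])"
  by (simp add: D_bas)

lemma D_arrow: "D (bas (\<one>, [i])) = bas (\<one>, [i]) \<otimes>\<^sub>k bas (\<one>, []) + bas (g, []) \<otimes>\<^sub>k bas (\<one>, [i])"
  by (simp add: D_bas)

lemma D_in_tensor_space: "x \<in> H \<Longrightarrow> D x \<in> tensor_space H H"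
proof (erule H_induct[where A = "{x \<in> H. D x \<in> tensor_space H H}", THEN CollectD, THEN conjunct2])
  show "pm.subspace {x \<in> H. D x \<in> tensor_space H H}"
    using subspace_H subspace_tensor_space[of H H] by (auto simp: pm.subspace_def)
  show "bas (\<one>, [i]) \<in> {x \<in> H. D x \<in> tensor_space H H}" for i
    using arrow_in_H[of i] one_in_H vertex_in_H[OF g_closed] subspace_tensor_space[of H H]
    by (auto simp: D_arrow simp del: tensor_bas intro!: pm.subspace_add tensor_in_tensor_space)
  show "bas (h, []) \<in> {x \<in> H. D x \<in> tensor_space H H}" if "h \<in> carrier G" for h
    using vertex_in_H[OF that] by (auto simp: D_vertex that simp del: tensor_bas intro!: tensor_in_tensor_space)
  show "M x y \<in> {x \<in> H. D x \<in> tensor_space H H}"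
    if "x \<in> {x \<in> H. D x \<in> tensor_space H H}" "y \<in> {x \<in> H. D x \<in> tensor_space H H}" for x y
    using that by (auto simp: M_in_H D_M H_pathspace subspace_H intro!: tensor_space_mult_closed[OF bilinear_M])
qed

lemma coalgebra_on_H: "coalgebra_on H D path_counit"
  unfolding coalgebra_on_def
proof (intro conjI ballI)
  show "pm.subspace H" by (rule subspace_H)
  show "plinear D" by (intro lin_intros)
  show "Vector_Spaces.linear pscale (*) (path_counit :: ('g path \<Rightarrow>\<^sub>0 'k) \<Rightarrow> 'k)" by (rule linear_path_counit)
  show "D ` H \<subseteq> tensor_space H H" using D_in_tensor_space by blast
  fix x assume "x \<in> H"
  note x = H_pathspace[OF this]
  show "lin_ext (\<lambda>((p, q), r). bas (p, (q, r))) (lin_ext (\<lambda>(p, q). D (bas p) \<otimes>\<^sub>k bas q) (D x))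
    = lin_ext (\<lambda>(p, q). bas p \<otimes>\<^sub>k D (bas q)) (D x)"
    "lin_ext (\<lambda>(p, q). pscale (path_counit (bas p :: 'g path \<Rightarrow>\<^sub>0 'k)) (bas q)) (D x) = x"
    "lin_ext (\<lambda>(p, q). pscale (path_counit (bas q :: 'g path \<Rightarrow>\<^sub>0 'k)) (bas p)) (D x) = x"
    by (rule D_coassoc[OF x] D_counit[OF x])+
qed

lemma bialgebra_on_H: "bialgebra_on H M one_vertex D path_counit"
  unfolding bialgebra_on_def algebra_hom_on_def
proof (intro conjI ballI)
  show "algebra_on H M one_vertex" by (rule algebra_on_H)
  show "coalgebra_on H D path_counit" by (rule coalgebra_on_H)
  show "plinear D" by (intro lin_intros)
  show "D ` H \<subseteq> tensor_space H H" using D_in_tensor_space by blast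
  show "D one_vertex = one_vertex \<otimes>\<^sub>k one_vertex" by (simp add: vertex_bas D_bas)
  show "path_counit one_vertex = 1" by (simp add: vertex_bas path_counit_bas)
  fix x y assume "x \<in> H" "y \<in> H"
  then have "x \<in> pathspace" "y \<in> pathspace" by (auto intro: H_pathspace)
  then show "D (M x y) = MM (D x) (D y)" "path_counit (M x y) = path_counit x * path_counit y"
    by (auto simp: D_M counit_M)
qed

section \<open>Convolution of the antipode with the identity, on either side\<close>

definition antipode_left :: "('g path \<times> 'g path \<Rightarrow>\<^sub>0 'k) \<Rightarrow> ('g path \<Rightarrow>\<^sub>0 'k)" where
  "antipode_left = lin_ext (\<lambda>(p, q). M (antipode (bas p)) (bas q))"

definition antipode_right :: "('g path \<times> 'g path \<Rightarrow>\<^sub>0 'k) \<Rightarrow> ('g path \<Rightarrow>\<^sub>0 'k)" where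
  "antipode_right = lin_ext (\<lambda>(p, q). M (bas p) (antipode (bas q)))"

lemma plinear_antipode_left [lin_intros]: "plinear h \<Longrightarrow> plinear (\<lambda>x. antipode_left (h x))"
  and plinear_antipode_right [lin_intros]: "plinear h \<Longrightarrow> plinear (\<lambda>x. antipode_right (h x))"
  unfolding antipode_left_def antipode_right_def by (intro lin_intros; assumption)+

lemma antipode_left_tensor: "antipode_left (x \<otimes>\<^sub>k y) = M (antipode x) y"
  unfolding antipode_left_def by (rule lin_ext_tensor) (intro lin_intros)+

lemma antipode_right_tensor: "antipode_right (x \<otimes>\<^sub>k y) = M x (antipode y)"
  unfolding antipode_right_def by (rule lin_ext_tensor) (intro lin_intros)+

lemma supp_D:
  assumes "x \<in> pathspace"
  shows "supp (D x) \<subseteq> (carrier G \<times> UNIV) \<times> (carrier G \<times> UNIV)"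
proof (rule supp_plinear[of D])
  fix p assume "p \<in> supp x"
  then have "left_target (fst p \<otimes> g [^] length (snd p)) (D (bas p))"
    using left_target_D[OF pathspace_homog[OF assms]] by blast
  then show "supp (D (bas p)) \<subseteq> (carrier G \<times> UNIV) \<times> (carrier G \<times> UNIV)"
    using left_targetD by fastforce
qed (intro lin_intros)

text \<open>Both antipode identities pass from \<open>x\<close> and \<open>y\<close> to \<open>xy\<close>, since
  \<open>S(x\<^sub>1y\<^sub>1)x\<^sub>2y\<^sub>2 = S(y\<^sub>1)(S(x\<^sub>1)x\<^sub>2)y\<^sub>2\<close> and \<open>x\<^sub>1y\<^sub>1S(x\<^sub>2y\<^sub>2) = x\<^sub>1(y\<^sub>1S(y\<^sub>2))S(x\<^sub>2)\<close>;
  hence it is enough to check them on generators.\<close>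

lemma antipode_left_MM:
  assumes z: "supp z \<subseteq> (carrier G \<times> UNIV) \<times> (carrier G \<times> UNIV)"
    and z': "supp z' \<subseteq> (carrier G \<times> UNIV) \<times> (carrier G \<times> UNIV)"
  shows "antipode_left (MM z z') =
    lin_ext (\<lambda>(p, q). M (antipode (bas p)) (M (antipode_left z) (bas q))) z'"
proof (rule plinear_eq2I[where x = z and y = z'])
  show "plinear (\<lambda>z. lin_ext (\<lambda>(p, q). M (antipode (bas p)) (M (antipode_left z) (bas q))) z')" for z'
    by (rule plinear_lin_ext_fun) (auto intro!: lin_intros simp: case_prod_beta)
  fix P Q assume PQ: "P \<in> supp z" "Q \<in> supp z'"
  obtain p q where P: "P = (p, q)" "bas p \<in> pathspace" "bas q \<in> pathspace"
    using z PQ(1) by (cases P) (auto simp: pathspace_def)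
  obtain p' q' where Q: "Q = (p', q')" "bas p' \<in> pathspace" "bas q' \<in> pathspace"
    using z' PQ(2) by (cases Q) (auto simp: pathspace_def)
  have "antipode_left (MM (bas P) (bas Q)) = M (antipode (M (bas p) (bas p'))) (M (bas q) (bas q'))"
    unfolding P(1) Q(1) tensor_mult_bas antipode_left_tensor ..
  also have "\<dots> = M (antipode (bas p')) (M (M (antipode (bas p)) (bas q)) (bas q'))"
    using P Q by (simp add: antipode_M M_assoc antipode_pathspace M_pathspace del: bas_in_pathspace)
  also have "\<dots> = lin_ext (\<lambda>(p, q). M (antipode (bas p)) (M (antipode_left (bas P)) (bas q))) (bas Q)"
    by (simp add: P(1) Q(1) antipode_left_def)
  finally show "antipode_left (MM (bas P) (bas Q)) =
    lin_ext (\<lambda>(p, q). M (antipode (bas p)) (M (antipode_left (bas P)) (bas q))) (bas Q)" .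
qed (intro lin_intros)+

lemma antipode_right_MM:
  assumes z: "supp z \<subseteq> (carrier G \<times> UNIV) \<times> (carrier G \<times> UNIV)"
    and z': "supp z' \<subseteq> (carrier G \<times> UNIV) \<times> (carrier G \<times> UNIV)"
  shows "antipode_right (MM z z') =
    lin_ext (\<lambda>(p, q). M (bas p) (M (antipode_right z') (antipode (bas q)))) z"
proof (rule plinear_eq2I[where x = z and y = z'])
  show "plinear (\<lambda>z'. lin_ext (\<lambda>(p, q). M (bas p) (M (antipode_right z') (antipode (bas q)))) z)" for z
    by (rule plinear_lin_ext_fun) (auto intro!: lin_intros simp: case_prod_beta)
  fix P Q assume PQ: "P \<in> supp z" "Q \<in> supp z'"
  obtain p q where P: "P = (p, q)" "bas p \<in> pathspace" "bas q \<in> pathspace"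
    using z PQ(1) by (cases P) (auto simp: pathspace_def)
  obtain p' q' where Q: "Q = (p', q')" "bas p' \<in> pathspace" "bas q' \<in> pathspace"
    using z' PQ(2) by (cases Q) (auto simp: pathspace_def)
  have "antipode_right (MM (bas P) (bas Q)) = M (M (bas p) (bas p')) (antipode (M (bas q) (bas q')))"
    unfolding P(1) Q(1) tensor_mult_bas antipode_right_tensor ..
  also have "\<dots> = M (bas p) (M (M (bas p') (antipode (bas q'))) (antipode (bas q)))"
    using P Q by (simp add: antipode_M M_assoc antipode_pathspace M_pathspace del: bas_in_pathspace)
  also have "\<dots> = lin_ext (\<lambda>(p, q). M (bas p) (M (antipode_right (bas Q)) (antipode (bas q)))) (bas P)"
    by (simp add: P(1) Q(1) antipode_right_def)
  finally show "antipode_right (MM (bas P) (bas Q)) =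
    lin_ext (\<lambda>(p, q). M (bas p) (M (antipode_right (bas Q)) (antipode (bas q)))) (bas P)" .
qed (intro lin_intros)+

lemma antipode_left_D_M:
  assumes "x \<in> pathspace" "y \<in> pathspace"
    and "antipode_left (D x) = pscale a (bas (\<one>, []))" "antipode_left (D y) = pscale b (bas (\<one>, []))"
  shows "antipode_left (D (M x y)) = pscale (a * b) (bas (\<one>, []))"
proof -
  have "antipode_left (D (M x y)) =
      lin_ext (\<lambda>(p, q). M (antipode (bas p)) (M (pscale a (bas (\<one>, []))) (bas q))) (D y)"
    unfolding D_M[OF assms(1,2)] antipode_left_MM[OF supp_D[OF assms(1)] supp_D[OF assms(2)]] assms(3) ..
  also have "\<dots> = pscale a (antipode_left (D y))"
  proof (rule plinear_eqI[where x = "D y"])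
    fix P assume "P \<in> supp (D y)"
    then obtain p h w where P: "P = (p, (h, w))" "h \<in> carrier G"
      using supp_D[OF assms(2)] by (cases P) auto
    then show "lin_ext (\<lambda>(p, q). M (antipode (bas p)) (M (pscale a (bas (\<one>, []))) (bas q))) (bas P) =
        pscale a (antipode_left (bas P))"
      by (simp add: antipode_left_def M_vertex_left)
  qed (intro lin_intros)+
  finally show ?thesis by (simp add: assms(4))
qed

lemma antipode_right_D_M:
  assumes "x \<in> pathspace" "y \<in> pathspace"
    and "antipode_right (D x) = pscale a (bas (\<one>, []))" "antipode_right (D y) = pscale b (bas (\<one>, []))"
  shows "antipode_right (D (M x y)) = pscale (a * b) (bas (\<one>, []))"
proof -
  have "antipode_right (D (M x y)) =
      lin_ext (\<lambda>(p, q). M (bas p) (M (pscale b (bas (\<one>, []))) (antipode (bas q)))) (D x)"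
    unfolding D_M[OF assms(1,2)] antipode_right_MM[OF supp_D[OF assms(1)] supp_D[OF assms(2)]] assms(4) ..
  also have "\<dots> = pscale b (antipode_right (D x))"
  proof (rule plinear_eqI[where x = "D x"])
    fix P assume "P \<in> supp (D x)"
    then obtain p h w where P: "P = (p, (h, w))" "h \<in> carrier G"
      using supp_D[OF assms(1)] by (cases P) auto
    then have "M (bas (\<one>, [])) (antipode (bas (h, w))) = antipode (bas (h, w))"
      by (intro M_one_left antipode_pathspace) simp
    then show "lin_ext (\<lambda>(p, q). M (bas p) (M (pscale b (bas (\<one>, []))) (antipode (bas q)))) (bas P) =
        pscale b (antipode_right (bas P))"
      by (simp add: antipode_right_def P)
  qed (intro lin_intros)+
  finally show ?thesis by (simp add: assms(3) mult.commute)
qed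

text \<open>Written as a product of generators, the value is visibly in \<open>H\<close>, and it
  cancels against the second term of the coproduct of the arrow.\<close>

lemma antipode_arrow: "antipode (bas (\<one>, [i])) = - M (bas (inv g, [])) (bas (\<one>, [i]))"
proof -
  have "bilin_ext (\<lambda>i (c, w). bas (c, w @ [i])) (bas i) (bas (inv g, [])) = (bas (inv g, [i]) :: 'g path \<Rightarrow>\<^sub>0 'k)"
    by simp
  then show ?thesis by (simp add: snoc_def act_one M_vertex_left)
qed

lemma antipode_axioms_H:
  assumes "x \<in> H"
  shows "antipode x \<in> H \<and> antipode_left (D x) = pscale (path_counit x) (bas (\<one>, []))
    \<and> antipode_right (D x) = pscale (path_counit x) (bas (\<one>, []))"
proof -
  let ?A = "{x \<in> H. antipode x \<in> H \<and> antipode_left (D x) = pscale (path_counit x) (bas (\<one>, []))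
    \<and> antipode_right (D x) = pscale (path_counit x) (bas (\<one>, []))}"
  have "x \<in> ?A" using assms
  proof (rule H_induct)
    note L = plinear_antipode_left[OF plinear_ident] and R = plinear_antipode_right[OF plinear_ident]
    have "path_counit (0 :: 'g path \<Rightarrow>\<^sub>0 'k) = 0" by (simp add: path_counit_def)
    then show "pm.subspace ?A"
      using subspace_H plinear_zero[OF L] plinear_zero[OF R]
      by (auto simp: pm.subspace_def path_counit_add path_counit_pscale pm.scale_left_distrib
          plinear_add[OF L] plinear_add[OF R] plinear_scale[OF L] plinear_scale[OF R])
    show "bas (\<one>, [i]) \<in> ?A" for i
    proof -
      have L': "antipode_left (D (bas (\<one>, [i]))) = 0"
        unfolding D_arrow plinear_add[OF L] antipode_left_tensor antipode_arrow
        by (simp add: M_vertex_left M_one_right_bas)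
      have R': "antipode_right (D (bas (\<one>, [i]))) = 0"
        unfolding D_arrow plinear_add[OF R] antipode_right_tensor antipode_arrow
        by (simp add: M_vertex_left M_one_right_bas)
      have "antipode (bas (\<one>, [i])) \<in> H"
        unfolding antipode_arrow using M_in_H[OF vertex_in_H arrow_in_H] pm.subspace_neg[OF subspace_H]
        by simp
      then show ?thesis using L' R' arrow_in_H by (simp add: path_counit_bas)
    qed
    show "bas (h, []) \<in> ?A" if "h \<in> carrier G" for h
      unfolding D_vertex[OF that] mem_Collect_eq antipode_left_tensor antipode_right_tensor
      using that by (simp add: vertex_in_H M_vertices path_counit_bas)
    show "M x y \<in> ?A" if "x \<in> ?A" "y \<in> ?A" for x y
    proof -
      have x: "x \<in> H" "x \<in> pathspace" and y: "y \<in> H" "y \<in> pathspace" using that H_pathspace by auto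
      have "antipode (M x y) \<in> H" using that by (simp add: antipode_M x y M_in_H)
      then show ?thesis
        using that x y by (simp add: M_in_H counit_M antipode_left_D_M antipode_right_D_M)
    qed
  qed
  then show ?thesis by blast
qed

lemma hopf_algebra_on_H: "hopf_algebra_on H M one_vertex D path_counit"
  unfolding hopf_algebra_on_def
proof (intro conjI exI[of _ antipode] ballI)
  show "bialgebra_on H M one_vertex D path_counit" by (rule bialgebra_on_H)
  show "plinear antipode" by (intro lin_intros)
  show "antipode ` H \<subseteq> H" using antipode_axioms_H by blast
  fix x assume "x \<in> H"
  then show "lin_ext (\<lambda>(p, q). M (antipode (bas p)) (bas q)) (D x) = pscale (path_counit x) one_vertex"
    "lin_ext (\<lambda>(p, q). M (bas p) (antipode (bas q))) (D x) = pscale (path_counit x) one_vertex"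
    using antipode_axioms_H[of x] unfolding antipode_left_def antipode_right_def vertex_bas by blast+
qed

text \<open>The coefficient of a path \<open>p\<close> of maximal length in the right tensor factor of \<open>\<Delta> x\<close> is a
  multiple of the vertex at which \<open>p\<close> ends.\<close>

lemma subcoalgebra_contains_vertex:
  assumes E: "subcoalgebra H D E" "E \<noteq> {0}"
  obtains t where "t \<in> carrier G" "bas (t, []) \<in> E"
proof -
  have sub: "pm.subspace E" "E \<subseteq> H" "D ` E \<subseteq> tensor_space E E"
    using E(1) by (auto simp: subcoalgebra_def)
  obtain x where x: "x \<in> E" "x \<noteq> 0" using E(2) pm.subspace_0[OF sub(1)] by blast
  let ?l = "\<lambda>p :: 'g path. length (snd p)"
  have "supp x \<noteq> {}" using x(2) by simp
  then have "Max (?l ` supp x) \<in> ?l ` supp x" by (intro Max_in) auto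
  then obtain p where p: "p \<in> supp x" "?l p = Max (?l ` supp x)" by (elim imageE) simp
  have max: "?l q \<le> ?l p" if "q \<in> supp x" for q
    unfolding p(2) using that by (intro Max_ge) auto
  obtain c w where cw: "p = (c, w)" by (cases p)
  define t where "t = c \<otimes> g [^] length w"
  have c: "c \<in> carrier G" using H_pathspace[of x] x sub(2) p(1) cw by (auto simp: pathspace_def)
  define R where "R = lin_ext (\<lambda>(q1, q2). if q2 = p then bas q1 else 0 :: 'g path \<Rightarrow>\<^sub>0 'k)"
  have linR: "plinear (\<lambda>x. R (h x))" if "plinear h" for h :: "('g path \<Rightarrow>\<^sub>0 'k) \<Rightarrow> _"
    unfolding R_def by (intro lin_intros that)
  have linc: "plinear (\<lambda>x. pscale (coeff_at x p) v)" for v :: "'g path \<Rightarrow>\<^sub>0 'k"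
    by (rule plinearI) (auto simp: lookup_add pm.scale_left_distrib)
  have "R (D x) = pscale (coeff_at x p) (bas (t, []))"
  proof (rule plinear_eqI[where x = x and f' = "\<lambda>x. pscale (coeff_at x p) (bas (t, []))"])
    fix q assume q: "q \<in> supp x"
    obtain h u where hu: "q = (h, u)" by (cases q)
    have len: "length u \<le> length w" using max[OF q] by (simp add: hu cw)
    \<comment> \<open>A prefix of \<open>q\<close> equal to the longest path \<open>p\<close> must
      be all of \<open>q\<close>, so only the last cut of \<open>p\<close> itself
      contributes.\<close>
    have take_eq: "(h, take i u) = p \<longleftrightarrow> q = p \<and> i = length u" if "i \<le> length u" for i
      using that len by (auto simp: hu cw)
    have "R (D (bas q)) = (\<Sum>i\<le>length u. R (bas ((h \<otimes> g [^] i, drop i u), (h, take i u))))"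
      unfolding hu D_bas R_def by (rule plinear_sum[OF linear_lin_ext])
    also have "\<dots> = (\<Sum>i\<le>length u. if i = length u then (if q = p then bas (t, []) else 0) else 0)"
      by (rule sum.cong[OF refl]) (use take_eq in \<open>auto simp: R_def t_def hu cw\<close>)
    finally show "R (D (bas q)) = pscale (coeff_at (bas q) p) (bas (t, []))"
      by (simp add: lookup_bas)
  qed (intro linR linc plinear_D plinear_ident)+
  \<comment> \<open>\<open>R\<close> evaluates a linear functional on the right factor, leaving a
    multiple of the left factor, which lies in \<open>E\<close>.\<close>
  moreover have "R z \<in> E" if "z \<in> tensor_space E E" for z
    using that sub(1)
  proof (induction rule: tensor_space_induct)
    case zero
    show ?case using pm.subspace_0[OF sub(1)] by (simp add: R_def plinear_zero[OF linear_lin_ext])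
  next
    case (add z z')
    then show ?case by (simp add: R_def plinear_add[OF linear_lin_ext] pm.subspace_add[OF sub(1)])
  next
    case (pure x y)
    have "R (x \<otimes>\<^sub>k y) = pscale (coeff_at y p) x"
    proof (rule plinear_eq2I[where x = x and y = y])
      show "R (bas q \<otimes>\<^sub>k bas q') = pscale (coeff_at (bas q') p) (bas q)" for q q'
        by (simp add: R_def lookup_bas)
    qed (intro linR linc lin_intros)+
    then show ?case using pm.subspace_scale[OF sub(1) pure(1)] by simp
  qed
  ultimately have "pscale (coeff_at x p) (bas (t, [])) \<in> E"
    using x(1) sub(3) by (metis image_subset_iff)
  then have "pscale (inverse (coeff_at x p)) (pscale (coeff_at x p) (bas (t, []))) \<in> E"
    by (rule pm.subspace_scale[OF sub(1)])
  then have "bas (t, []) \<in> E" using p(1) by (simp add: in_keys_iff)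
  then show ?thesis using that[of t] c by (simp add: t_def)
qed

text \<open>A simple subcoalgebra contains a vertex, whose span is already a nonzero subcoalgebra;
  by simplicity nothing else is left.\<close>

lemma pointed_on_H: "pointed_on H D"
  unfolding pointed_on_def
proof (intro allI impI)
  fix E assume E: "simple_subcoalgebra H D E"
  then have sub: "subcoalgebra H D E" "E \<noteq> {0}" by (auto simp: simple_subcoalgebra_def)
  then obtain t where t: "t \<in> carrier G" "bas (t, []) \<in> E" using subcoalgebra_contains_vertex by blast
  let ?F = "pm.span {bas (t, []) :: 'g path \<Rightarrow>\<^sub>0 'k}"
  have "?F \<subseteq> E" using t sub(1) by (intro pm.span_minimal) (auto simp: subcoalgebra_def)
  have v: "bas (t, []) \<in> ?F" by (rule pm.span_base) simp
  have "D x \<in> tensor_space ?F ?F" if "x \<in> ?F" for x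
  proof -
    obtain a where "x = pscale a (bas (t, []))" using \<open>x \<in> ?F\<close> by (auto simp: pm.span_singleton)
    then show ?thesis
      using pm.subspace_scale[OF subspace_tensor_space tensor_in_tensor_space[OF v v]]
      by (simp add: D_vertex[OF t(1)] del: tensor_bas)
  qed
  then have "subcoalgebra H D ?F"
    using \<open>?F \<subseteq> E\<close> sub(1) by (auto simp: subcoalgebra_def)
  then have "?F = {0} \<or> ?F = E" using E \<open>?F \<subseteq> E\<close> by (simp add: simple_subcoalgebra_def)
  then have "E = ?F" using v bas_neq_0[of "(t, [])"] by blast
  have "pm.independent {bas (t, []) :: 'g path \<Rightarrow>\<^sub>0 'k}" by simp
  then show "pm.dim E = 1"
    unfolding \<open>E = ?F\<close> by (subst pm.dim_span_eq_card_independent) simp_all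
qed

end

section \<open>Relations and a basis\<close>

text \<open>The generator g acts on V by a single Jordan block with eigenvalue 1.\<close>

locale jordan_quiver = hopf_quiver G g act
  for G :: "('g, 'm) monoid_scheme" (structure) and g :: 'g
    and act :: "(vbasis \<Rightarrow>\<^sub>0 'k::field) \<Rightarrow> 'g \<Rightarrow> (vbasis \<Rightarrow>\<^sub>0 'k)" +
  fixes n :: nat
  assumes char_2: "CHAR('k) = 2"
    and carrier_eq: "carrier G = generate G {g}" and order_eq: "order G = n" and n_pos: "n > 0"
    and act_a: "act (bas Va) g = bas Va" and act_b: "act (bas Vb) g = bas Va + bas Vb"
begin

lemma two_eq_0 [simp]: "(2 :: 'k) = 0"
proof -
  have "(of_nat CHAR('k) :: 'k) = 0" by (rule of_nat_CHAR)
  then show ?thesis unfolding char_2 by simp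
qed

lemma double_zero: "x + x = (0 :: 'y \<Rightarrow>\<^sub>0 'k)"
proof -
  have "x + x = pscale (1 + 1) x" unfolding pm.scale_left_distrib by simp
  then show ?thesis by simp
qed

lemma double_zero_left: "x + (x + y) = (y :: 'y \<Rightarrow>\<^sub>0 'k)"
  by (simp add: double_zero flip: add.assoc)

lemma of_nat_parity: "(of_nat m :: 'k) = (if even m then 0 else 1)"
proof (induction m)
  case (Suc m)
  then show ?case by (simp add: two_eq_0)
qed simp

lemma act_pow: "act (bas Va) (g [^] (m::nat)) = bas Va"
  "act (bas Vb) (g [^] (m::nat)) = bas Vb + pscale (of_nat m) (bas Va)"
proof -
  show a: "act (bas Va) (g [^] (m::nat)) = bas Va" for m
    by (induction m) (simp_all add: act_one act_mult act_a)
  show "act (bas Vb) (g [^] (m::nat)) = bas Vb + pscale (of_nat m) (bas Va)"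
    by (induction m) (simp_all add: act_one act_mult act_a act_b plinear_add[OF act_linear]
        plinear_scale[OF act_linear] pm.scale_left_distrib add.commute)
qed

lemma act_coeff_pow:
  "act_coeff (g [^] (m::nat)) Va Va = 1" "act_coeff (g [^] (m::nat)) Va Vb = 0"
  "act_coeff (g [^] (m::nat)) Vb Vb = 1" "act_coeff (g [^] (m::nat)) Vb Va = of_nat m"
  by (simp_all add: act_coeff_def act_pow lookup_bas lookup_add)

section \<open>Derivatives of words in a and b\<close>

abbreviation e :: "'g path \<Rightarrow>\<^sub>0 'k" where "e \<equiv> bas (\<one>, [])"

definition A :: "('g path \<Rightarrow>\<^sub>0 'k) \<Rightarrow> ('g path \<Rightarrow>\<^sub>0 'k)" where "A = M (bas (\<one>, [Va]))"

definition B :: "('g path \<Rightarrow>\<^sub>0 'k) \<Rightarrow> ('g path \<Rightarrow>\<^sub>0 'k)" where "B = M (bas (\<one>, [Vb]))"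

lemma AB_simps [simp]:
  "A (x + y) = A x + A y" "A (pscale c x) = pscale c (A x)" "A 0 = 0"
  "B (x + y) = B x + B y" "B (pscale c x) = pscale c (B x)" "B 0 = 0"
  by (simp_all add: A_def B_def)

lemma AB_pathspace [simp]: "x \<in> pathspace \<Longrightarrow> A x \<in> pathspace" "x \<in> pathspace \<Longrightarrow> B x \<in> pathspace"
  by (simp_all add: A_def B_def M_pathspace)

lemma AB_assoc:
  "x \<in> pathspace \<Longrightarrow> y \<in> pathspace \<Longrightarrow> A (M x y) = M (A x) y"
  "x \<in> pathspace \<Longrightarrow> y \<in> pathspace \<Longrightarrow> B (M x y) = M (B x) y"
  by (simp_all add: A_def B_def M_assoc)

text \<open>The data that determine the derivatives of ax and bx; starting from \<open>e\<close>,
  they are computed letter by letter for every word.\<close>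

definition derivs :: "nat \<Rightarrow> ('g path \<Rightarrow>\<^sub>0 'k) \<Rightarrow> ('g path \<Rightarrow>\<^sub>0 'k) \<Rightarrow> ('g path \<Rightarrow>\<^sub>0 'k) \<Rightarrow> bool" where
  "derivs m x y z \<longleftrightarrow> homog \<one> m x \<and> deriv Va x = y \<and> deriv Vb x = z"

lemma derivs_e: "derivs 0 e 0 0"
  by (simp add: derivs_def homog_def)

lemma derivs_A:
  assumes "derivs m x y z"
  shows "derivs (Suc m) (A x) (x + A y) (A z)"
proof -
  have x: "homog \<one> m x" using assms by (simp add: derivs_def)
  have a: "homog \<one> 1 (bas (\<one>, [Va]))" by (simp add: homog_def)
  show ?thesis
    using assms homog_M[OF a x] M_one_left[OF homog_pathspace[OF x]]
    by (simp add: derivs_def A_def deriv_M[OF a x] act_coeff_pow deriv_bas)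
qed

text \<open>The new arrow b is twisted by g^m, the end of x, and becomes b + m a. In characteristic
  2 it thus contributes x to the derivative by a exactly when m is odd, and always to the derivative
  by b.\<close>

lemma derivs_B:
  assumes "derivs m x y z"
  shows "derivs (Suc m) (B x) (if even m then B y else x + B y) (x + B z)"
proof -
  have x: "homog \<one> m x" using assms by (simp add: derivs_def)
  have b: "homog \<one> 1 (bas (\<one>, [Vb]))" by (simp add: homog_def)
  show ?thesis
    using assms homog_M[OF b x] M_one_left[OF homog_pathspace[OF x]]
    by (simp add: derivs_def B_def deriv_M[OF b x] act_coeff_pow of_nat_parity deriv_bas)
qed

lemma derivs_unique:
  assumes "derivs m x y z" "derivs m x' y' z'" "m > 0" "y = y'" "z = z'"
  shows "x = x'"
proof (rule homog_eqI)
  show "homog \<one> m x" "homog \<one> m x'" using assms by (simp_all add: derivs_def)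
  show "deriv i x = deriv i x'" for i using assms by (cases i) (simp_all add: derivs_def)
qed (use \<open>m > 0\<close> in simp)

lemma derivs_add: "derivs m x y z \<Longrightarrow> derivs m x' y' z' \<Longrightarrow> derivs m (x + x') (y + y') (z + z')"
  by (auto simp: derivs_def homog_add)

lemma derivs_0: "derivs m 0 0 0"
  by (simp add: derivs_def homog_zero)

lemma derivs_a: "derivs 1 (A e) e 0"
  using derivs_A[OF derivs_e] by simp

lemma derivs_b: "derivs 1 (B e) 0 e"
  using derivs_B[OF derivs_e] by simp

text \<open>Both letters contribute a to the derivative by a, and equal contributions cancel in
  characteristic 2. The vanishing of b^4 below has the same reason.\<close>

lemma aa: "A (A e) = 0"
  by (rule derivs_unique[OF derivs_A[OF derivs_a] derivs_0]) (simp_all add: double_zero)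

lemma derivs_bb: "derivs 2 (B (B e)) (B e) 0"
  using derivs_B[OF derivs_b] by (simp add: double_zero numeral_2_eq_2)

lemma derivs_ab: "derivs 2 (A (B e)) (B e) (A e)"
  using derivs_A[OF derivs_b] by (simp add: numeral_2_eq_2)

lemma derivs_ba: "derivs 2 (B (A e)) (A e + B e) (A e)"
  using derivs_B[OF derivs_a] by (simp add: numeral_2_eq_2)

lemma derivs_bbb: "derivs 3 (B (B (B e))) (B (B e)) (B (B e))"
  using derivs_B[OF derivs_bb] by (simp add: numeral_3_eq_3 numeral_2_eq_2)

lemma bbbb: "B (B (B (B e))) = 0"
  by (rule derivs_unique[OF derivs_B[OF derivs_bbb] derivs_0]) (simp_all add: double_zero)

lemma derivs_aba: "derivs 3 (A (B (A e))) (B (A e) + A (B e)) 0"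
  using derivs_A[OF derivs_ba] by (simp add: aa numeral_3_eq_3 numeral_2_eq_2)

lemma derivs_abb: "derivs 3 (A (B (B e))) (B (B e) + A (B e)) 0"
  using derivs_A[OF derivs_bb] by (simp add: numeral_3_eq_3 numeral_2_eq_2)

lemma derivs_bba: "derivs 3 (B (B (A e))) (B (A e) + B (B e)) 0"
  using derivs_B[OF derivs_ba] by (simp add: double_zero numeral_3_eq_3 numeral_2_eq_2)

text \<open>Both sides have derivative 0 by b. By a, the word ab^2 gives b^2 + ab and aba gives ba +
  ab, which add up to the derivative ba + b^2 of b^2 a.\<close>

lemma bba: "B (B (A e)) = A (B (B e)) + A (B (A e))"
  by (rule derivs_unique[OF derivs_bba derivs_add[OF derivs_abb derivs_aba]])
    (simp_all add: double_zero double_zero_left ac_simps)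

text \<open>An identity between words applied to \<open>e\<close> may be multiplied by any
  \<open>x\<close> on the right. The relations for b^2 a and baba are extended in the same way
  below.\<close>

lemma rel_aa: "x \<in> pathspace \<Longrightarrow> A (A x) = 0"
  using AB_assoc[of "A e" x] AB_assoc[of e x] aa by (simp add: M_one_left)

lemma rel_bba: "x \<in> pathspace \<Longrightarrow> B (B (A x)) = A (B (B x)) + A (B (A x))"
proof -
  assume x: "x \<in> pathspace"
  have "B (B (A x)) = M (B (B (A e))) x" "A (B (B x)) = M (A (B (B e))) x" "A (B (A x)) = M (A (B (A e))) x"
    using x by (simp_all add: AB_assoc[symmetric] M_one_left)
  then show ?thesis by (simp add: bba)
qed

text \<open>Both sides have derivative aba by b. By a they give aba + b^2 a + bab and bab + ab^2,
  which agree after rewriting b^2 a as ab^2 + aba.\<close>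

lemma baba: "B (A (B (A e))) = A (B (A (B e)))"
proof (rule derivs_unique)
  show "derivs 4 (B (A (B (A e)))) (A (B (A e)) + B (B (A e) + A (B e))) (A (B (A e)))"
    using derivs_B[OF derivs_aba] by simp
  have "derivs 3 (B (A (B e))) (B (B e)) (A (B e) + B (A e))"
    using derivs_B[OF derivs_ab] by (simp add: numeral_3_eq_3 numeral_2_eq_2)
  then show "derivs 4 (A (B (A (B e)))) (B (A (B e)) + A (B (B e))) (A (A (B e) + B (A e)))"
    using derivs_A by fastforce
qed (simp_all add: bba rel_aa double_zero double_zero_left ac_simps)

lemma rel_baba: "x \<in> pathspace \<Longrightarrow> B (A (B (A x))) = A (B (A (B x)))"
proof -
  assume x: "x \<in> pathspace"
  have "B (A (B (A x))) = M (B (A (B (A e)))) x" "A (B (A (B x))) = M (A (B (A (B e)))) x"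
    using x by (simp_all add: AB_assoc[symmetric] M_one_left)
  then show ?thesis by (simp add: baba)
qed

definition bpow :: "nat \<Rightarrow> ('g path \<Rightarrow>\<^sub>0 'k)" where
  "bpow l = (B ^^ l) e"

lemma bpow_simps [simp]: "bpow 0 = e" "bpow (Suc l) = B (bpow l)"
  by (simp_all add: bpow_def)

lemma bpow_pathspace [simp]: "bpow l \<in> pathspace"
  by (induction l) simp_all

lemma bpow_ge_4: "l \<ge> 4 \<Longrightarrow> bpow l = 0"
proof (induction l rule: dec_induct)
  case base
  show ?case by (simp add: numeral_eq_Suc bbbb)
qed simp

lemma M_bpow: "M (bpow l) (bpow j) = bpow (l + j)"
  by (induction l) (simp_all add: M_one_left AB_assoc[symmetric])

text \<open>Vanishing would be inherited by derivatives. Deriving in turn by b, a, b, a, a gives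
  abab^2, then bab^2 + ab^3 + abab, then aba, ba + ab and finally a, whose derivative by a is
  \<open>e\<close>.\<close>

lemma socle_neq_0: "A (B (A (bpow 3))) \<noteq> 0"
proof
  assume zero: "A (B (A (bpow 3))) = 0"
  have three: "bpow 3 = B (B (B e))" by (simp add: numeral_3_eq_3)
  note nums = numeral_eq_Suc
  have "derivs 4 (A (bpow 3)) (bpow 3 + A (B (B e))) (A (B (B e)))"
    using derivs_A[OF derivs_bbb] three by simp
  then have "derivs 5 (B (A (bpow 3))) (B (bpow 3) + B (A (B (B e)))) (A (bpow 3) + B (A (B (B e))))"
    using derivs_B by fastforce
  then have "derivs 6 (A (B (A (bpow 3)))) (B (A (bpow 3)) + A (B (bpow 3) + B (A (B (B e)))))
      (A (A (bpow 3) + B (A (B (B e)))))"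
    using derivs_A by fastforce
  then have "A (A (bpow 3) + B (A (B (B e)))) = 0"
    using zero by (simp add: derivs_def)
  then have abab: "A (B (A (B (B e)))) = 0" by (simp add: rel_aa)
  have "derivs 4 (B (A (B (B e)))) (A (B (B e)) + B (B (B e) + A (B e))) (A (B (B e)))"
    using derivs_B[OF derivs_abb] by simp
  then have "derivs 5 (A (B (A (B (B e))))) (B (A (B (B e))) + A (A (B (B e)) + B (B (B e) + A (B e)))) (A (A (B (B e))))"
    using derivs_A by fastforce
  then have eq: "B (A (B (B e))) + (A (B (B (B e))) + A (B (A (B e)))) = 0"
    using abab by (simp add: derivs_def rel_aa)
  have "deriv Vb (B (A (B (B e)))) = A (B (B e))" "deriv Vb (A (B (B (B e)))) = A (B (B e))"
    using derivs_B[OF derivs_abb] derivs_A[OF derivs_bbb] by (simp_all add: derivs_def)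
  moreover have "deriv Vb (A (B (A (B e)))) = A (B (A e))"
  proof -
    have "derivs 3 (B (A (B e))) (B (B e)) (A (B e) + B (A e))"
      using derivs_B[OF derivs_ab] by (simp add: numeral_3_eq_3 numeral_2_eq_2)
    from derivs_A[OF this] show ?thesis by (simp add: derivs_def rel_aa)
  qed
  ultimately have "A (B (A e)) = 0"
    using arg_cong[OF eq, of "deriv Vb"] double_zero[of "A (B (B e))"] by (simp flip: add.assoc)
  then have "B (A e) + A (B e) = 0" using derivs_aba by (simp add: derivs_def)
  then have "deriv Va (B (A e)) + deriv Va (A (B e)) = 0" using deriv_simps by metis
  then have "A e = 0" using derivs_ab derivs_ba by (simp add: derivs_def double_zero add.assoc)
  then show False using derivs_a by (simp add: derivs_def)
qed

text \<open>Alternating words with a as rightmost letter; for c < 4 they are 1, a, ba, aba, the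
  middle parts of the normal forms.\<close>

fun alt :: "nat \<Rightarrow> ('g path \<Rightarrow>\<^sub>0 'k) \<Rightarrow> ('g path \<Rightarrow>\<^sub>0 'k)" where
  "alt 0 x = x"
| "alt (Suc c) x = (if even c then A (alt c x) else B (alt c x))"

end

text \<open>Independence of the indexed family also yields injectivity: an equality f i = f j would
  be a relation with coefficients 1 and -1. The dimension count needs both.\<close>

lemma independent_family:
  fixes f :: "'i \<Rightarrow> ('x \<Rightarrow>\<^sub>0 'k::field)"
  assumes fin: "finite I"
    and indep: "\<And>r i. (\<Sum>i\<in>I. pscale (r i) (f i)) = 0 \<Longrightarrow> i \<in> I \<Longrightarrow> r i = 0"
  shows "inj_on f I" and "pm.independent (f ` I)"
proof -
  show inj: "inj_on f I"
  proof (rule inj_onI, rule ccontr)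
    fix i j assume ij: "i \<in> I" "j \<in> I" "f i = f j" "i \<noteq> j"
    let ?r = "\<lambda>k. if k = i then 1 else if k = j then -1 else (0 :: 'k)"
    have "(\<Sum>k\<in>I. pscale (?r k) (f k)) = (\<Sum>k\<in>I. (if k = i then f i else 0) + (if k = j then - f j else 0))"
      by (rule sum.cong) (use ij(4) in auto)
    also have "\<dots> = 0" using ij fin by (simp add: sum.distrib)
    finally show False using indep[of ?r i] ij(1) by simp
  qed
  show "pm.independent (f ` I)"
  proof (rule pm.independent_if_scalars_zero)
    show "finite (f ` I)" using fin by simp
    fix r x assume "(\<Sum>x\<in>f ` I. pscale (r x) x) = 0" "x \<in> f ` I"
    then show "r x = 0" using indep[of "\<lambda>i. r (f i)"] by (auto simp: sum.reindex[OF inj])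
  qed
qed

context jordan_quiver
begin

section \<open>Linear independence of the normal forms\<close>

lemma alt_simps [simp]: "alt c (x + y) = alt c x + alt c y" "alt c (pscale r x) = pscale r (alt c x)" "alt c 0 = 0"
  by (induction c) auto

lemma alt_pathspace [simp]: "x \<in> pathspace \<Longrightarrow> alt c x \<in> pathspace"
  by (induction c) auto

lemma alt_M: "x \<in> pathspace \<Longrightarrow> y \<in> pathspace \<Longrightarrow> M (alt c x) y = alt c (M x y)"
  by (induction c) (auto simp: AB_assoc[symmetric])

lemma lessThan_4: "{..<4::nat} = {0, 1, 2, 3}"
  by auto

lemma alt_numeral: "alt 1 x = A x" "alt 2 x = B (A x)" "alt 3 x = A (B (A x))"
  by (simp_all add: numeral_2_eq_2 numeral_3_eq_3)

text \<open>Multiplication by aba, ab and a carries 1, a and ba, respectively, to aba and kills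
  every later word in front of b^3. The coefficients are thus found to vanish one after another, the
  last because aba b^3 is nonzero.\<close>

lemma alt_bpow_3_independent:
  assumes sum: "(\<Sum>c<4. pscale (r c) (alt c (bpow 3))) = 0" and c: "c < 4"
  shows "r c = 0"
proof -
  define x where "x = bpow 3"
  have x: "x \<in> pathspace" by (simp add: x_def)
  have bx: "B x = 0" using bpow_ge_4[of 4] by (simp add: x_def numeral_eq_Suc)
  \<comment> \<open>baba x = abab x, which ends in b x = b^4 = 0.\<close>
  have baba: "B (A (B (A x))) = 0" using rel_baba[OF x] by (simp add: bx)
  \<comment> \<open>Rewriting b^2 a as ab^2 + aba makes both terms start with a^2.\<close>
  have abba: "A (B (B (A x))) = 0" using x by (simp add: rel_bba rel_aa)
  have z: "A (B (A x)) \<noteq> 0" unfolding x_def by (rule socle_neq_0)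
  have s: "pscale (r 0) x + pscale (r 1) (A x) + pscale (r 2) (B (A x)) + pscale (r 3) (A (B (A x))) = 0"
    using sum unfolding lessThan_4 by (simp add: alt_numeral x_def add.assoc del: One_nat_def)
  have "pscale (r 0) (A (B (A x))) = 0"
    using arg_cong[OF s, of "\<lambda>y. A (B (A y))"] x by (simp add: rel_aa baba)
  then have r0: "r 0 = 0" using z by simp
  have "pscale (r 1) (A (B (A x))) = 0"
    using arg_cong[OF s, of "\<lambda>y. A (B y)"] x by (simp add: bx baba abba)
  then have r1: "r 1 = 0" using z by simp
  have "pscale (r 2) (A (B (A x))) = 0"
    using arg_cong[OF s, of A] x by (simp add: r0 r1 rel_aa)
  then have r2: "r 2 = 0" using z by simp
  have "r 3 = 0" using s z by (simp add: r0 r1 r2 del: One_nat_def)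
  then show ?thesis using r0 r1 r2 c by (auto simp: less_Suc_eq numeral_eq_Suc)
qed

text \<open>After multiplication by b^(3-l) on the right, terms with larger powers of b vanish since
  b^4 = 0, and those with smaller powers vanish by induction. What remains is a relation among the
  words in front of b^3.\<close>

lemma alt_bpow_independent:
  assumes sum: "(\<Sum>c<4. \<Sum>l<4. pscale (r c l) (alt c (bpow l))) = 0"
  shows "l < 4 \<Longrightarrow> \<forall>c<4. r c l = 0"
proof (induction l rule: less_induct)
  case (less l)
  have "M (\<Sum>c<4. \<Sum>l'<4. pscale (r c l') (alt c (bpow l'))) (bpow (3 - l)) =
      (\<Sum>c<4. \<Sum>l'<4. pscale (r c l') (alt c (bpow (l' + (3 - l)))))"
    by (simp add: plinear_sum[OF plinear_M_left[OF plinear_ident]] alt_M M_bpow)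
  also have "\<dots> = (\<Sum>c<4. \<Sum>l'<4. if l' = l then pscale (r c l) (alt c (bpow 3)) else 0)"
  proof (intro sum.cong refl)
    fix c l' :: nat assume "c \<in> {..<4}" "l' \<in> {..<4}"
    then consider "l' < l" "r c l' = 0" | "l' = l" | "l' > l" using less.IH[of l'] by fastforce
    then show "pscale (r c l') (alt c (bpow (l' + (3 - l)))) =
        (if l' = l then pscale (r c l) (alt c (bpow 3)) else 0)"
      by cases (use less.prems in \<open>simp_all add: bpow_ge_4\<close>)
  qed
  also have "\<dots> = (\<Sum>c<4. pscale (r c l) (alt c (bpow 3)))" using less.prems by simp
  finally have "(\<Sum>c<4. pscale (r c l) (alt c (bpow 3))) = 0" unfolding sum by simp
  then show ?case using alt_bpow_3_independent[of "\<lambda>c. r c l"] by blast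
qed

definition normal :: "nat \<times> nat \<times> nat \<Rightarrow> ('g path \<Rightarrow>\<^sub>0 'k)" where
  "normal = (\<lambda>(k, c, l). M (bas (g [^] k, [])) (alt c (bpow l)))"

abbreviation "NI \<equiv> {..<n} \<times> {..<4::nat} \<times> {..<4::nat}"

lemma homog_alt_bpow: "homog \<one> (c + l) (alt c (bpow l))"
proof -
  have a: "homog \<one> 1 (bas (\<one>, [i]))" for i by (simp add: homog_def)
  have "homog \<one> l (bpow l)"
  proof (induction l)
    case 0
    show ?case by (simp add: homog_def)
  next
    case (Suc l)
    then show ?case using homog_M[OF a Suc] by (simp add: B_def)
  qed
  then show ?thesis
  proof (induction c)
    case (Suc c)
    then show ?case using homog_M[OF a Suc.IH[OF Suc.prems]] by (auto simp: A_def B_def)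
  qed simp
qed

lemma ord_g: "ord g = n"
  using generate_pow_card[OF g_closed] order_eq carrier_eq by (simp add: order_def)

lemma g_pow_inj: "k < n \<Longrightarrow> k' < n \<Longrightarrow> g [^] k = g [^] k' \<Longrightarrow> k = k'"
  using ord_inj[OF g_closed] n_pos unfolding ord_g by (auto dest!: inj_onD)

lemma g_pow_n: "g [^] n = \<one>"
  using pow_order_eq_1[OF g_closed] order_eq by simp

definition source_part :: "'g \<Rightarrow> ('g path \<Rightarrow>\<^sub>0 'k) \<Rightarrow> ('g path \<Rightarrow>\<^sub>0 'k)" where
  "source_part h = lin_ext (\<lambda>p. if fst p = h then bas p else 0)"

lemma source_part_homog: "homog c m x \<Longrightarrow> source_part h x = (if c = h then x else 0)"
proof -
  assume x: "homog c m x"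
  have lin: "plinear (source_part h)" unfolding source_part_def by (rule linear_lin_ext)
  show ?thesis
  proof (rule plinear_eqI[where x = x and f' = "\<lambda>x. if c = h then x else 0", OF lin])
    show "plinear (\<lambda>x :: 'g path \<Rightarrow>\<^sub>0 'k. if c = h then x else 0)" by (rule plinearI) auto
    fix p assume "p \<in> supp x"
    then show "source_part h (bas p) = (if c = h then bas p else 0)"
      using homog_suppD[OF x] by (fastforce simp: source_part_def)
  qed
qed

text \<open>A normal form with group part g^k consists of paths starting at g^k. Projecting onto
  this source separates the powers of g, and multiplying by the inverse of g^k leaves a relation
  among words in a and b.\<close>

lemma normal_independent:
  assumes sum: "(\<Sum>i\<in>NI. pscale (r i) (normal i)) = 0" and i: "i \<in> NI"
  shows "r i = 0"
proof -
  obtain k c l where kcl: "i = (k, c, l)" "k < n" "c < 4" "l < 4" using i by auto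
  have lin: "plinear (source_part h)" for h unfolding source_part_def by (rule linear_lin_ext)
  have M_normal: "M (bas (inv (g [^] k), [])) (normal (k, c, l)) = alt c (bpow l)" for c l
    by (simp add: normal_def M_assoc[symmetric] M_vertices M_one_left)
  have part: "source_part (g [^] k) (normal (k', c, l)) = (if k' = k then normal (k', c, l) else 0)"
    if "k' < n" for k' c l
  proof -
    have "homog (g [^] k') (c + l) (normal (k', c, l))"
      using homog_M[OF homog_bas[of "g [^] k'" "[]"] homog_alt_bpow[of c l]] by (simp add: normal_def)
    then show ?thesis using g_pow_inj[OF that kcl(2)] source_part_homog by auto
  qed
  have "(\<Sum>i\<in>NI. pscale (r i) (normal i)) = (\<Sum>k'<n. \<Sum>c<4. \<Sum>l<4. pscale (r (k', c, l)) (normal (k', c, l)))"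
    by (simp add: sum.cartesian_product)
  then have "0 = source_part (g [^] k) (\<Sum>k'<n. \<Sum>c<4. \<Sum>l<4. pscale (r (k', c, l)) (normal (k', c, l)))"
    using sum by (simp add: plinear_zero[OF lin])
  also have "\<dots> = (\<Sum>k'<n. \<Sum>c<4. \<Sum>l<4. pscale (r (k', c, l)) (source_part (g [^] k) (normal (k', c, l))))"
    by (simp only: plinear_sum[OF lin] plinear_scale[OF lin])
  also have "\<dots> = (\<Sum>k'<n. if k' = k then (\<Sum>c<4. \<Sum>l<4. pscale (r (k, c, l)) (normal (k, c, l))) else 0)"
    by (rule sum.cong) (auto simp: part)
  also have "\<dots> = (\<Sum>c<4. \<Sum>l<4. pscale (r (k, c, l)) (normal (k, c, l)))" using kcl(2) by simp
  finally have "M (bas (inv (g [^] k), [])) (\<Sum>c<4. \<Sum>l<4. pscale (r (k, c, l)) (normal (k, c, l))) = 0"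
    by simp
  then have "(\<Sum>c<4. \<Sum>l<4. pscale (r (k, c, l)) (alt c (bpow l))) = 0"
    by (simp add: plinear_sum[OF plinear_M_right[OF plinear_ident]] M_normal)
  then show ?thesis using alt_bpow_independent[of "\<lambda>c l. r (k, c, l)"] kcl by blast
qed

lemma inj_on_normal: "inj_on normal NI" and independent_normal: "pm.independent (normal ` NI)"
  by (rule independent_family; use normal_independent in auto)+

end

section \<open>The free algebra\<close>

lemma bas_word_mult: "bas (Word u) * bas (Word v) = (bas (Word (u @ v)) :: 'l word \<Rightarrow>\<^sub>0 'k::field)"
  by (simp add: bas_def mult_single plus_word_def)

lemma one_word: "(1 :: 'l word \<Rightarrow>\<^sub>0 'k::field) = bas (Word [])"
  by (simp add: bas_def flip: single_one zero_word_def)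

lemma pscale_word: "pscale c x = (Poly_Mapping.single 0 c :: 'l word \<Rightarrow>\<^sub>0 'k::field) * x"
  by (simp add: pscale_def mult_map_scale_conv_mult)

lemma scalar_commute: "x * Poly_Mapping.single 0 c = Poly_Mapping.single 0 c * (x :: 'l word \<Rightarrow>\<^sub>0 'k::field)"
proof -
  have "pscale d (bas p) = Poly_Mapping.single p d" for d :: 'k and p :: "'l word"
    by (rule poly_mapping_eqI) (simp add: lookup_bas lookup_single when_def)
  then show ?thesis
    by (subst (1 2) bas_expansion[of x])
      (simp add: sum_distrib_left sum_distrib_right mult_single mult.commute)
qed

lemma pscale_mult_left: "pscale c x * y = pscale c (x * (y :: 'l word \<Rightarrow>\<^sub>0 'k::field))"
  by (simp add: pscale_word mult.assoc)

lemma pscale_mult_right: "x * pscale c y = pscale c (x * (y :: 'l word \<Rightarrow>\<^sub>0 'k::field))"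
  by (simp add: pscale_word scalar_commute flip: mult.assoc)

lemma plinear_word_mult_left [lin_intros]: "plinear h \<Longrightarrow> plinear (\<lambda>x. h x * (y :: 'l word \<Rightarrow>\<^sub>0 'k::field))"
  by (rule plinearI) (simp_all add: plinear_add plinear_scale distrib_right pscale_mult_left)

lemma plinear_word_mult_right [lin_intros]: "plinear h \<Longrightarrow> plinear (\<lambda>x. (y :: 'l word \<Rightarrow>\<^sub>0 'k::field) * h x)"
  by (rule plinearI) (simp_all add: plinear_add plinear_scale distrib_left pscale_mult_right)

section \<open>Two-sided ideals and evaluation of the free algebra\<close>

lemma ideal_generated_base: "x \<in> R \<Longrightarrow> x \<in> ideal_generated R"
  and ideal_generated_zero: "0 \<in> ideal_generated R"
  and ideal_generated_diff: "x \<in> ideal_generated R \<Longrightarrow> y \<in> ideal_generated R \<Longrightarrow> x - y \<in> ideal_generated R"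
  and ideal_generated_mult_left: "x \<in> ideal_generated R \<Longrightarrow> r * x \<in> ideal_generated R"
  and ideal_generated_mult_right: "x \<in> ideal_generated R \<Longrightarrow> x * r \<in> ideal_generated R"
  unfolding ideal_generated_def by auto

lemma ideal_generated_uminus: "x \<in> ideal_generated R \<Longrightarrow> - x \<in> ideal_generated R"
  using ideal_generated_diff[OF ideal_generated_zero, of x] by simp

lemma ideal_generated_add: "x \<in> ideal_generated R \<Longrightarrow> y \<in> ideal_generated R \<Longrightarrow> x + y \<in> ideal_generated R"
  using ideal_generated_diff[OF _ ideal_generated_uminus, of x _ y] by simp

lemma ideal_generated_least:
  assumes "R \<subseteq> I" "0 \<in> I" "\<And>x y. x \<in> I \<Longrightarrow> y \<in> I \<Longrightarrow> x - y \<in> I"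
    "\<And>x r. x \<in> I \<Longrightarrow> r * x \<in> I" "\<And>x r. x \<in> I \<Longrightarrow> x * r \<in> I"
  shows "ideal_generated R \<subseteq> I"
  using assms unfolding ideal_generated_def by auto

text \<open>Scaling is multiplication by a multiple of 1, so ideals absorb scalars.\<close>

lemma subspace_ideal_generated:
  "pm.subspace (ideal_generated R :: ('l word \<Rightarrow>\<^sub>0 'k::field) set)"
  by (simp add: pm.subspace_def ideal_generated_zero ideal_generated_add ideal_generated_mult_left pscale_word)

lemma plinear_free_eval [lin_intros]: "plinear h \<Longrightarrow> plinear (\<lambda>x. free_eval M u f (h x))"
  unfolding free_eval_def by (intro lin_intros)

lemma free_eval_bas: "free_eval M u f (bas (Word w)) = foldr (\<lambda>l x. M (f l) x) w u"
  by (simp add: free_eval_def)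

context jordan_quiver
begin

section \<open>The presentation\<close>

abbreviation ev :: "(gen word \<Rightarrow>\<^sub>0 'k) \<Rightarrow> ('g path \<Rightarrow>\<^sub>0 'k)" where
  "ev \<equiv> free_eval M e (gen_val G g)"

lemma linear_ev: "plinear ev"
  by (intro lin_intros)

lemma gen_val_pathspace [simp]: "gen_val G g l \<in> pathspace"
  by (cases l) (simp_all add: vertex_bas)

lemma ev_Nil: "ev (bas (Word [])) = e"
  and ev_Cons: "ev (bas (Word (l # w))) = M (gen_val G g l) (ev (bas (Word w)))"
  by (simp_all add: free_eval_bas)

lemma ev_in_subspace:
  assumes "pm.subspace S" "\<And>w. ev (bas (Word w)) \<in> S"
  shows "ev x \<in> S"
  unfolding plinear_expand[OF linear_ev, of x]
  by (intro pm.subspace_sum pm.subspace_scale assms(1)) (metis assms(2) word.exhaust)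

lemma ev_pathspace [simp]: "ev x \<in> pathspace"
proof (rule ev_in_subspace[OF subspace_pathspace])
  fix w show "ev (bas (Word w)) \<in> pathspace"
    by (induction w) (simp_all add: ev_Nil ev_Cons M_pathspace)
qed

lemma ev_mult: "ev (x * y) = M (ev x) (ev y)"
proof (rule plinear_eq2I[where x = x and y = y])
  fix p q :: "gen word"
  obtain u v where p: "p = Word u" and q: "q = Word v" by (metis word.exhaust)
  have "ev (bas (Word (u @ v))) = M (ev (bas (Word u))) (ev (bas (Word v)))"
    by (induction u) (simp_all add: ev_Nil ev_Cons M_one_left M_assoc)
  then show "ev (bas p * bas q) = M (ev (bas p)) (ev (bas q))"
    by (simp add: p q bas_word_mult)
qed (intro lin_intros)+

lemma ev_simps [simp]:
  "ev (x + y) = ev x + ev y" "ev (x - y) = ev x - ev y" "ev (pscale c x) = pscale c (ev x)" "ev 0 = 0" "ev 1 = e"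
  using pmp.linear_diff[OF linear_ev]
  by (simp_all add: plinear_add[OF linear_ev] plinear_scale[OF linear_ev] plinear_zero[OF linear_ev] one_word ev_Nil)

lemma ev_var: "ev (var l) = gen_val G g l"
  by (simp add: var_def ev_Cons ev_Nil M_one_right)

lemma ev_a_mult: "ev (var Gen_a * x) = A (ev x)" and ev_b_mult: "ev (var Gen_b * x) = B (ev x)"
  by (simp_all add: ev_mult ev_var A_def B_def)

lemma ev_a: "ev (var Gen_a) = A e" and ev_b: "ev (var Gen_b) = B e"
  by (simp_all add: ev_var A_def B_def M_one_right)

lemma ev_g_pow: "ev (var Gen_g ^ k) = bas (g [^] k, [])"
proof (induction k)
  case (Suc k)
  have "g \<otimes> g [^] k = g [^] Suc k" by (simp add: m_comm)
  then show ?case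
    by (simp add: ev_mult ev_var Suc vertex_bas M_vertices del: nat_pow_Suc)
qed simp

lemma ev_b_pow: "ev (var Gen_b ^ l) = bpow l"
  by (induction l) (simp_all add: ev_b_mult)

fun alt_word :: "nat \<Rightarrow> (gen word \<Rightarrow>\<^sub>0 'k)" where
  "alt_word 0 = 1"
| "alt_word (Suc c) = (if even c then var Gen_a else var Gen_b) * alt_word c"

definition normal_word :: "nat \<times> nat \<times> nat \<Rightarrow> (gen word \<Rightarrow>\<^sub>0 'k)" where
  "normal_word = (\<lambda>(k, c, l). var Gen_g ^ k * (alt_word c * var Gen_b ^ l))"

lemma ev_normal_word: "ev (normal_word i) = normal i"
proof -
  obtain k c l where i: "i = (k, c, l)" by (cases i)
  have "ev (alt_word c * var Gen_b ^ l) = alt c (bpow l)"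
    by (induction c) (simp_all add: ev_b_pow mult.assoc ev_a_mult ev_b_mult)
  then show ?thesis by (simp add: i normal_word_def normal_def ev_mult[of "var Gen_g ^ k"] ev_g_pow)
qed

text \<open>These are ag = ga and bg = g(a + b): the path (g, [i]) is g times the arrow i from the
  unit, and moving g to the left applies the module action.\<close>

lemma arrow_vertex:
  "M (bas (\<one>, [Va])) (bas (g, [])) = bas (g, [Va])"
  "M (bas (\<one>, [Vb])) (bas (g, [])) = bas (g, [Va]) + bas (g, [Vb])"
proof -
  have h: "homog g 1 (M (bas (\<one>, [i])) (bas (g, [])))" "homog g 1 (bas (g, [i]))" for i
    using homog_M[OF homog_bas[of \<one> "[i]"] homog_bas[of g "[]"]] by (simp_all add: homog_def)
  note coeff = act_coeff_pow[of 1, simplified]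
  show "M (bas (\<one>, [Va])) (bas (g, [])) = bas (g, [Va])"
    by (rule homog_eqI[OF h]) (auto simp: deriv_M_bas deriv_bas coeff M_vertices, metis (full_types) coeff vbasis.exhaust)
  show "M (bas (\<one>, [Vb])) (bas (g, [])) = bas (g, [Va]) + bas (g, [Vb])"
  proof (rule homog_eqI[OF h(1) homog_add[OF h(2) h(2)]])
    show "deriv i (M (bas (\<one>, [Vb])) (bas (g, []))) = deriv i (bas (g, [Va]) + bas (g, [Vb]))" for i
      by (cases i) (simp_all add: deriv_M_bas deriv_bas coeff M_vertices)
  qed simp
qed

abbreviation "RI \<equiv> ideal_generated (biproduct_relations n :: (gen word \<Rightarrow>\<^sub>0 'k) set)"

lemma relations_in_RI:
  fixes a b gg :: "gen word \<Rightarrow>\<^sub>0 'k"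
  defines "a \<equiv> var Gen_a" and "b \<equiv> var Gen_b" and "gg \<equiv> var Gen_g"
  shows "gg ^ n - 1 \<in> RI" "gg ^ (n - 1) * a * gg - a \<in> RI" "gg ^ (n - 1) * b * gg - (a + b) \<in> RI"
    "a ^ 2 \<in> RI" "b ^ 4 \<in> RI" "b * a * b * a - a * b * a * b \<in> RI" "b ^ 2 * a - (a * b ^ 2 + a * b * a) \<in> RI"
  unfolding assms by (rule ideal_generated_base; simp add: biproduct_relations_def Let_def)+

lemma ev_RI: "x \<in> RI \<Longrightarrow> ev x = 0"
proof -
  have "RI \<subseteq> {x. ev x = 0}"
  proof (rule ideal_generated_least)
    have gn: "g [^] (n - 1) \<otimes> g = \<one>" using g_pow_n n_pos by (metis Suc_pred' nat_pow_Suc)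
    have cancel: "M (bas (g [^] (n - 1), [])) (bas (g, [i])) = bas (\<one>, [i])" for i
      using gn by (simp add: M_vertex_left)
    have four: "var Gen_b ^ 4 = (var Gen_b * (var Gen_b * (var Gen_b * var Gen_b)) :: gen word \<Rightarrow>\<^sub>0 'k)"
      by (simp add: numeral_eq_Suc)
    have "ev x = 0" if "x \<in> biproduct_relations n" for x
      using that unfolding biproduct_relations_def Let_def
      by (auto simp: ev_g_pow g_pow_n mult.assoc power2_eq_square ev_a_mult ev_b_mult ev_a ev_b four
          aa bbbb bba baba)
        (simp_all add: ev_mult ev_g_pow ev_var vertex_bas arrow_vertex cancel[unfolded One_nat_def] A_def B_def M_one_right)
    then show "biproduct_relations n \<subseteq> {x. ev x = 0}" by blast
  qed (simp_all add: ev_mult)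
  then show "x \<in> RI \<Longrightarrow> ev x = 0" by blast
qed

text \<open>The words \<open>g\<^sup>k w b\<^sup>l\<close> with \<open>k < n\<close>, \<open>w \<in> {1, a, ba, aba}\<close> and \<open>l < 4\<close> span the free algebra modulo the
  relations, because their span plus the ideal is a left ideal containing \<open>1\<close>.\<close>

definition reducible :: "(gen word \<Rightarrow>\<^sub>0 'k) set" where
  "reducible = {x. \<exists>y\<in>pm.span (normal_word ` NI). x - y \<in> RI}"

lemma reducible_cong: "x \<in> reducible \<Longrightarrow> x' - x \<in> RI \<Longrightarrow> x' \<in> reducible"
  unfolding reducible_def using ideal_generated_add[of "x' - x" _ "x - y" for y] by force

lemma RI_reducible: "x \<in> RI \<Longrightarrow> x \<in> reducible"
  unfolding reducible_def using pm.span_zero by force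

lemma span_reducible: "x \<in> pm.span (normal_word ` NI) \<Longrightarrow> x \<in> reducible"
  unfolding reducible_def using ideal_generated_zero by force

lemma subspace_reducible: "pm.subspace reducible"
  unfolding pm.subspace_def
proof (intro conjI allI ballI)
  show "0 \<in> reducible" by (rule RI_reducible[OF ideal_generated_zero])
next
  fix x x' assume "x \<in> reducible" "x' \<in> reducible"
  then obtain y y' where "y \<in> pm.span (normal_word ` NI)" "x - y \<in> RI"
    "y' \<in> pm.span (normal_word ` NI)" "x' - y' \<in> RI" unfolding reducible_def by blast
  then have "y + y' \<in> pm.span (normal_word ` NI)" "(x + x') - (y + y') \<in> RI"
    using ideal_generated_add[of "x - y" _ "x' - y'"] by (simp_all add: pm.span_add algebra_simps)
  then show "x + x' \<in> reducible" unfolding reducible_def by blast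
next
  fix c x assume "x \<in> reducible"
  then obtain y where "y \<in> pm.span (normal_word ` NI)" "x - y \<in> RI" unfolding reducible_def by blast
  then have "pscale c y \<in> pm.span (normal_word ` NI)" "pscale c x - pscale c y \<in> RI"
    using pm.subspace_scale[OF subspace_ideal_generated, of "x - y" _ c]
    by (simp_all add: pm.span_scale pm.scale_right_diff_distrib)
  then show "pscale c x \<in> reducible" unfolding reducible_def by blast
qed

section \<open>Reduction of words modulo the relations\<close>

context
  fixes a b gg :: "gen word \<Rightarrow>\<^sub>0 'k"
  defines a_def: "a \<equiv> var Gen_a" and b_def: "b \<equiv> var Gen_b" and gg_def: "gg \<equiv> var Gen_g"
begin

lemmas relations = relations_in_RI[folded a_def b_def gg_def]

lemma alt_word_cases:
  "alt_word 0 = 1" "alt_word 1 = a" "alt_word 2 = b * a" "alt_word 3 = a * (b * a)"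
  by (simp_all add: numeral_2_eq_2 numeral_3_eq_3 a_def b_def)

text \<open>The exponent \<open>l\<close> is left unbounded so that reductions may push further
  letters b to the right; from l = 4 on the word lies in the ideal.\<close>

lemma normal_reducible:
  assumes "k < n" "c < 4"
  shows "gg ^ k * (alt_word c * b ^ l) \<in> reducible"
proof (cases "l < 4")
  case True
  then have "normal_word (k, c, l) \<in> reducible"
    using assms by (intro span_reducible pm.span_base) auto
  then show ?thesis by (simp add: normal_word_def gg_def b_def)
next
  case False
  then have "b ^ l = b ^ 4 * b ^ (l - 4)" by (simp flip: power_add)
  then have "b ^ l \<in> RI" using relations(5) by (simp add: ideal_generated_mult_right)
  then show ?thesis by (intro RI_reducible ideal_generated_mult_left)
qed

lemma gg_pow_pred: "gg * gg ^ (n - 1) = gg ^ n"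
  using n_pos by (metis Suc_pred' power_Suc)

text \<open>The given relation concerns conjugation by g^(n-1). Multiplying by g and replacing g^n
  by 1 turns it into a commutation rule.\<close>

lemma a_gg: "a * gg - gg * a \<in> RI"
proof -
  have "a * gg - gg * a = gg * (gg ^ (n - 1) * a * gg - a) - (gg ^ n - 1) * (a * gg)"
    unfolding gg_pow_pred[symmetric] by (simp add: algebra_simps)
  then show ?thesis
    using relations(1,2) by (simp add: ideal_generated_diff ideal_generated_mult_left ideal_generated_mult_right)
qed

lemma b_gg: "b * gg - gg * (a + b) \<in> RI"
proof -
  have "b * gg - gg * (a + b) = gg * (gg ^ (n - 1) * b * gg - (a + b)) - (gg ^ n - 1) * (b * gg)"
    unfolding gg_pow_pred[symmetric] by (simp add: algebra_simps)
  then show ?thesis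
    using relations(1,3) by (simp add: ideal_generated_diff ideal_generated_mult_left ideal_generated_mult_right)
qed

lemma a_gg_pow: "a * gg ^ k - gg ^ k * a \<in> RI"
proof (induction k)
  case (Suc k)
  have "a * gg ^ Suc k - gg ^ Suc k * a = (a * gg - gg * a) * gg ^ k + gg * (a * gg ^ k - gg ^ k * a)"
    by (simp add: algebra_simps)
  then show ?case
    using a_gg Suc by (simp add: ideal_generated_add ideal_generated_mult_left ideal_generated_mult_right)
qed (simp add: ideal_generated_zero)

text \<open>Each power of g adds another a. For spanning any coefficient of a will do, so it stays
  existential.\<close>

lemma b_gg_pow: "\<exists>r. b * gg ^ k - gg ^ k * (b + pscale r a) \<in> RI"
proof (induction k)
  case 0
  have "b * gg ^ 0 - gg ^ 0 * (b + pscale 0 a) \<in> RI" by (simp add: ideal_generated_zero)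
  then show ?case by blast
next
  case (Suc k)
  then obtain r where r: "b * gg ^ k - gg ^ k * (b + pscale r a) \<in> RI" by blast
  have "b * gg ^ Suc k - gg ^ Suc k * (b + pscale (r + 1) a) =
      (b * gg - gg * (a + b)) * gg ^ k + gg * (a * gg ^ k - gg ^ k * a)
      + gg * (b * gg ^ k - gg ^ k * (b + pscale r a))"
    by (simp add: algebra_simps pm.scale_left_distrib)
  then show ?case
    using a_gg_pow[of k] b_gg r
    by (metis ideal_generated_add ideal_generated_mult_left ideal_generated_mult_right)
qed

lemma a_normal_reducible:
  assumes k: "k < n" and c: "c < 4"
  shows "gg ^ k * (a * (alt_word c * b ^ l)) \<in> reducible"
proof -
  consider "c = 0" | "c = 1" | "c = 2" | "c = 3" using c by linarith
  then show ?thesis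
  proof cases
    case 1
    then show ?thesis using normal_reducible[OF k, of 1 l] by (simp add: alt_word_cases del: One_nat_def)
  next
    case 2
    then have "gg ^ k * (a * (alt_word c * b ^ l)) = gg ^ k * (a ^ 2 * b ^ l)"
      by (simp add: alt_word_cases power2_eq_square mult.assoc del: One_nat_def)
    then show ?thesis
      using relations(4) by (simp add: RI_reducible ideal_generated_mult_left ideal_generated_mult_right)
  next
    case 3
    then show ?thesis using normal_reducible[OF k, of 3 l] by (simp add: alt_word_cases mult.assoc)
  next
    case 4
    then have "gg ^ k * (a * (alt_word c * b ^ l)) = gg ^ k * (a ^ 2 * (b * a * b ^ l))"
      by (simp add: alt_word_cases power2_eq_square mult.assoc)
    then show ?thesis
      using relations(4) by (simp add: RI_reducible ideal_generated_mult_left ideal_generated_mult_right)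
  qed
qed

text \<open>In front of 1 and a the letter b gives a normal form at once. In front of ba it makes
  b^2 a, replaced by ab^2 + aba, and in front of aba it makes baba, replaced by abab; the freed
  letters b join the power on the right.\<close>

lemma b_normal_reducible:
  assumes k: "k < n" and c: "c < 4"
  shows "gg ^ k * (b * (alt_word c * b ^ l)) \<in> reducible"
proof -
  consider "c = 0" | "c = 1" | "c = 2" | "c = 3" using c by linarith
  then show ?thesis
  proof cases
    case 1
    then show ?thesis using normal_reducible[OF k, of 0 "Suc l"] by simp
  next
    case 2
    then show ?thesis using normal_reducible[OF k, of 2 l] by (simp add: alt_word_cases mult.assoc del: One_nat_def)
  next
    case 3
    let ?y = "gg ^ k * (alt_word 1 * b ^ (l + 2)) + gg ^ k * (alt_word 3 * b ^ l)"
    have "?y \<in> reducible"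
      by (intro pm.subspace_add[OF subspace_reducible] normal_reducible k) simp_all
    moreover have "gg ^ k * (b * (alt_word c * b ^ l)) - ?y
        = gg ^ k * ((b ^ 2 * a - (a * b ^ 2 + a * b * a)) * b ^ l)"
      using 3 by (simp add: alt_word_cases power2_eq_square algebra_simps del: One_nat_def)
    ultimately show ?thesis
      using relations(7) by (metis reducible_cong ideal_generated_mult_left ideal_generated_mult_right)
  next
    case 4
    have "gg ^ k * (alt_word 3 * b ^ Suc l) \<in> reducible"
      by (intro normal_reducible k) simp
    moreover have "gg ^ k * (b * (alt_word c * b ^ l)) - gg ^ k * (alt_word 3 * b ^ Suc l)
        = gg ^ k * ((b * a * b * a - a * b * a * b) * b ^ l)"
      using 4 by (simp add: alt_word_cases algebra_simps)
    ultimately show ?thesis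
      using relations(6) by (metis reducible_cong ideal_generated_mult_left ideal_generated_mult_right)
  qed
qed

lemma left_mult_reducible:
  assumes normal: "\<And>k c l. k < n \<Longrightarrow> c < 4 \<Longrightarrow> s * (gg ^ k * (alt_word c * b ^ l)) \<in> reducible"
    and x: "x \<in> reducible"
  shows "s * x \<in> reducible"
proof -
  obtain y where y: "y \<in> pm.span (normal_word ` NI)" "x - y \<in> RI" using x unfolding reducible_def by blast
  have "s * y \<in> reducible" using y(1)
  proof (induction rule: pm.span_induct_alt)
    case base
    show ?case by (simp add: RI_reducible ideal_generated_zero)
  next
    case (step r z y)
    then have "s * z \<in> reducible"
      using normal by (auto simp: normal_word_def gg_def b_def)
    then show ?case
      using step.IH pm.subspace_add[OF subspace_reducible] pm.subspace_scale[OF subspace_reducible]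
      by (simp add: distrib_left pscale_mult_right)
  qed
  moreover have "s * x - s * y \<in> RI"
    using ideal_generated_mult_left[OF y(2), of s] by (simp add: right_diff_distrib)
  ultimately show ?thesis by (rule reducible_cong)
qed

lemma letter_mult_reducible:
  assumes "x \<in> reducible"
  shows "a * x \<in> reducible" "b * x \<in> reducible" "gg * x \<in> reducible"
proof -
  have a: "a * (gg ^ k * (alt_word c * b ^ l)) \<in> reducible" if k: "k < n" and c: "c < 4" for k c l
  proof -
    let ?w = "alt_word c * b ^ l"
    have eq: "a * (gg ^ k * ?w) - gg ^ k * (a * ?w) = (a * gg ^ k - gg ^ k * a) * ?w"
      by (simp add: algebra_simps)
    have "a * (gg ^ k * ?w) - gg ^ k * (a * ?w) \<in> RI"
      unfolding eq by (rule ideal_generated_mult_right[OF a_gg_pow])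
    then show "a * (gg ^ k * ?w) \<in> reducible"
      by (rule reducible_cong[OF a_normal_reducible[OF k c]])
  qed
  have b: "b * (gg ^ k * (alt_word c * b ^ l)) \<in> reducible" if k: "k < n" and c: "c < 4" for k c l
  proof -
    let ?w = "alt_word c * b ^ l"
    obtain r where r: "b * gg ^ k - gg ^ k * (b + pscale r a) \<in> RI" using b_gg_pow by blast
    let ?y = "gg ^ k * (b * ?w) + pscale r (gg ^ k * (a * ?w))"
    have "?y \<in> reducible"
      by (intro pm.subspace_add[OF subspace_reducible] pm.subspace_scale[OF subspace_reducible]
          a_normal_reducible b_normal_reducible k c)
    moreover have "b * (gg ^ k * ?w) - ?y = (b * gg ^ k - gg ^ k * (b + pscale r a)) * ?w"
      by (simp add: algebra_simps pscale_mult_left pscale_mult_right)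
    ultimately show "b * (gg ^ k * ?w) \<in> reducible"
      using ideal_generated_mult_right[OF r] reducible_cong by metis
  qed
  have g: "gg * (gg ^ k * (alt_word c * b ^ l)) \<in> reducible" if k: "k < n" and c: "c < 4" for k c l
  proof -
    let ?w = "alt_word c * b ^ l"
    show "gg * (gg ^ k * ?w) \<in> reducible"
    proof (cases "Suc k < n")
      case True
      then show ?thesis using normal_reducible[OF True c, of l] by (simp add: mult.assoc)
    next
      case False
      \<comment> \<open>Here the new exponent of g is n, and the relation g^n = 1 wraps it around to
        0.\<close>
      then have n: "n = Suc k" using k by simp
      have "gg ^ 0 * ?w \<in> reducible" by (rule normal_reducible[OF n_pos c])
      moreover have "gg * (gg ^ k * ?w) - gg ^ 0 * ?w = (gg ^ n - 1) * ?w"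
        by (simp add: n algebra_simps)
      ultimately show ?thesis using ideal_generated_mult_right[OF relations(1)] reducible_cong by metis
    qed
  qed
  show "a * x \<in> reducible" by (rule left_mult_reducible[OF a assms])
  show "b * x \<in> reducible" by (rule left_mult_reducible[OF b assms])
  show "gg * x \<in> reducible" by (rule left_mult_reducible[OF g assms])
qed

lemma all_reducible: "x \<in> reducible"
proof -
  have word: "bas (Word w) \<in> reducible" for w
  proof (induction w)
    case Nil
    show ?case using normal_reducible[of 0 0 0] n_pos by (simp flip: one_word)
  next
    case (Cons l w)
    have "bas (Word (l # w)) = var l * (bas (Word w) :: gen word \<Rightarrow>\<^sub>0 'k)" by (simp add: var_def bas_word_mult)
    then show ?case
      using letter_mult_reducible[OF Cons] by (cases l) (simp_all add: a_def b_def gg_def)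
  qed
  show ?thesis
    by (subst bas_expansion[of x])
      (intro pm.subspace_sum pm.subspace_scale subspace_reducible, metis word word.exhaust)
qed

end

text \<open>The values of the normal words are distinct and independent in kQ, so no nonzero
  combination of these words evaluates to 0.\<close>

lemma ev_inj_on_normal_words: "inj_on ev (pm.span (normal_word ` NI))"
proof (rule pmp.linear_inj_on_span_independent_image[OF linear_ev])
  have image: "ev ` normal_word ` NI = normal ` NI" by (simp add: image_image ev_normal_word)
  show "pm.independent (ev ` normal_word ` NI)" unfolding image by (rule independent_normal)
  show "inj_on ev (normal_word ` NI)"
    by (rule inj_on_imageI) (use inj_on_normal in \<open>simp add: comp_def ev_normal_word\<close>)
qed

text \<open>Modulo the relations, an element of the kernel is a combination of normal words. Its
  value is still 0, so by injectivity it is the zero combination.\<close>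

lemma kernel_ev: "{x. ev x = 0} = RI"
proof (intro equalityI subsetI)
  fix x assume x: "x \<in> {x. ev x = 0}"
  obtain y where y: "y \<in> pm.span (normal_word ` NI)" "x - y \<in> RI"
    using all_reducible[of x] unfolding reducible_def by blast
  have "ev y = ev 0" using ev_RI[OF y(2)] x by simp
  then have "y = 0" by (rule inj_onD[OF ev_inj_on_normal_words _ y(1) pm.span_zero])
  then show "x \<in> RI" using y(2) by simp
qed (simp add: ev_RI)

section \<open>Generation by a, b and g, the presentation and the dimension\<close>

lemma carrier_powers: "carrier G = (\<lambda>k. g [^] k) ` {..<n}"
proof (rule card_subset_eq[symmetric])
  show "finite (carrier G)" using order_eq n_pos unfolding order_def by (metis card.infinite less_irrefl)
  show "(\<lambda>k. g [^] k) ` {..<n} \<subseteq> carrier G" by auto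
  have "inj_on (\<lambda>k. g [^] k) {..<n}" using g_pow_inj by (auto intro: inj_onI)
  then show "card ((\<lambda>k. g [^] k) ` {..<n}) = card (carrier G)"
    using order_eq by (simp add: card_image order_def)
qed

lemma gen_val_in_H: "gen_val G g l \<in> H"
  by (cases l) (simp_all add: arrow_in_H vertex_in_H vertex_bas)

lemma range_ev: "range ev = H"
proof (intro equalityI subsetI)
  have "ev (bas (Word w)) \<in> H" for w
    by (induction w) (simp_all add: ev_Nil ev_Cons one_in_H M_in_H gen_val_in_H)
  then show "x \<in> H" if "x \<in> range ev" for x using that ev_in_subspace[OF subspace_H] by blast
next
  fix x assume "x \<in> H"
  then show "x \<in> range ev"
  proof (rule H_induct)
    show "pm.subspace (range ev)" unfolding pm.subspace_def
    proof (intro conjI ballI allI)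
      show "0 \<in> range ev" by (rule range_eqI[of _ _ 0]) simp
      show "x + y \<in> range ev" if xy: "x \<in> range ev" "y \<in> range ev" for x y
      proof -
        obtain u v where "x = ev u" "y = ev v" using xy by blast
        then show ?thesis by (intro range_eqI[of _ _ "u + v"]) simp
      qed
      show "pscale c x \<in> range ev" if x: "x \<in> range ev" for c x
      proof -
        obtain u where "x = ev u" using x by blast
        then show ?thesis by (intro range_eqI[of _ _ "pscale c u"]) simp
      qed
    qed
    show "bas (\<one>, [i]) \<in> range ev" for i
      by (rule range_eqI[of _ _ "var (case i of Va \<Rightarrow> Gen_a | Vb \<Rightarrow> Gen_b)"])
        (simp add: ev_var split: vbasis.split)
    show "bas (h, []) \<in> range ev" if h: "h \<in> carrier G" for h
    proof -
      obtain k where "h = g [^] (k::nat)" using h unfolding carrier_powers by blast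
      then show ?thesis by (intro range_eqI[of _ _ "var Gen_g ^ k"]) (simp add: ev_g_pow)
    qed
    show "M x y \<in> range ev" if xy: "x \<in> range ev" "y \<in> range ev" for x y
    proof -
      obtain u v where "x = ev u" "y = ev v" using xy by blast
      then show ?thesis by (intro range_eqI[of _ _ "u * v"]) (simp add: ev_mult)
    qed
  qed
qed

lemma H_generators: "H = subalgebra_generated M e (range (gen_val G g))" (is "_ = ?S")
proof (rule equalityI)
  have "ev (bas (Word w)) \<in> ?S" for w
  proof (induction w)
    case Nil
    show ?case using subalgebra_generated_unit by (simp add: ev_Nil)
  next
    case (Cons l w)
    then show ?case by (simp add: ev_Cons subalgebra_generated_mult subalgebra_generated_base)
  qed
  then have "ev x \<in> ?S" for x by (rule ev_in_subspace[OF subspace_subalgebra_generated])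
  then show "H \<subseteq> ?S" unfolding range_ev[symmetric] by blast
  show "?S \<subseteq> H"
  proof (rule subalgebra_generated_least)
    show "range (gen_val G g) \<subseteq> H" by (rule image_subsetI) (rule gen_val_in_H)
  qed (simp_all add: subspace_H one_in_H M_in_H)
qed

lemma presented_by_H: "presented_by H M one_vertex (gen_val G g) (biproduct_relations n)"
  unfolding presented_by_def vertex_bas using H_generators kernel_ev by blast

text \<open>Evaluating the reduction of words in the free algebra shows that the normal forms span
  \<open>H\<close>; there are n choices for the power of g, 4 for the alternating word and 4 for the
  power of b.\<close>

lemma dim_H: "pm.dim H = 16 * n"
proof -
  have "H = pm.span (normal ` NI)"
  proof (intro equalityI subsetI)
    fix x assume "x \<in> H"
    then obtain z where z: "x = ev z" using range_ev by blast
    obtain y where y: "y \<in> pm.span (normal_word ` NI)" "z - y \<in> RI"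
      using all_reducible[of z] unfolding reducible_def by blast
    have "x = ev y" using ev_RI[OF y(2)] z by simp
    also have "\<dots> \<in> ev ` pm.span (normal_word ` NI)" using y(1) by blast
    also have "\<dots> = pm.span (normal ` NI)"
      by (simp add: pmp.linear_span_image[OF linear_ev, symmetric] image_image ev_normal_word)
    finally show "x \<in> pm.span (normal ` NI)" .
  next
    fix x assume "x \<in> pm.span (normal ` NI)"
    moreover have "normal i \<in> H" for i
      using rangeI[of ev "normal_word i"] unfolding ev_normal_word range_ev .
    then have "normal ` NI \<subseteq> H" by blast
    ultimately show "x \<in> H" using pm.span_minimal[OF _ subspace_H] by blast
  qed
  then have "pm.dim H = card (normal ` NI)"
    using pm.dim_span_eq_card_independent[OF independent_normal] by metis
  then show ?thesis by (simp add: card_image[OF inj_on_normal] card_cartesian_product)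
qed

end

theorem corollary3p4:
  fixes G :: "('g, 'm) monoid_scheme"
    and g :: 'g
    and n :: nat
    and act :: "(vbasis \<Rightarrow>\<^sub>0 'k::field) \<Rightarrow> 'g \<Rightarrow> (vbasis \<Rightarrow>\<^sub>0 'k)"
  assumes "CHAR('k) = 2"
    and "group G" and "g \<in> carrier G" and "carrier G = generate G {g}"
    and "order G = n" and "n > 0" and "2 dvd n"
    and "right_module G act"
    and "act (bas Va) g = bas Va"
    and "act (bas Vb) g = bas Va + bas Vb"
  shows "let H = radford_biproduct G g act;
             M = path_mult G g act;
             \<Delta> = path_comult G g;
             one = vertex \<one>\<^bsub>G\<^esub>;
             a = arrow \<one>\<^bsub>G\<^esub> (bas Va);
             b = arrow \<one>\<^bsub>G\<^esub> (bas Vb);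
             gg = vertex g
         in hopf_algebra_on H M one \<Delta> path_counit
          \<and> pointed_on H \<Delta>
          \<and> pm.dim H = 16 * n
          \<and> presented_by H M one (gen_val G g) (biproduct_relations n)
          \<and> \<Delta> gg = gg \<otimes>\<^sub>k gg
          \<and> \<Delta> a = a \<otimes>\<^sub>k one + gg \<otimes>\<^sub>k a
          \<and> \<Delta> b = b \<otimes>\<^sub>k one + gg \<otimes>\<^sub>k b
          \<and> (\<forall>\<Delta>'. algebra_hom_on H M one (tensor_space H H) (tensor_mult M) (one \<otimes>\<^sub>k one) \<Delta>'
                \<and> \<Delta>' gg = gg \<otimes>\<^sub>k gg
                \<and> \<Delta>' a = a \<otimes>\<^sub>k one + gg \<otimes>\<^sub>k a
                \<and> \<Delta>' b = b \<otimes>\<^sub>k one + gg \<otimes>\<^sub>k b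
              \<longrightarrow> (\<forall>x\<in>H. \<Delta>' x = \<Delta> x))"
proof -
  interpret group G by fact
  have "h \<otimes>\<^bsub>G\<^esub> l = l \<otimes>\<^bsub>G\<^esub> h" if h: "h \<in> carrier G" and l: "l \<in> carrier G" for h l
  proof -
    \<comment> \<open>Both elements are powers of the single generator g and hence commute, which
      supplies the commutative group required by the quiver locale.\<close>
    obtain i j :: int where "h = g [^]\<^bsub>G\<^esub> i" "l = g [^]\<^bsub>G\<^esub> j"
      using h l generate_pow[OF assms(3)] assms(4) by blast
    then show ?thesis using assms(3) by (simp add: int_pow_mult[symmetric] add.commute)
  qed
  then have "comm_group G" by (rule group_comm_groupI)
  then interpret jordan_quiver G g act n
    using assms by (intro jordan_quiver.intro jordan_quiver_axioms.intro hopf_quiver.intro hopf_quiver_axioms.intro)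
  have coproducts: "D (vertex g) = vertex g \<otimes>\<^sub>k vertex g"
    "D (arrow \<one>\<^bsub>G\<^esub> (bas i)) = arrow \<one>\<^bsub>G\<^esub> (bas i) \<otimes>\<^sub>k one_vertex + vertex g \<otimes>\<^sub>k arrow \<one>\<^bsub>G\<^esub> (bas i)" for i
    using D_vertex[OF g_closed] D_arrow[of i] by (simp_all add: vertex_bas)
  have unique: "\<Delta>' x = D x"
    if hom: "algebra_hom_on H M one_vertex (tensor_space H H) MM (one_vertex \<otimes>\<^sub>k one_vertex) \<Delta>'"
      and gens: "\<And>l. \<Delta>' (gen_val G g l) = D (gen_val G g l)" and x: "x \<in> H" for \<Delta>' x
  proof -
    have lin: "plinear \<Delta>'" using hom by (simp add: algebra_hom_on_def)
    \<comment> \<open>Both maps are linear and multiplicative on \<open>H\<close>, so the elements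
      on which they agree form a subalgebra; containing the generators, it is all of
      \<open>H\<close>.\<close>
    have "subalgebra_generated M e (range (gen_val G g)) \<subseteq> {x \<in> H. \<Delta>' x = D x}"
    proof (rule subalgebra_generated_least)
      show "pm.subspace {x \<in> H. \<Delta>' x = D x}"
        using subspace_H by (auto simp: pm.subspace_def plinear_zero[OF lin] plinear_add[OF lin] plinear_scale[OF lin])
      show "e \<in> {x \<in> H. \<Delta>' x = D x}"
        using hom one_in_H by (simp add: algebra_hom_on_def vertex_bas D_bas)
      show "range (gen_val G g) \<subseteq> {x \<in> H. \<Delta>' x = D x}"
        using gens H_generators subalgebra_generated_base by blast
      show "M x y \<in> {x \<in> H. \<Delta>' x = D x}" if "x \<in> {x \<in> H. \<Delta>' x = D x}" "y \<in> {x \<in> H. \<Delta>' x = D x}" for x y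
        using that hom by (simp add: algebra_hom_on_def M_in_H D_M H_pathspace)
    qed
    then show ?thesis using x H_generators by blast
  qed
  show ?thesis
    unfolding Let_def
  proof (intro conjI allI impI ballI)
    fix \<Delta>' x
    assume *: "algebra_hom_on H M one_vertex (tensor_space H H) MM (one_vertex \<otimes>\<^sub>k one_vertex) \<Delta>'
      \<and> \<Delta>' (vertex g) = vertex g \<otimes>\<^sub>k vertex g
      \<and> \<Delta>' (arrow \<one>\<^bsub>G\<^esub> (bas Va)) = arrow \<one>\<^bsub>G\<^esub> (bas Va) \<otimes>\<^sub>k one_vertex + vertex g \<otimes>\<^sub>k arrow \<one>\<^bsub>G\<^esub> (bas Va)
      \<and> \<Delta>' (arrow \<one>\<^bsub>G\<^esub> (bas Vb)) = arrow \<one>\<^bsub>G\<^esub> (bas Vb) \<otimes>\<^sub>k one_vertex + vertex g \<otimes>\<^sub>k arrow \<one>\<^bsub>G\<^esub> (bas Vb)"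
      and x: "x \<in> H"
    have "\<Delta>' (gen_val G g l) = D (gen_val G g l)" for l
      using * coproducts by (cases l) (simp_all del: arrow_bas tensor_bas)
    then show "\<Delta>' x = D x" using unique * x by blast
  qed (rule hopf_algebra_on_H pointed_on_H dim_H presented_by_H coproducts)+
qed

end
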